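(* Let $d\ge1$, $D\in\{2d,2d+1\}$, $U=D+1$, let $z_1,\dots,z_U\in[-1,1]$ be distinct points, and let $\mathbf q=(q_1,\dots,q_U)$ be the corresponding Lagrange basis of the univariate polynomials of degree at most $D$ ($q_i(z_i)=1$, $q_i(z_j)=0$ for $j\ne i$). Let $\Sigma\subset\mathbb R^U$ be the cone of coefficient vectors in the basis $\mathbf q$ of polynomials of degree at most $D$ nonnegative on $[-1,1]$ (represented as weighted sums of squares as in the context), and let $\mathbf 1$ be the coefficient vector of the constant one polynomial. Let $\mu=\max_{i=1,\dots,U}\max_{-1\le z\le1}|q_i(z)|$. Then: 1. $k_1^{\mathbf 1}:=\min\{\mathbf 1^{\mathrm T}\mathbf v\mid\mathbf v\in\Sigma^*,\ \|\mathbf v\|_\infty=1\}\ge\frac1\mu$. 2. There exist finitely many points $x_1,\dots,x_s\in[-1,1]$, unisolvent for the polynomials of degree at most $D$, and $\alpha_1,\dots,\alpha_s>0$ such that $\mathbf M=\sum_{i=1}^s\alpha_i\mathbf q(x_i)\mathbf q(x_i)^{\mathrm T}$ is the identity matrix, so $\operatorname{cond}(\mathbf M)=1$. 3. For every $\mathbf t\in\Sigma^\circ$ and $\varepsilon>0$ with $\mathbf t-\varepsilon\mathbf 1$ on the boundary of $\Sigma$, there exists an integer dual certificate $\overline{\mathbf y}\in(\Sigma^* )^\circ$ of $\mathbf t$ with $$\|\overline{\mathbf y}\|_\infty\le\frac12+\left\lceil\frac32\sqrt{2d+2}\,\|\mathbf t\|_2\right\rceil\frac{(2d+2)\mu}{\varepsilon}$$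 and $$\log\|\overline{\mathbf y}\|_\infty\le C\bigl(1+\log d+\log\|\mathbf t\|_2+\log\mu+\log(1/\varepsilon)\bigr)$$ with an absolute constant $C$ (independent of $d$, the points $z_i$, $\mathbf t$ and $\varepsilon$).
   Context: $\mathcal V_k$ denotes univariate real polynomials of degree at most $k$; $\Sigma_{2k}$ the sums of squares of elements of $\mathcal V_k$. If $D=2d$: weights $w_1=1$, $w_2=1-z^2$, degrees $(d_1,d_2)=(d,d-1)$; if $D=2d+1$: weights $w_1=1-z$, $w_2=1+z$, degrees $(d_1,d_2)=(d,d)$. In both cases $\Sigma=\{w_1\sigma_1+w_2\sigma_2:\sigma_i\in\Sigma_{2d_i}\}$, which is exactly the cone of polynomials in $\mathcal V_D$ nonnegative on $[-1,1]$. Polynomials in $\mathcal V_D$ are identified with coefficient vectors in the basis $\mathbf q$. $\Sigma^*=\{\mathbf y\in\mathbb R^U:\mathbf x^{\mathrm T}\mathbf y\ge0\ \forall\mathbf x\in\Sigma\}$. Fix any ordered bases $\mathbf p_i$ of $\mathcal V_{d_i}$; $\Lambda_i$ is the unique linear map from $\mathbb R^U$ to symmetric matrices with $\Lambda_i(\mathbf q(z))=w_i(z)\mathbf p_i(z)\mathbf p_i(z)^{\mathrm T}$ for all $z$, and $\Lambda=\Lambda_1\oplus\Lambda_2$. Then $\Sigma^*=\{\mathbf x:\Lambda(\mathbf x)\succcurlyeq0\}$ and $(\Sigma^* )^\circ=\{\mathbf x:\Lambda(\mathbf x)\succ0\}$; $^\circ$ denotes interior. Let $f(\mathbf x)=-\ln\det\Lambda(\mathbf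 x)$ on $(\Sigma^* )^\circ$, with (positive definite) Hessian $H$. A vector $\mathbf x\in(\Sigma^* )^\circ$ is a dual certificate of $\mathbf s\in\Sigma$ if $H(\mathbf x)^{-1}\mathbf s\in\Sigma^*$. A point set is unisolvent for a space of polynomials if every polynomial in it is uniquely determined by its values on the set. *)

theory Defs
  imports
    "HOL-Computational_Algebra.Polynomial"
    "HOL-Analysis.L2_Norm"
    "HOL-Analysis.Derivative"
    "HOL-Analysis.Abstract_Metric_Spaces"
    "Jordan_Normal_Form.Determinant"
    "Jordan_Normal_Form.Gauss_Jordan_Elimination"
begin

no_notation inner (infix \<open>\<bullet>\<close> 70)

text \<open>
  The dimension \<open>U = D + 1\<close> has to be quantified inside formulas, so vectors and matrices are those
  of \<open>Jordan_Normal_Form\<close>, with explicit carriers. Index sets are 0-based: the paper's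
  \<open>1, ..., U\<close> is \<open>{..D}\<close>, and \<open>q_1, ..., q_U\<close> is \<open>q 0, ..., q D\<close>.
\<close>

subsection \<open>Euclidean space, norms and matrices\<close>

definition norm2 :: "real vec \<Rightarrow> real" where
  "norm2 v = L2_set (\<lambda>i. v $ i) {..<dim_vec v}"

definition norm_inf :: "real vec \<Rightarrow> real" where
  "norm_inf v = (MAX i\<in>{..<dim_vec v}. \<bar>v $ i\<bar>)"

definition euclid_dist :: "nat \<Rightarrow> real vec \<Rightarrow> real vec \<Rightarrow> real" where
  "euclid_dist n x y = L2_set (\<lambda>i. x $ i - y $ i) {..<n}"

definition euclid_top :: "nat \<Rightarrow> real vec topology" where
  "euclid_top n = Metric_space.mtopology (carrier_vec n) (euclid_dist n)"

lemma Metric_space_euclid: "Metric_space (carrier_vec n) (euclid_dist n)"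
proof
  show "0 \<le> euclid_dist n x y" for x y
    by (simp add: euclid_dist_def)
  show "euclid_dist n x y = euclid_dist n y x" for x y
    by (simp add: euclid_dist_def L2_set_def power2_commute)
  show "euclid_dist n x y = 0 \<longleftrightarrow> x = y" if "x \<in> carrier_vec n" "y \<in> carrier_vec n" for x y
    using that by (auto simp: euclid_dist_def L2_set_eq_0_iff)
  show "euclid_dist n x z \<le> euclid_dist n x y + euclid_dist n y z"
    if "x \<in> carrier_vec n" "y \<in> carrier_vec n" "z \<in> carrier_vec n" for x y z
    using L2_set_triangle_ineq[of "\<lambda>i. x $ i - y $ i" "\<lambda>i. y $ i - z $ i" "{..<n}"]
    by (simp add: euclid_dist_def)
qed

definition dsum_mat :: "real mat \<Rightarrow> real mat \<Rightarrow> real mat" where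
  "dsum_mat A B =
     four_block_mat A (0\<^sub>m (dim_row A) (dim_col B)) (0\<^sub>m (dim_row B) (dim_col A)) B"

text \<open>The 2-norm condition number; \<open>mat_inverse\<close> is meaningful only for invertible matrices.\<close>

definition op_norm2 :: "real mat \<Rightarrow> real" where
  "op_norm2 A = (SUP v\<in>{v \<in> carrier_vec (dim_col A). norm2 v = 1}. norm2 (A *\<^sub>v v))"

definition cond_num :: "real mat \<Rightarrow> real" where
  "cond_num A = op_norm2 A * op_norm2 (the (mat_inverse A))"

definition hessian :: "nat \<Rightarrow> (real vec \<Rightarrow> real) \<Rightarrow> real vec \<Rightarrow> real mat" where
  "hessian n f x =
     (let partial = (\<lambda>i g y. deriv (\<lambda>s. g (y + s \<cdot>\<^sub>v unit_vec n i)) 0)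
      in mat n n (\<lambda>(i, j). partial i (partial j f) x))"

subsection \<open>Polynomials\<close>

definition polys_le :: "nat \<Rightarrow> real poly set" where
  "polys_le k = {p. degree p \<le> k}"

definition sos_polys :: "nat \<Rightarrow> real poly set" where
  "sos_polys k = {\<Sum>i<n. (g i)\<^sup>2 | (n :: nat) g. \<forall>i<n. g i \<in> polys_le k}"

definition unisolvent :: "real set \<Rightarrow> real poly set \<Rightarrow> bool" where
  "unisolvent X V \<longleftrightarrow> (\<forall>p\<in>V. \<forall>r\<in>V. (\<forall>x\<in>X. poly p x = poly r x) \<longrightarrow> p = r)"

definition ordered_basis :: "nat \<Rightarrow> (nat \<Rightarrow> real poly) \<Rightarrow> bool" where
  "ordered_basis k p \<longleftrightarrow>
     inj_on p {..k} \<and> \<not> Modules.module.dependent smult (p ` {..k}) \<and>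
     Modules.module.span smult (p ` {..k}) = polys_le k"

definition lagrange_basis :: "nat \<Rightarrow> (nat \<Rightarrow> real) \<Rightarrow> (nat \<Rightarrow> real poly) \<Rightarrow> bool" where
  "lagrange_basis D z q \<longleftrightarrow>
     (\<forall>i\<le>D. q i \<in> polys_le D) \<and>
     (\<forall>i\<le>D. \<forall>j\<le>D. poly (q i) (z j) = (if i = j then 1 else 0))"

definition eval_vec :: "nat \<Rightarrow> (nat \<Rightarrow> real poly) \<Rightarrow> real \<Rightarrow> real vec" where
  "eval_vec n q t = vec n (\<lambda>i. poly (q i) t)"

definition poly_of_vec :: "nat \<Rightarrow> (nat \<Rightarrow> real poly) \<Rightarrow> real vec \<Rightarrow> real poly" where
  "poly_of_vec D q x = (\<Sum>i\<le>D. smult (x $ i) (q i))"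

definition coeff_vec :: "nat \<Rightarrow> (nat \<Rightarrow> real poly) \<Rightarrow> real poly \<Rightarrow> real vec" where
  "coeff_vec D q p = (THE x. x \<in> carrier_vec (D + 1) \<and> poly_of_vec D q x = p)"

text \<open>The suprema are maxima, by continuity on a compact interval.\<close>

definition basis_max_abs :: "nat \<Rightarrow> (nat \<Rightarrow> real poly) \<Rightarrow> real" where
  "basis_max_abs D q = (MAX i\<in>{..D}. SUP t\<in>{-1..1}. \<bar>poly (q i) t\<bar>)"

subsection \<open>The cone, its dual and the barrier\<close>

definition weight1 :: "nat \<Rightarrow> real poly" where
  "weight1 D = (if even D then 1 else [:1, -1:])"

definition weight2 :: "nat \<Rightarrow> real poly" where
  "weight2 D = (if even D then [:1, 0, -1:] else [:1, 1:])"

definition deg1 :: "nat \<Rightarrow> nat" where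
  "deg1 D = D div 2"

definition deg2 :: "nat \<Rightarrow> nat" where
  "deg2 D = (if even D then D div 2 - 1 else D div 2)"

text \<open>By the theorem of Markov and Lukacs, these are exactly the polynomials of degree at most \<open>D\<close>
  that are nonnegative on \<open>[-1, 1]\<close>.\<close>

definition wsos_polys :: "nat \<Rightarrow> real poly set" where
  "wsos_polys D =
     {weight1 D * \<sigma>1 + weight2 D * \<sigma>2 | \<sigma>1 \<sigma>2.
        \<sigma>1 \<in> sos_polys (deg1 D) \<and> \<sigma>2 \<in> sos_polys (deg2 D)}"

definition wsos_cone :: "nat \<Rightarrow> (nat \<Rightarrow> real poly) \<Rightarrow> real vec set" where
  "wsos_cone D q = {x \<in> carrier_vec (D + 1). poly_of_vec D q x \<in> wsos_polys D}"

definition dual_cone :: "nat \<Rightarrow> real vec set \<Rightarrow> real vec set" where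
  "dual_cone n K = {y \<in> carrier_vec n. \<forall>x\<in>K. x \<bullet> y \<ge> 0}"

text \<open>\<open>moment_map D q w k p L\<close>: on \<open>\<real>\<^sup>D\<^sup>+\<^sup>1\<close>, \<open>L\<close> is the unique linear map into the symmetric
  matrices of order \<open>k + 1\<close> sending each \<open>q(t)\<close> to \<open>w(t) p(t) p(t)\<^sup>T\<close>.\<close>

definition moment_map ::
  "nat \<Rightarrow> (nat \<Rightarrow> real poly) \<Rightarrow> real poly \<Rightarrow> nat \<Rightarrow> (nat \<Rightarrow> real poly) \<Rightarrow>
   (real vec \<Rightarrow> real mat) \<Rightarrow> bool" where
  "moment_map D q w k p L \<longleftrightarrow>
     (\<forall>x \<in> carrier_vec (D + 1). L x \<in> carrier_mat (k + 1) (k + 1) \<and> transpose_mat (L x) = L x) \<and>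
     (\<forall>x \<in> carrier_vec (D + 1). \<forall>y \<in> carrier_vec (D + 1). L (x + y) = L x + L y) \<and>
     (\<forall>x \<in> carrier_vec (D + 1). \<forall>c. L (c \<cdot>\<^sub>v x) = c \<cdot>\<^sub>m L x) \<and>
     (\<forall>t. L (eval_vec (D + 1) q t) =
          mat (k + 1) (k + 1) (\<lambda>(a, b). poly w t * poly (p a) t * poly (p b) t))"

definition barrier :: "(real vec \<Rightarrow> real mat) \<Rightarrow> (real vec \<Rightarrow> real mat) \<Rightarrow> real vec \<Rightarrow> real" where
  "barrier L1 L2 x = - ln (det (dsum_mat (L1 x) (L2 x)))"

definition dual_certificate ::
  "nat \<Rightarrow> (nat \<Rightarrow> real poly) \<Rightarrow> (real vec \<Rightarrow> real mat) \<Rightarrow> (real vec \<Rightarrow> real mat) \<Rightarrow>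
   real vec \<Rightarrow> real vec \<Rightarrow> bool" where
  "dual_certificate D q L1 L2 s x \<longleftrightarrow>
     s \<in> wsos_cone D q \<and>
     x \<in> euclid_top (D + 1) interior_of dual_cone (D + 1) (wsos_cone D q) \<and>
     the (mat_inverse (hessian (D + 1) (barrier L1 L2) x)) *\<^sub>v s
       \<in> dual_cone (D + 1) (wsos_cone D q)"

end

theory Submission
  imports
    Defs
    "HOL-Computational_Algebra.Fundamental_Theorem_Algebra"
    "HOL-Analysis.Function_Topology"
begin

no_notation inner (infix \<open>\<bullet>\<close> 70)
no_notation Finite_Cartesian_Product.vec.vec_nth (infixl \<open>$\<close> 90)

text \<open>
  By Markov-Lukacs, \<open>\<mu> \<plusminus> q\<^sub>i\<close> lies in \<open>\<Sigma>\<close>, so \<open>\<bar>v\<^sub>i\<bar> \<le> \<mu> (1 \<bullet> v)\<close> for \<open>v\<close> in the dual cone; this is part 1. For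
  part 2 take the interpolation nodes themselves with unit weights.

  For part 3 put \<open>N = 3/2 sqrt (2d + 2) \<parallel>t\<parallel>\<close> and let \<open>y\<close> be the point with \<open>-g(y) = t / N\<close>, obtained by
  maximising \<open>det \<Lambda>\<close> on a compact slice of the dual cone. Since \<open>t - \<epsilon> 1\<close> is in the closed cone,
  \<open>1 \<bullet> y \<le> N U / \<epsilon>\<close>, which bounds \<open>y\<close> by part 1. Each \<open>\<Lambda>(e\<^sub>i)\<close> is positive semidefinite, so the
  local norm of \<open>e\<^sub>i\<close> at \<open>y\<close> is at most \<open>t\<^sub>i / N\<close>, and rounding \<open>y\<close> to the nearest integer vector \<open>x\<close> moves it by at
  most \<open>1/3\<close> in this norm. Finally the local norm at \<open>x\<close> of \<open>g(x) - g(y)\<close> is at most that of \<open>x - y\<close> at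
  \<open>y\<close>, so the preimage of \<open>t / N\<close> under \<open>H(x)\<close> is in the Dikin ellipsoid around \<open>x\<close>.

  \<open>N\<close> is not rounded up: the integer vector must satisfy the logarithmic bound too, which would
  fail for small \<open>\<parallel>t\<parallel>\<close> if \<open>y\<close> were scaled by the ceiling.
\<close>

section \<open>Weighted sums of squares and the Markov-Lukacs theorem\<close>

text \<open>The two blocks of \<open>\<Lambda>\<close> have orders adding up to
  \<open>D + 1\<close>, the number of coordinates. Hence testing the gradient condition at
  \<open>y\<close> itself yields the trace of an identity matrix of known order, and this scalar
  equation controls the size of \<open>y\<close>. Comparing local norms at two points by
  self-concordance would cost a factor. For \<open>-ln det\<close> none is lost: relative to the
  inner product at \<open>A\<close>, the difference of the gradients at \<open>B\<close> and
  \<open>A\<close> is represented by \<open>A B^-1 A - A\<close>, whose local norm at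
  \<open>A\<close> equals that of \<open>A - B\<close> at \<open>B\<close> exactly. Any rounding
  error below one is therefore good enough. In the logarithmic bound neither
  \<open>ln (norm2 t)\<close> nor \<open>ln (1 / \<epsilon>)\<close> has a sign of its own. Their
  sum has one, because evaluation at a node lies in the dual cone and gives
  \<open>\<epsilon> \<le> t $ i\<close>. Markov-Lukacs rests on multiplicativity: the cones for
  degrees \<open>m\<close> and \<open>n\<close> multiply into the cone for \<open>m + n\<close>, so
  it suffices to place linear and quadratic factors.\<close>

lemma polys_le_iff [simp]: "p \<in> polys_le k \<longleftrightarrow> degree p \<le> k"
  by (simp add: polys_le_def)

text \<open>Squares generate the cone, so a property that survives adding one square holds
  throughout; later proofs need not handle the representing family.\<close>

lemma sos_induct [consumes 1, case_names zero add_square]: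
  assumes "a \<in> sos_polys k" and "P 0"
    and step: "\<And>a g. a \<in> sos_polys k \<Longrightarrow> P a \<Longrightarrow> degree g \<le> k \<Longrightarrow> P (a + g\<^sup>2)"
  shows "P a"
proof -
  from assms(1) obtain n g where a: "a = (\<Sum>i<n. (g i)\<^sup>2)" and g: "\<forall>i<(n::nat). degree (g i) \<le> k"
    by (auto simp: sos_polys_def)
  have "P (\<Sum>i<m. (g i)\<^sup>2)" if "m \<le> n" for m
    using that
  proof (induction m)
    case (Suc m)
    have "(\<Sum>i<m. (g i)\<^sup>2) \<in> sos_polys k"
      using g Suc.prems unfolding sos_polys_def by fastforce
    then show ?case using Suc g by (simp add: step)
  qed (simp add: assms(2))
  then show ?thesis using a by simp
qed

lemma sos_zero: "0 \<in> sos_polys k"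
  unfolding sos_polys_def by (rule CollectI, rule exI[of _ 0]) simp

lemma sos_add_square:
  assumes "a \<in> sos_polys k" "degree g \<le> k"
  shows "a + g\<^sup>2 \<in> sos_polys k"
proof -
  from assms(1) obtain n f where a: "a = (\<Sum>i<n. (f i)\<^sup>2)" and f: "\<forall>i<(n::nat). degree (f i) \<le> k"
    by (auto simp: sos_polys_def)
  have "a + g\<^sup>2 = (\<Sum>i<Suc n. ((f(n := g)) i)\<^sup>2)"
    by (simp add: a)
  moreover have "\<forall>i<Suc n. (f(n := g)) i \<in> polys_le k"
    using f assms(2) by (auto simp: less_Suc_eq)
  ultimately show ?thesis unfolding sos_polys_def by blast
qed

lemma sos_square: "degree g \<le> k \<Longrightarrow> g\<^sup>2 \<in> sos_polys k"
  using sos_add_square[OF sos_zero] by simp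

lemma sos_add: "b \<in> sos_polys k \<Longrightarrow> a \<in> sos_polys k \<Longrightarrow> a + b \<in> sos_polys k"
  by (induction b rule: sos_induct) (auto simp: add.assoc[symmetric] sos_add_square)

lemma sos_mult_square:
  assumes "a \<in> sos_polys k" "degree g + k \<le> m"
  shows "g\<^sup>2 * a \<in> sos_polys m"
  using assms(1)
proof (induction rule: sos_induct)
  case (add_square a h)
  have "degree (g * h) \<le> m"
    using degree_mult_le[of g h] add_square.hyps(2) assms(2) by linarith
  then show ?case
    using sos_add_square[OF add_square.IH, of "g * h"] by (simp add: distrib_left power_mult_distrib)
qed (simp add: sos_zero)

lemma sos_mult:
  assumes "a \<in> sos_polys k" "b \<in> sos_polys l" "k + l \<le> m"
  shows "a * b \<in> sos_polys m"
  using assms(1)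
proof (induction rule: sos_induct)
  case (add_square a g)
  have "g\<^sup>2 * b \<in> sos_polys m"
    using assms add_square by (intro sos_mult_square) auto
  then show ?case using add_square by (simp add: distrib_right sos_add)
qed (simp add: sos_zero)

lemma sos_const: "c \<ge> 0 \<Longrightarrow> [:c:] \<in> sos_polys k"
  using sos_square[of "[:sqrt c:]" k] by (simp add: power2_eq_square)

lemma sos_smult: "a \<in> sos_polys k \<Longrightarrow> c \<ge> 0 \<Longrightarrow> smult c a \<in> sos_polys k"
  using sos_mult[OF sos_const[of c 0], of a k k] by simp

lemma sos_nonneg: "a \<in> sos_polys k \<Longrightarrow> poly a x \<ge> 0"
  by (induction rule: sos_induct) auto

lemma sos_degree: "a \<in> sos_polys k \<Longrightarrow> degree a \<le> 2 * k"
proof (induction rule: sos_induct)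
  case (add_square a g)
  have "degree (g\<^sup>2) \<le> 2 * k"
    using degree_power_le[of g 2] add_square.hyps(2) by linarith
  then show ?case using add_square degree_add_le by blast
qed simp

section \<open>Weighted cones in both parities and their products\<close>

lemma wsos_even_iff:
  "p \<in> wsos_polys (2 * n) \<longleftrightarrow>
    (\<exists>\<sigma>\<in>sos_polys n. \<exists>\<tau>\<in>sos_polys (n - 1). p = \<sigma> + [:1, -1:] * [:1, 1:] * \<tau>)"
  unfolding wsos_polys_def weight1_def weight2_def deg1_def deg2_def by auto

lemma wsos_odd_iff:
  "p \<in> wsos_polys (Suc (2 * n)) \<longleftrightarrow>
    (\<exists>\<sigma>\<in>sos_polys n. \<exists>\<tau>\<in>sos_polys n. p = [:1, -1:] * \<sigma> + [:1, 1:] * \<tau>)"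
  unfolding wsos_polys_def weight1_def weight2_def deg1_def deg2_def by auto

text \<open>A product of two terms carries the weight 1, \<open>u * v\<close> or
  \<open>(u * v)^2\<close>, and the last one, being a square, is absorbed by the unweighted part.
  Positivity of \<open>m\<close> and \<open>n\<close> makes \<open>m - 1\<close> and
  \<open>n - 1\<close> true subtractions, so that the degrees fit.\<close>

lemma wsos_mult_even_even:
  assumes "p \<in> wsos_polys (2 * m)" "r \<in> wsos_polys (2 * n)" "m > 0" "n > 0"
  shows "p * r \<in> wsos_polys (2 * (m + n))"
proof -
  define u v :: "real poly" where "u = [:1, -1:]" and "v = [:1, 1:]"
  have deg: "degree (u * v) \<le> 2"
    by (simp add: u_def v_def)
  obtain \<sigma> \<tau> where p: "\<sigma> \<in> sos_polys m" "\<tau> \<in> sos_polys (m - 1)" "p = \<sigma> + u * v * \<tau>"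
    using assms(1) unfolding wsos_even_iff u_def v_def by blast
  obtain \<sigma>' \<tau>' where r: "\<sigma>' \<in> sos_polys n" "\<tau>' \<in> sos_polys (n - 1)" "r = \<sigma>' + u * v * \<tau>'"
    using assms(2) unfolding wsos_even_iff u_def v_def by blast
  have "p * r = (\<sigma> * \<sigma>' + (u * v)\<^sup>2 * (\<tau> * \<tau>')) + u * v * (\<sigma> * \<tau>' + \<tau> * \<sigma>')"
    unfolding p r by (simp only: power2_eq_square algebra_simps)
  moreover have "\<sigma> * \<sigma>' + (u * v)\<^sup>2 * (\<tau> * \<tau>') \<in> sos_polys (m + n)"
    by (intro sos_add sos_mult_square[of _ "m - 1 + (n - 1)"] sos_mult[OF p(1) r(1)]
        sos_mult[OF p(2) r(2)]) (use deg assms in auto)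
  moreover have "\<sigma> * \<tau>' + \<tau> * \<sigma>' \<in> sos_polys (m + n - 1)"
    by (intro sos_add sos_mult[OF p(1) r(2)] sos_mult[OF p(2) r(1)]) (use assms in auto)
  ultimately show ?thesis unfolding wsos_even_iff u_def v_def by blast
qed

text \<open>Equal linear weights multiply to squares and different ones to \<open>u * v\<close>,
  which is the second weight of an even cone.\<close>

lemma wsos_mult_odd_odd:
  assumes "p \<in> wsos_polys (Suc (2 * m))" "r \<in> wsos_polys (Suc (2 * n))"
  shows "p * r \<in> wsos_polys (2 * Suc (m + n))"
proof -
  define u v :: "real poly" where "u = [:1, -1:]" and "v = [:1, 1:]"
  have deg: "degree u = 1" "degree v = 1"
    by (simp_all add: u_def v_def)
  obtain \<sigma> \<tau> where p: "\<sigma> \<in> sos_polys m" "\<tau> \<in> sos_polys m" "p = u * \<sigma> + v * \<tau>"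
    using assms(1) unfolding wsos_odd_iff u_def v_def by blast
  obtain \<sigma>' \<tau>' where r: "\<sigma>' \<in> sos_polys n" "\<tau>' \<in> sos_polys n" "r = u * \<sigma>' + v * \<tau>'"
    using assms(2) unfolding wsos_odd_iff u_def v_def by blast
  have "p * r = (u\<^sup>2 * (\<sigma> * \<sigma>') + v\<^sup>2 * (\<tau> * \<tau>')) + u * v * (\<sigma> * \<tau>' + \<tau> * \<sigma>')"
    unfolding p r by (simp only: power2_eq_square algebra_simps)
  moreover have "u\<^sup>2 * (\<sigma> * \<sigma>') + v\<^sup>2 * (\<tau> * \<tau>') \<in> sos_polys (Suc (m + n))"
    by (intro sos_add sos_mult_square[of _ "m + n"] sos_mult[OF p(1) r(1)] sos_mult[OF p(2) r(2)])
      (use deg in auto)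
  moreover have "\<sigma> * \<tau>' + \<tau> * \<sigma>' \<in> sos_polys (Suc (m + n) - 1)"
    by (intro sos_add sos_mult[OF p(1) r(2)] sos_mult[OF p(2) r(1)]) auto
  ultimately show ?thesis unfolding wsos_even_iff u_def v_def by blast
qed

lemma wsos_mult_even_odd:
  assumes "p \<in> wsos_polys (2 * m)" "r \<in> wsos_polys (Suc (2 * n))" "m > 0"
  shows "p * r \<in> wsos_polys (Suc (2 * (m + n)))"
proof -
  define u v :: "real poly" where "u = [:1, -1:]" and "v = [:1, 1:]"
  have deg: "degree u = 1" "degree v = 1"
    by (simp_all add: u_def v_def)
  obtain \<sigma> \<tau> where p: "\<sigma> \<in> sos_polys m" "\<tau> \<in> sos_polys (m - 1)" "p = \<sigma> + u * v * \<tau>"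
    using assms(1) unfolding wsos_even_iff u_def v_def by blast
  obtain \<sigma>' \<tau>' where r: "\<sigma>' \<in> sos_polys n" "\<tau>' \<in> sos_polys n" "r = u * \<sigma>' + v * \<tau>'"
    using assms(2) unfolding wsos_odd_iff u_def v_def by blast
  have "p * r = u * (\<sigma> * \<sigma>' + v\<^sup>2 * (\<tau> * \<tau>')) + v * (\<sigma> * \<tau>' + u\<^sup>2 * (\<tau> * \<sigma>'))"
    unfolding p r by (simp only: power2_eq_square algebra_simps)
  moreover have "\<sigma> * \<sigma>' + v\<^sup>2 * (\<tau> * \<tau>') \<in> sos_polys (m + n)"
    by (intro sos_add sos_mult_square[of _ "m - 1 + n"] sos_mult[OF p(1) r(1)] sos_mult[OF p(2) r(2)])
      (use deg assms in auto)
  moreover have "\<sigma> * \<tau>' + u\<^sup>2 * (\<tau> * \<sigma>') \<in> sos_polys (m + n)"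
    by (intro sos_add sos_mult_square[of _ "m - 1 + n"] sos_mult[OF p(1) r(2)] sos_mult[OF p(2) r(1)])
      (use deg assms in auto)
  ultimately show ?thesis unfolding wsos_odd_iff u_def v_def by blast
qed

text \<open>Positive degrees matter: subtraction in \<open>deg2\<close> truncates, so the cone for
  degree 0 contains \<open>1 - z^2\<close>, and its products with the cone for degree 1 would leave
  the latter.\<close>

lemma wsos_mult:
  assumes "p \<in> wsos_polys m" "r \<in> wsos_polys n" "m > 0" "n > 0"
  shows "p * r \<in> wsos_polys (m + n)"
proof -
  \<comment> \<open>The case of odd \<open>m\<close> and even \<open>n\<close> is left out here;
    swapping the factors reduces it to a case that is included.\<close>
  have "p * r \<in> wsos_polys (m + n)"
    if "p \<in> wsos_polys m" "r \<in> wsos_polys n" "m > 0" "n > 0" "even m \<or> odd n"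
    for p r m n
  proof (cases "even m")
    case True
    then obtain a where a: "m = 2 * a" by (rule evenE)
    show ?thesis
    proof (cases "even n")
      case True
      then obtain b where "n = 2 * b" by (rule evenE)
      then show ?thesis using wsos_mult_even_even[of p a r b] that a by (simp add: distrib_left)
    next
      case False
      then obtain b where "n = Suc (2 * b)" by (metis oddE Suc_eq_plus1)
      then show ?thesis using wsos_mult_even_odd[of p a r b] that a by (simp add: distrib_left)
    qed
  next
    case False
    moreover from this have "odd n"
      using \<open>even m \<or> odd n\<close> by simp
    ultimately obtain a b where "m = Suc (2 * a)" "n = Suc (2 * b)"
      by (metis oddE Suc_eq_plus1)
    then show ?thesis using wsos_mult_odd_odd[of p a r b] that by (simp add: distrib_left)
  qed
  from this[of p m r n] this[of r n p m] show ?thesis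
    using assms by (auto simp: add.commute mult.commute)
qed

lemma wsos_smult:
  assumes "p \<in> wsos_polys n" "c \<ge> 0"
  shows "smult c p \<in> wsos_polys n"
proof -
  obtain \<sigma> \<tau> where "\<sigma> \<in> sos_polys (deg1 n)" "\<tau> \<in> sos_polys (deg2 n)"
      "p = weight1 n * \<sigma> + weight2 n * \<tau>"
    using assms(1) by (auto simp: wsos_polys_def)
  then have "smult c p = weight1 n * smult c \<sigma> + weight2 n * smult c \<tau>"
      "smult c \<sigma> \<in> sos_polys (deg1 n)" "smult c \<tau> \<in> sos_polys (deg2 n)"
    using assms(2) by (simp_all add: smult_add_right sos_smult)
  then show ?thesis unfolding wsos_polys_def by blast
qed

lemma wsos_const:
  assumes "c \<ge> 0" shows "[:c:] \<in> wsos_polys n"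
proof (cases "even n")
  case True
  then show ?thesis
    using assms sos_const[of c] sos_zero by (elim evenE) (force simp: wsos_even_iff)
next
  case False
  have "[:c:] = [:1, -1:] * [:c/2:] + [:1, 1:] * [:c/2:]" by simp
  moreover have "[:c/2:] \<in> sos_polys m" for m
    using assms by (simp add: sos_const)
  ultimately have "[:c:] \<in> wsos_polys (Suc (2 * m))" for m
    unfolding wsos_odd_iff by blast
  then show ?thesis using False by (elim oddE) simp
qed

lemma wsos_sos: "p \<in> sos_polys n \<Longrightarrow> p \<in> wsos_polys (2 * n)"
  unfolding wsos_even_iff by (rule bexI[of _ p], rule bexI[of _ 0]) (simp_all add: sos_zero)

lemma wsos_linear:
  assumes "\<bar>c\<bar> \<le> 1" shows "[:1, c:] \<in> wsos_polys 1"
proof -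
  have "[:1, c:] = [:1, -1:] * [:(1 - c) / 2:] + [:1, 1:] * [:(1 + c) / 2:]"
    by (simp add: field_simps)
  moreover have "[:(1 - c) / 2:] \<in> sos_polys 0" "[:(1 + c) / 2:] \<in> sos_polys 0"
    using assms by (auto intro!: sos_const)
  ultimately show ?thesis
    using wsos_odd_iff[of "[:1, c:]" 0] unfolding One_nat_def mult_0_right by blast
qed

lemma wsos_nonneg:
  assumes "p \<in> wsos_polys n" "x \<in> {-1..1}"
  shows "poly p x \<ge> 0"
proof -
  obtain \<sigma> \<tau> where p: "\<sigma> \<in> sos_polys (deg1 n)" "\<tau> \<in> sos_polys (deg2 n)"
      "p = weight1 n * \<sigma> + weight2 n * \<tau>"
    using assms(1) by (auto simp: wsos_polys_def)
  have "x * x \<le> 1"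
    using assms(2) abs_square_le_1[of x] by (simp add: abs_le_iff power2_eq_square)
  then have "poly (weight1 n) x \<ge> 0" "poly (weight2 n) x \<ge> 0"
    using assms(2) by (auto simp: weight1_def weight2_def)
  then show ?thesis using p by (simp add: sos_nonneg)
qed

text \<open>Dividing by a factor that vanishes at \<open>a\<close> leaves the sign of the quotient
  at \<open>a\<close> open; a one-sided limit settles it. The side is chosen to stay inside the
  interval, which matters when \<open>a\<close> is an endpoint.\<close>

lemma poly_nonneg_except_point:
  fixes p :: "real poly"
  assumes nn: "\<And>x. x \<in> {-1..1} \<Longrightarrow> x \<noteq> a \<Longrightarrow> poly p x \<ge> 0" and x: "x \<in> {-1..1}"
  shows "poly p x \<ge> 0"
proof (cases "x = a")
  case True
  have lim: "(poly p \<longlongrightarrow> poly p a) (at_left a)" "(poly p \<longlongrightarrow> poly p a) (at_right a)"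
    using poly_isCont[where p = p and x = a] by (simp_all add: isCont_def filterlim_at_split)
  show ?thesis
  proof (cases "a < 1")
    case True
    have "eventually (\<lambda>y. poly p y \<ge> 0) (at_right a)"
      using eventually_at_right_real[OF True] by eventually_elim (use x \<open>x = a\<close> in \<open>auto intro: nn\<close>)
    then show ?thesis
      using lim(2) \<open>x = a\<close> tendsto_lowerbound trivial_limit_at_right_real by blast
  next
    case False
    then have "-1 < a" using x \<open>x = a\<close> by simp
    have "eventually (\<lambda>y. poly p y \<ge> 0) (at_left a)"
      using eventually_at_left_real[OF \<open>-1 < a\<close>] by eventually_elim (use x \<open>x = a\<close> in \<open>auto intro: nn\<close>)
    then show ?thesis
      using lim(1) \<open>x = a\<close> tendsto_lowerbound trivial_limit_at_left_real by blast
  qed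
qed (use nn x in auto)

section \<open>Real polynomials at complex points\<close>

lemma map_poly_of_real_add:
  "map_poly complex_of_real (p + r) = map_poly complex_of_real p + map_poly complex_of_real r"
  by (rule poly_eqI) (simp add: coeff_map_poly)

lemma map_poly_of_real_mult:
  "map_poly complex_of_real (p * r) = map_poly complex_of_real p * map_poly complex_of_real r"
  by (rule poly_eqI) (simp add: coeff_map_poly coeff_mult)

lemma poly_map_poly_of_real:
  "poly (map_poly complex_of_real p) (of_real x) = of_real (poly p x)"
  by (induction p) (simp_all add: map_poly_pCons)

text \<open>The divisor is the product of \<open>X - w\<close> and its conjugate. The remainder is
  real, of degree at most one, and vanishes at the non-real \<open>w\<close>: the imaginary part
  kills its slope, then the real part its constant.\<close>

lemma real_poly_complex_root_factor:
  fixes p :: "real poly"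
  assumes root: "poly (map_poly complex_of_real p) w = 0" and im: "Im w \<noteq> 0"
  shows "[:(cmod w)\<^sup>2, - 2 * Re w, 1:] dvd p"
proof -
  define l where "l = [:(cmod w)\<^sup>2, - 2 * Re w, 1:]"
  define r where "r = p mod l"
  have l: "poly (map_poly complex_of_real l) w = 0"
    unfolding l_def by (simp add: complex_eq_iff cmod_def power2_eq_square algebra_simps map_poly_pCons)
  have "map_poly complex_of_real p =
      map_poly complex_of_real (p div l) * map_poly complex_of_real l + map_poly complex_of_real r"
    unfolding r_def by (metis map_poly_of_real_add map_poly_of_real_mult div_mult_mod_eq)
  then have 0: "poly (map_poly complex_of_real r) w = 0"
    using root l by simp
  have "degree r < 2"
    using degree_mod_less[of l p] by (auto simp: r_def l_def)
  then have "r = [:coeff r 0, coeff r 1:]"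
    by (intro poly_eqI) (auto simp: coeff_pCons coeff_eq_0 split: nat.split)
  then obtain a b where r: "r = [:a, b:]" by blast
  have "complex_of_real a + w * complex_of_real b = 0"
    using 0 by (simp add: r map_poly_pCons)
  then have "b = 0" "a = 0" using im by (auto simp: complex_eq_iff)
  then have "r = 0" using r by simp
  then show ?thesis unfolding r_def l_def by (simp add: dvd_eq_mod_eq_0)
qed

text \<open>Split off a factor of degree \<open>k\<close> lying in the cone for \<open>k\<close>,
  apply induction to the quotient, and multiply. The bound \<open>n\<close> varies along the
  induction, since the quotient belongs to the cone for \<open>n - k\<close>. A real root outside
  the open interval gives a linear factor, an interior root a squared one, a pair of complex roots a
  sum of two squares.\<close>

theorem Markov_Lukacs:
  assumes "n > 0" "degree p \<le> n" "\<And>x. x \<in> {-1..1} \<Longrightarrow> poly p x \<ge> 0"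
  shows "p \<in> wsos_polys n"
  using assms
proof (induction "degree p" arbitrary: p n rule: less_induct)
  case less
  \<comment> \<open>The factor may vanish at one point \<open>a\<close> of the interval, where the
    sign of the quotient comes from continuity. For \<open>n = k\<close> the quotient is a constant,
    and the exceptional cone for degree 0 is bypassed.\<close>
  have factor: "p \<in> wsos_polys n"
    if p: "p = l * r" and l: "l \<in> wsos_polys k" "degree l = k" "k > 0" and p0: "p \<noteq> 0"
      and pos: "\<And>x. x \<in> {-1..1} \<Longrightarrow> x \<noteq> a \<Longrightarrow> poly l x > 0" for l r k a
  proof -
    have r: "poly r x \<ge> 0" if "x \<in> {-1..1}" for x
    proof (rule poly_nonneg_except_point[OF _ that])
      show "poly r y \<ge> 0" if "y \<in> {-1..1}" "y \<noteq> a" for y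
        using less.prems(3)[of y] pos[of y] that p by (simp add: zero_le_mult_iff)
    qed
    have deg: "degree p = k + degree r"
      using p p0 l by (auto simp: degree_mult_eq)
    show ?thesis
    proof (cases "n = k")
      case True
      then have "degree r = 0" using deg less.prems(2) by simp
      then obtain c where c: "r = [:c:]" by (rule degree_eq_zeroE)
      then have "c \<ge> 0" using r[of 0] by simp
      then show ?thesis using wsos_smult[of l k c] l p c True by simp
    next
      case False
      then have "n - k > 0" "degree r \<le> n - k" using deg less.prems(2) by auto
      then have "r \<in> wsos_polys (n - k)"
        using deg l r by (intro less.hyps) auto
      then have "l * r \<in> wsos_polys (k + (n - k))"
        using l \<open>n - k > 0\<close> by (intro wsos_mult) auto
      then show ?thesis using p \<open>n - k > 0\<close> by simp
    qed
  qed
  consider (zero) "p = 0" | (const) "p \<noteq> 0" "degree p = 0" | (root) a where "p \<noteq> 0" "poly p a = 0"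
    | (noroot) "degree p > 0" "\<And>a. poly p a \<noteq> 0"
    by fastforce
  then show ?case
  proof cases
    case zero
    then show ?thesis using wsos_const[of 0 n] by simp
  next
    case const
    then obtain c where "p = [:c:]" by (metis degree_eq_zeroE)
    then show ?thesis using less.prems(3)[of 0] wsos_const[of c n] by simp
  next
    case root
    then obtain r where r: "p = [:-a, 1:] * r" by (metis dvdE poly_eq_0_iff_dvd)
    consider "a \<ge> 1" | "a \<le> -1" | "-1 < a" "a < 1" by linarith
    then show ?thesis
    proof cases
      case 1
      show ?thesis
      \<comment> \<open>Normalised to \<open>1 - x / a\<close>, the root factor has slope of modulus
        at most one; on the interval it can vanish only at 1, namely when
        \<open>a = 1\<close>.\<close>
      proof (rule factor[where k = 1 and a = 1])
        show "p = [:1, - (1 / a):] * smult (-a) r"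
          using r 1 by (simp add: field_simps)
        show "[:1, - (1 / a):] \<in> wsos_polys 1" using 1 by (intro wsos_linear) (simp add: abs_le_iff field_simps)
      qed (use 1 root in \<open>auto simp: field_simps\<close>)
    next
      case 2
      show ?thesis
      proof (rule factor[where k = 1 and a = "-1"])
        show "p = [:1, - (1 / a):] * smult (-a) r"
          using r 2 by (simp add: field_simps)
        show "[:1, - (1 / a):] \<in> wsos_polys 1" using 2 by (intro wsos_linear) (simp add: abs_le_iff field_simps)
      qed (use 2 root in \<open>auto simp: field_simps\<close>)
    next
      case 3
      \<comment> \<open>The quotient changes sign at an interior root, so the root is double.\<close>
      have sgn: "(x - a) * poly r x \<ge> 0" if "x \<in> {-1..1}" for x
        using less.prems(3)[OF that] r by (simp add: algebra_simps)
      have "poly r a = 0"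
      proof (rule antisym)
        have lim: "(poly r \<longlongrightarrow> poly r a) (at_left a)" "(poly r \<longlongrightarrow> poly r a) (at_right a)"
          using poly_isCont[where p = r and x = a] by (simp_all add: isCont_def filterlim_at_split)
        have "eventually (\<lambda>x. poly r x \<ge> 0) (at_right a)"
          using eventually_at_right_less[of a] eventually_at_right_real[OF 3(2)]
        proof eventually_elim
          case (elim x)
          then show ?case using sgn[of x] 3 by (auto simp: zero_le_mult_iff)
        qed
        then show "poly r a \<ge> 0" using lim(2) by (intro tendsto_lowerbound) auto
        have "eventually (\<lambda>x. poly r x \<le> 0) (at_left a)"
          using eventually_at_left_real[OF 3(1)]
        proof eventually_elim
          case (elim x)
          then show ?case using sgn[of x] 3 by (auto simp: zero_le_mult_iff)
        qed
        then show "poly r a \<le> 0" using lim(1) by (intro tendsto_upperbound) auto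
      qed
      then obtain r' where r': "r = [:-a, 1:] * r'" by (metis dvdE poly_eq_0_iff_dvd)
      show ?thesis
      proof (rule factor[where k = 2 and a = a])
        show "p = [:-a, 1:]\<^sup>2 * r'"
          unfolding r r' by (simp only: power2_eq_square mult.assoc)
        show "[:-a, 1:]\<^sup>2 \<in> wsos_polys 2"
          using wsos_sos[of _ 1] sos_square[of "[:-a, 1:]" 1] by simp
      qed (use root in \<open>auto simp: degree_power_eq\<close>)
    qed
  next
    case noroot
    have "degree (map_poly complex_of_real p) > 0"
      using noroot by (simp add: degree_map_poly)
    then obtain w where w: "poly (map_poly complex_of_real p) w = 0"
      using fundamental_theorem_of_algebra[of "map_poly complex_of_real p"]
      by (auto simp: constant_degree)
    have im: "Im w \<noteq> 0"
    proof
      assume "Im w = 0"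
      then have "w = of_real (Re w)" by (simp add: complex_eq_iff)
      then have "complex_of_real (poly p (Re w)) = 0"
        using w by (metis poly_map_poly_of_real)
      then show False using noroot by simp
    qed
    define l where "l = [:(cmod w)\<^sup>2, - 2 * Re w, 1:]"
    from real_poly_complex_root_factor[OF w im] obtain r where r: "p = l * r"
      unfolding l_def by (rule dvdE)
    have l: "l = [:Im w:]\<^sup>2 + [:- Re w, 1:]\<^sup>2"
      by (simp add: l_def cmod_power2) (simp add: power2_eq_square)
    show ?thesis
    \<comment> \<open>The factor is positive everywhere, so the exceptional point is put outside the
      interval.\<close>
    proof (rule factor[where k = 2 and a = 2, OF r])
      have "l \<in> sos_polys 1"
        unfolding l by (intro sos_add_square sos_square) auto
      then show "l \<in> wsos_polys 2" using wsos_sos[of l 1] by simp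
      show "poly l x > 0" for x
        unfolding l using im by (simp add: sum_power2_gt_zero_iff)
    qed (use noroot in \<open>auto simp: l_def\<close>)
  qed
qed

section \<open>Positive definite matrices and local norms\<close>

definition mtrace :: "real mat \<Rightarrow> real" where
  "mtrace A = (\<Sum>i<dim_row A. A $$ (i, i))"

lemma mtrace_mult:
  assumes "A \<in> carrier_mat n m" "B \<in> carrier_mat m n"
  shows "mtrace (A * B) = (\<Sum>i<n. \<Sum>j<m. A $$ (i, j) * B $$ (j, i))"
  using assms by (auto simp: mtrace_def scalar_prod_def atLeast0LessThan intro!: sum.cong)

lemma mtrace_comm:
  assumes "A \<in> carrier_mat n m" "B \<in> carrier_mat m n"
  shows "mtrace (A * B) = mtrace (B * A)"
  unfolding mtrace_mult[OF assms] mtrace_mult[OF assms(2,1)]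
  by (subst sum.swap) (simp add: mult.commute)

lemma mtrace_add:
  assumes "A \<in> carrier_mat n n" "B \<in> carrier_mat n n"
  shows "mtrace (A + B) = mtrace A + mtrace B"
  using assms by (auto simp: mtrace_def sum.distrib)

lemma mtrace_minus:
  assumes "A \<in> carrier_mat n n" "B \<in> carrier_mat n n"
  shows "mtrace (A - B) = mtrace A - mtrace B"
  using assms by (auto simp: mtrace_def sum_subtractf)

lemma mtrace_smult: "A \<in> carrier_mat n n \<Longrightarrow> mtrace (c \<cdot>\<^sub>m A) = c * mtrace A"
  by (auto simp: mtrace_def sum_distrib_left)

lemma mtrace_one: "mtrace (1\<^sub>m n) = real n"
  by (simp add: mtrace_def)

definition outer :: "real vec \<Rightarrow> real vec \<Rightarrow> real mat" where
  "outer a b = mat (dim_vec a) (dim_vec b) (\<lambda>(i, j). a $ i * b $ j)"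

lemma outer_carrier: "a \<in> carrier_vec n \<Longrightarrow> b \<in> carrier_vec m \<Longrightarrow> outer a b \<in> carrier_mat n m"
  by (auto simp: outer_def)

lemma transpose_outer: "(outer a b)\<^sup>T = outer b a"
  by (rule eq_matI) (auto simp: outer_def)

lemma mult_outer:
  assumes "A \<in> carrier_mat k n" "a \<in> carrier_vec n"
  shows "A * outer a b = outer (A *\<^sub>v a) b"
  using assms by (intro eq_matI) (auto simp: outer_def scalar_prod_def sum_distrib_right mult.assoc)

lemma outer_mult_vec:
  assumes "v \<in> carrier_vec m" "b \<in> carrier_vec m"
  shows "outer a b *\<^sub>v v = (b \<bullet> v) \<cdot>\<^sub>v a"
  using assms by (intro eq_vecI) (auto simp: outer_def scalar_prod_def sum_distrib_right sum_distrib_left mult_ac)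

lemma mtrace_outer: "a \<in> carrier_vec n \<Longrightarrow> b \<in> carrier_vec n \<Longrightarrow> mtrace (outer a b) = b \<bullet> a"
  by (auto simp: mtrace_def outer_def scalar_prod_def atLeast0LessThan mult.commute)

text \<open>A total function, unlike \<open>mat_inverse\<close>, with entries that are cofactors
  divided by the determinant; continuity in the matrix can be read off.\<close>

definition minv :: "real mat \<Rightarrow> real mat" where
  "minv A = (1 / det A) \<cdot>\<^sub>m adj_mat A"

lemma minv:
  assumes A: "A \<in> carrier_mat n n" and "det A \<noteq> 0"
  shows "minv A \<in> carrier_mat n n" "A * minv A = 1\<^sub>m n" "minv A * A = 1\<^sub>m n"
  using adj_mat[OF A] assms(2) A unfolding minv_def
  by (auto simp: mult_smult_distrib mult_smult_assoc_mat[of _ n n _ n])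

lemma minv_unique:
  assumes A: "A \<in> carrier_mat n n" and d: "det A \<noteq> 0" and B: "B \<in> carrier_mat n n" "A * B = 1\<^sub>m n"
  shows "B = minv A"
proof -
  have "B = (minv A * A) * B" using minv[OF A d] B by simp
  also have "\<dots> = minv A * (A * B)" by (rule assoc_mult_mat) (use minv[OF A d] A B in auto)
  also have "\<dots> = minv A" using minv[OF A d] B by simp
  finally show ?thesis .
qed

lemma minv_transpose:
  assumes A: "A \<in> carrier_mat n n" and d: "det A \<noteq> 0" and s: "A\<^sup>T = A"
  shows "(minv A)\<^sup>T = minv A"
proof (rule minv_unique[OF A d])
  show "(minv A)\<^sup>T \<in> carrier_mat n n" using minv[OF A d] by simp
  have "(minv A * A)\<^sup>T = A\<^sup>T * (minv A)\<^sup>T" by (rule transpose_mult) (use minv[OF A d] A in auto)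
  then show "A * (minv A)\<^sup>T = 1\<^sub>m n" using minv[OF A d] s by simp
qed

section \<open>Positive definiteness and Cholesky factors\<close>

definition pos_def :: "nat \<Rightarrow> real mat \<Rightarrow> bool" where
  "pos_def n A \<longleftrightarrow> A \<in> carrier_mat n n \<and> A\<^sup>T = A \<and>
     (\<forall>v \<in> carrier_vec n. v \<noteq> 0\<^sub>v n \<longrightarrow> v \<bullet> (A *\<^sub>v v) > 0)"

lemma quad_form_sum:
  assumes "A \<in> carrier_mat n n" "v \<in> carrier_vec n" "w \<in> carrier_vec n"
  shows "v \<bullet> (A *\<^sub>v w) = (\<Sum>i<n. \<Sum>j<n. v $ i * A $$ (i, j) * w $ j)"
  using assms by (auto simp: scalar_prod_def atLeast0LessThan sum_distrib_left mult.assoc intro!: sum.cong)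

text \<open>The pivot is the last diagonal entry; the induction hypothesis is applied to its Schur
  complement.\<close>

lemma Cholesky_fun:
  fixes f :: "nat \<Rightarrow> nat \<Rightarrow> real"
  assumes "\<And>i j. i < n \<Longrightarrow> j < n \<Longrightarrow> f i j = f j i"
    and "\<And>v. (\<exists>i<n. v i \<noteq> 0) \<Longrightarrow> (\<Sum>i<n. \<Sum>j<n. v i * f i j * v j) > 0"
  shows "\<exists>L. \<forall>i<n. \<forall>j<n. f i j = (\<Sum>k<n. L k i * L k j)"
  using assms
proof (induction n arbitrary: f)
  case (Suc n)
  define a where "a = f n n"
  have "(\<Sum>i<Suc n. \<Sum>j<Suc n. (if i = n then 1 else 0) * f i j * (if j = n then 1 else 0)) > 0"
    by (rule Suc.prems(2)) auto
  then have a: "a > 0" by (simp add: a_def)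
  define g where "g i j = f i j - f i n * f j n / a" for i j
  have "(\<Sum>i<n. \<Sum>j<n. v i * g i j * v j) > 0" if v: "\<exists>i<n. v i \<noteq> 0" for v
  proof -
    define b where "b = (\<Sum>i<n. f i n * v i)"
    \<comment> \<open>This last entry minimises the form while the others are fixed; the minimum is
      the form of the Schur complement at \<open>v\<close>.\<close>
    define w where "w = v(n := - b / a)"
    have w: "w i = v i" if "i < n" for i using that by (simp add: w_def)
    have "0 < (\<Sum>i<Suc n. \<Sum>j<Suc n. w i * f i j * w j)"
      by (rule Suc.prems(2)) (use v w in \<open>auto intro: less_SucI\<close>)
    also have "\<dots> = (\<Sum>i<n. (\<Sum>j<n. v i * f i j * v j) + v i * f i n * (- b / a))
        + ((\<Sum>j<n. (- b / a) * f n j * v j) + (- b / a) * a * (- b / a))"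
      by (simp add: w w_def a_def)
    also have "(\<Sum>j<n. (- b / a) * f n j * v j) = (- b / a) * b"
      unfolding b_def sum_distrib_left
      by (rule sum.cong) (use Suc.prems(1) in \<open>auto simp: mult_ac\<close>)
    also have "(\<Sum>i<n. (\<Sum>j<n. v i * f i j * v j) + v i * f i n * (- b / a))
        = (\<Sum>i<n. \<Sum>j<n. v i * f i j * v j) + b * (- b / a)"
      unfolding sum.distrib b_def sum_distrib_right by (simp add: mult_ac)
    also have "(\<Sum>i<n. \<Sum>j<n. v i * f i j * v j) + b * (- b / a) + ((- b / a) * b + (- b / a) * a * (- b / a))
       = (\<Sum>i<n. \<Sum>j<n. v i * f i j * v j) - b * b / a"
      using a by (simp add: field_simps)
    also have "b * b / a = (\<Sum>i<n. \<Sum>j<n. v i * (f i n * f j n / a) * v j)"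
      unfolding b_def sum_product sum_divide_distrib by (simp add: mult_ac)
    also have "(\<Sum>i<n. \<Sum>j<n. v i * f i j * v j) - \<dots> = (\<Sum>i<n. \<Sum>j<n. v i * g i j * v j)"
      unfolding g_def by (simp add: algebra_simps sum_subtractf)
    finally show ?thesis .
  qed
  moreover have "g i j = g j i" if "i < n" "j < n" for i j
    using Suc.prems(1) that by (simp add: g_def)
  ultimately obtain L where L: "\<forall>i<n. \<forall>j<n. g i j = (\<Sum>k<n. L k i * L k j)"
    using Suc.IH by blast
  \<comment> \<open>The new row \<open>n\<close> is the pivot column over the square root of the
    pivot; the earlier rows get a zero in the new column.\<close>
  define M where "M k i = (if k = n then f i n / sqrt a else if i = n then 0 else L k i)" for k i
  have "f i j = (\<Sum>k<Suc n. M k i * M k j)" if ij: "i < Suc n" "j < Suc n" for i j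
  proof -
    have last: "M n i * M n j = f i n * f j n / a"
      using a by (simp add: M_def)
    consider "i < n" "j < n" | "i = n" | "j = n"
      using ij by linarith
    then show ?thesis
    proof cases
      case 1
      then have "(\<Sum>k<n. M k i * M k j) = g i j"
        using L by (simp add: M_def)
      then show ?thesis using last by (simp add: g_def)
    next
      case 2
      then have "(\<Sum>k<n. M k i * M k j) = 0" by (simp add: M_def)
      then show ?thesis using last 2 a Suc.prems(1)[of n j] ij by (simp add: a_def)
    next
      case 3
      then have "(\<Sum>k<n. M k i * M k j) = 0" by (simp add: M_def)
      then show ?thesis using last 3 a by (simp add: a_def)
    qed
  qed
  then show ?case by blast
qed simp

lemma Cholesky:
  assumes "pos_def n A"
  obtains R where "R \<in> carrier_mat n n" "A = R\<^sup>T * R"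
proof -
  have A: "A \<in> carrier_mat n n" "A\<^sup>T = A" using assms by (auto simp: pos_def_def)
  have "\<exists>L. \<forall>i<n. \<forall>j<n. A $$ (i, j) = (\<Sum>k<n. L k i * L k j)"
  proof (rule Cholesky_fun)
    show "A $$ (i, j) = A $$ (j, i)" if "i < n" "j < n" for i j
      using that A by (metis index_transpose_mat(1) carrier_matD)
    show "(\<Sum>i<n. \<Sum>j<n. v i * A $$ (i, j) * v j) > 0" if "\<exists>i<n. v i \<noteq> 0" for v
    proof -
      from that obtain i where "i < n" "v i \<noteq> 0" by auto
      then have "vec n v \<noteq> 0\<^sub>v n" by (metis index_vec index_zero_vec(1))
      then have "0 < vec n v \<bullet> (A *\<^sub>v vec n v)" using assms by (auto simp: pos_def_def)
      also have "\<dots> = (\<Sum>i<n. \<Sum>j<n. v i * A $$ (i, j) * v j)"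
        by (subst quad_form_sum[of _ n]) (use A in auto)
      finally show ?thesis .
    qed
  qed
  then obtain L where L: "\<forall>i<n. \<forall>j<n. A $$ (i, j) = (\<Sum>k<n. L k i * L k j)" by blast
  show ?thesis
  proof (rule that[of "mat n n (\<lambda>(k, i). L k i)"])
    show "A = (mat n n (\<lambda>(k, i). L k i))\<^sup>T * mat n n (\<lambda>(k, i). L k i)"
      using A L by (intro eq_matI) (auto simp: scalar_prod_def atLeast0LessThan)
  qed simp
qed

text \<open>Through the Cholesky factor the determinant is a square, and it is nonzero because a
  kernel vector would have form value zero.\<close>

lemma pos_def_det:
  assumes "pos_def n A" shows "det A > 0"
proof -
  have A: "A \<in> carrier_mat n n" using assms by (auto simp: pos_def_def)
  obtain R where R: "R \<in> carrier_mat n n" "A = R\<^sup>T * R" using Cholesky[OF assms] .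
  have "det A = (det R)\<^sup>2"
    using R det_mult[of "R\<^sup>T" n R] det_transpose[of R n] by (simp add: power2_eq_square)
  moreover have "det A \<noteq> 0"
  proof
    assume "det A = 0"
    then obtain v where "v \<in> carrier_vec n" "v \<noteq> 0\<^sub>v n" "A *\<^sub>v v = 0\<^sub>v n"
      using det_0_iff_vec_prod_zero_field[OF A] by auto
    then show False using assms by (auto simp: pos_def_def)
  qed
  ultimately show ?thesis by simp
qed

text \<open>The second derivative of \<open>-ln det\<close> at \<open>A\<close> in the directions
  \<open>X\<close> and \<open>Y\<close>.\<close>

definition local_inner :: "real mat \<Rightarrow> real mat \<Rightarrow> real mat \<Rightarrow> real" where
  "local_inner A X Y = mtrace (minv A * X * (minv A * Y))"

text \<open>Writing \<open>A\<close> as \<open>R^T R\<close> with \<open>W\<close> the inverse of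
  \<open>R\<close>, congruence by \<open>W\<close> sends \<open>A\<close> to the identity and the
  local form to the entrywise inner product of matrices. \<open>R\<close> is returned too, so that
  the congruence can be undone in \<open>local_inner_eq_0\<close>.\<close>

lemma local_inner_expand:
  assumes "pos_def n A"
  shows "\<exists>R W. R \<in> carrier_mat n n \<and> W \<in> carrier_mat n n \<and> R\<^sup>T * W\<^sup>T = 1\<^sub>m n \<and> W * R = 1\<^sub>m n \<and>
    (\<forall>X\<in>carrier_mat n n. \<forall>Y\<in>carrier_mat n n. Y\<^sup>T = Y \<longrightarrow>
      local_inner A X Y = (\<Sum>(i, j)\<in>{..<n} \<times> {..<n}. (W\<^sup>T * X * W) $$ (i, j) * (W\<^sup>T * Y * W) $$ (i, j)))"
proof -
  have A: "A \<in> carrier_mat n n" using assms by (auto simp: pos_def_def)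
  have d: "det A \<noteq> 0" using pos_def_det[OF assms] by simp
  obtain R where R: "R \<in> carrier_mat n n" "A = R\<^sup>T * R" using Cholesky[OF assms] .
  have dR: "det R \<noteq> 0"
    using d R det_mult[of "R\<^sup>T" n R] det_transpose[of R n] by auto
  define W where "W = minv R"
  have W: "W \<in> carrier_mat n n" "R * W = 1\<^sub>m n" "W * R = 1\<^sub>m n"
    using minv[OF R(1) dR] by (auto simp: W_def)
  have RW: "R\<^sup>T * W\<^sup>T = 1\<^sub>m n"
    using W R transpose_mult[of W n n R n] by simp
  have "R * (W * W\<^sup>T) = (R * W) * W\<^sup>T"
    by (rule assoc_mult_mat[symmetric]) (use R W in auto)
  then have "R * (W * W\<^sup>T) = W\<^sup>T" using W by simp
  moreover have "A * (W * W\<^sup>T) = R\<^sup>T * (R * (W * W\<^sup>T))"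
    unfolding R(2) by (rule assoc_mult_mat) (use R W in auto)
  ultimately have "A * (W * W\<^sup>T) = 1\<^sub>m n" using RW by simp
  then have G: "minv A = W * W\<^sup>T"
    using minv_unique[OF A d, of "W * W\<^sup>T"] W by simp
  show ?thesis
  proof (rule exI[of _ R], rule exI[of _ W], intro conjI ballI impI R(1) W(1) RW W(3))
    fix X Y :: "real mat" assume X: "X \<in> carrier_mat n n" and Y: "Y \<in> carrier_mat n n" "Y\<^sup>T = Y"
    have sym: "(W\<^sup>T * Y * W) $$ (j, i) = (W\<^sup>T * Y * W) $$ (i, j)" if "i < n" "j < n" for i j
    proof -
      have "(W\<^sup>T * Y * W)\<^sup>T = W\<^sup>T * (W\<^sup>T * Y)\<^sup>T"
        by (rule transpose_mult) (use W Y in auto)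
      also have "(W\<^sup>T * Y)\<^sup>T = Y * W"
        using transpose_mult[of "W\<^sup>T" n n Y n] W Y by simp
      also have "W\<^sup>T * (Y * W) = W\<^sup>T * Y * W"
        by (rule assoc_mult_mat[symmetric]) (use W Y in auto)
      finally have "(W\<^sup>T * Y * W)\<^sup>T $$ (i, j) = (W\<^sup>T * Y * W) $$ (i, j)" by simp
      moreover have "dim_row (W\<^sup>T * Y * W) = n" "dim_col (W\<^sup>T * Y * W) = n" using W by auto
      ultimately show ?thesis using that index_transpose_mat(1)[of i "W\<^sup>T * Y * W" j] by simp
    qed
    have "local_inner A X Y = mtrace (W * (W\<^sup>T * X * (W * (W\<^sup>T * Y))))"
      unfolding local_inner_def G using W X Y by (simp add: assoc_mult_mat[of _ n n _ n _ n])
    also have "\<dots> = mtrace ((W\<^sup>T * X * (W * (W\<^sup>T * Y))) * W)"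
      by (rule mtrace_comm[of _ n n]) (use W X Y in auto)
    also have "\<dots> = mtrace ((W\<^sup>T * X * W) * (W\<^sup>T * Y * W))"
      using W X Y by (simp add: assoc_mult_mat[of _ n n _ n _ n])
    also have "\<dots> = (\<Sum>i<n. \<Sum>j<n. (W\<^sup>T * X * W) $$ (i, j) * (W\<^sup>T * Y * W) $$ (j, i))"
      by (rule mtrace_mult) (use W X Y in auto)
    also have "\<dots> = (\<Sum>i<n. \<Sum>j<n. (W\<^sup>T * X * W) $$ (i, j) * (W\<^sup>T * Y * W) $$ (i, j))"
      by (intro sum.cong refl arg_cong2[where f = "(*)"]) (use sym in auto)
    finally show "local_inner A X Y = (\<Sum>(i, j)\<in>{..<n} \<times> {..<n}. (W\<^sup>T * X * W) $$ (i, j) * (W\<^sup>T * Y * W) $$ (i, j))"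
      by (simp add: sum.cartesian_product)
  qed
qed

lemma local_inner_nonneg:
  assumes "pos_def n A" "X \<in> carrier_mat n n" "X\<^sup>T = X"
  shows "local_inner A X X \<ge> 0"
proof -
  obtain R W where R: "R \<in> carrier_mat n n" "W \<in> carrier_mat n n" "R\<^sup>T * W\<^sup>T = 1\<^sub>m n" "W * R = 1\<^sub>m n"
    and W: "\<forall>X\<in>carrier_mat n n. \<forall>Y\<in>carrier_mat n n. Y\<^sup>T = Y \<longrightarrow>
      local_inner A X Y = (\<Sum>(i, j)\<in>{..<n} \<times> {..<n}. (W\<^sup>T * X * W) $$ (i, j) * (W\<^sup>T * Y * W) $$ (i, j))"
    using local_inner_expand[OF assms(1)] by (elim exE conjE)
  show ?thesis unfolding W[rule_format, OF assms(2,2,3)] by (auto intro: sum_nonneg)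
qed

lemma local_inner_Cauchy_Schwarz:
  assumes "pos_def n A" "X \<in> carrier_mat n n" "X\<^sup>T = X" "Y \<in> carrier_mat n n" "Y\<^sup>T = Y"
  shows "\<bar>local_inner A X Y\<bar> \<le> sqrt (local_inner A X X) * sqrt (local_inner A Y Y)"
proof -
  obtain R W where R: "R \<in> carrier_mat n n" "W \<in> carrier_mat n n" "R\<^sup>T * W\<^sup>T = 1\<^sub>m n" "W * R = 1\<^sub>m n"
    and W: "\<forall>X\<in>carrier_mat n n. \<forall>Y\<in>carrier_mat n n. Y\<^sup>T = Y \<longrightarrow>
      local_inner A X Y = (\<Sum>(i, j)\<in>{..<n} \<times> {..<n}. (W\<^sup>T * X * W) $$ (i, j) * (W\<^sup>T * Y * W) $$ (i, j))"
    using local_inner_expand[OF assms(1)] by (elim exE conjE)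
  let ?f = "\<lambda>X p. (W\<^sup>T * X * W) $$ p"
  have norm: "L2_set (?f Z) ({..<n} \<times> {..<n}) = sqrt (local_inner A Z Z)"
    if "Z \<in> carrier_mat n n" "Z\<^sup>T = Z" for Z
    unfolding W[rule_format, OF that(1,1,2)] L2_set_def by (simp add: power2_eq_square case_prod_beta)
  have "\<bar>local_inner A X Y\<bar> \<le> (\<Sum>p\<in>{..<n} \<times> {..<n}. \<bar>?f X p\<bar> * \<bar>?f Y p\<bar>)"
    unfolding W[rule_format, OF assms(2,4,5)]
    by (rule order_trans[OF sum_abs]) (auto simp: abs_mult case_prod_beta)
  also have "\<dots> \<le> L2_set (?f X) ({..<n} \<times> {..<n}) * L2_set (?f Y) ({..<n} \<times> {..<n})"
    by (rule L2_set_mult_ineq)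
  finally show ?thesis unfolding norm[OF assms(2,3)] norm[OF assms(4,5)] .
qed

lemma local_inner_eq_0:
  assumes "pos_def n A" "X \<in> carrier_mat n n" "X\<^sup>T = X" "local_inner A X X = 0"
  shows "X = 0\<^sub>m n n"
proof -
  obtain R W where R: "R \<in> carrier_mat n n" "W \<in> carrier_mat n n" "R\<^sup>T * W\<^sup>T = 1\<^sub>m n" "W * R = 1\<^sub>m n"
    and W: "\<forall>X\<in>carrier_mat n n. \<forall>Y\<in>carrier_mat n n. Y\<^sup>T = Y \<longrightarrow>
      local_inner A X Y = (\<Sum>(i, j)\<in>{..<n} \<times> {..<n}. (W\<^sup>T * X * W) $$ (i, j) * (W\<^sup>T * Y * W) $$ (i, j))"
    using local_inner_expand[OF assms(1)] by (elim exE conjE)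
  have "\<forall>p\<in>{..<n} \<times> {..<n}. (case p of (i, j) \<Rightarrow> (W\<^sup>T * X * W) $$ (i, j) * (W\<^sup>T * X * W) $$ (i, j)) = 0"
    using assms(4) unfolding W[rule_format, OF assms(2,2,3)] by (subst sum_nonneg_eq_0_iff[symmetric]) auto
  then have 0: "W\<^sup>T * X * W = 0\<^sub>m n n"
    using R assms(2) by (intro eq_matI) auto
  have "X = (R\<^sup>T * W\<^sup>T) * X * (W * R)"
    using assms(2) R by simp
  also have "\<dots> = R\<^sup>T * (W\<^sup>T * X * W) * R"
    using assms(2) R(1,2) by (simp add: assoc_mult_mat[of _ n n _ n _ n])
  also have "\<dots> = 0\<^sub>m n n" using R unfolding 0 by simp
  finally show ?thesis .
qed

text \<open>A rank-one argument collapses the trace to one value of the form of \<open>X\<close>.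
  With \<open>w = A *\<^sub>v v\<close> this expresses the value at an arbitrary \<open>v\<close> as
  a local inner product.\<close>

lemma local_inner_outer:
  assumes A: "pos_def n A" and X: "X \<in> carrier_mat n n" and w: "w \<in> carrier_vec n"
  shows "local_inner A X (outer w w) = (minv A *\<^sub>v w) \<bullet> (X *\<^sub>v (minv A *\<^sub>v w))"
proof -
  have "A \<in> carrier_mat n n" "A\<^sup>T = A" using A by (auto simp: pos_def_def)
  note G = minv[OF this(1)] minv_transpose[OF this(1) _ this(2)]
  have d: "det A \<noteq> 0" using pos_def_det[OF A] by simp
  have "local_inner A X (outer w w) = mtrace ((minv A * X * minv A) * outer w w)"
    unfolding local_inner_def using G d X outer_carrier[OF w w] by (simp add: assoc_mult_mat[of _ n n _ n _ n])
  also have "\<dots> = mtrace (outer ((minv A * X * minv A) *\<^sub>v w) w)"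
    by (subst mult_outer[of _ n n]) (use G d X w in auto)
  also have "\<dots> = w \<bullet> ((minv A * X * minv A) *\<^sub>v w)"
    by (rule mtrace_outer[of _ n])
      (use G d X w in \<open>auto intro!: mult_mat_vec_carrier[of _ n n] mult_carrier_mat[of _ n n]\<close>)
  also have "\<dots> = w \<bullet> (minv A *\<^sub>v (X *\<^sub>v (minv A *\<^sub>v w)))"
    using G d X w by (simp add: assoc_mult_mat_vec[of _ n n _ n])
  also have "\<dots> = ((minv A)\<^sup>T *\<^sub>v w) \<bullet> (X *\<^sub>v (minv A *\<^sub>v w))"
    by (subst transpose_vec_mult_scalar[of _ n n]) (use G d X w in auto)
  finally show ?thesis using G d by simp
qed

text \<open>For \<open>w = A *\<^sub>v v\<close> the value of \<open>X\<close> at \<open>v\<close>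
  is its local inner product with \<open>outer w w\<close>, and the local norm of
  \<open>outer w w\<close> is the value of \<open>A\<close> at \<open>v\<close>. Cauchy-Schwarz
  finishes.\<close>

lemma Dikin:
  assumes A: "pos_def n A" and X: "X \<in> carrier_mat n n" "X\<^sup>T = X" and v: "v \<in> carrier_vec n"
  shows "\<bar>v \<bullet> (X *\<^sub>v v)\<bar> \<le> sqrt (local_inner A X X) * (v \<bullet> (A *\<^sub>v v))"
proof -
  have A': "A \<in> carrier_mat n n" "A\<^sup>T = A" using A by (auto simp: pos_def_def)
  have d: "det A \<noteq> 0" using pos_def_det[OF A] by simp
  note G = minv[OF A'(1) d] minv_transpose[OF A'(1) d A'(2)]
  define w where "w = A *\<^sub>v v"
  have w: "w \<in> carrier_vec n" using A' v by (simp add: w_def)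
  have Gw: "minv A *\<^sub>v w = v"
    unfolding w_def using G A' v by (simp add: assoc_mult_mat_vec[of _ n n _ n, symmetric])
  have vA: "v \<bullet> (A *\<^sub>v v) \<ge> 0"
  proof (cases "v = 0\<^sub>v n")
    case False
    then show ?thesis using A v by (auto simp: pos_def_def less_imp_le)
  qed (use A' v in auto)
  have "local_inner A (outer w w) (outer w w) = v \<bullet> (outer w w *\<^sub>v v)"
    using local_inner_outer[OF A outer_carrier[OF w w] w] Gw by simp
  also have "\<dots> = (v \<bullet> w)\<^sup>2"
    using outer_mult_vec[OF v w, of w] v w comm_scalar_prod[OF v w] by (simp add: power2_eq_square)
  finally have "sqrt (local_inner A (outer w w) (outer w w)) = v \<bullet> (A *\<^sub>v v)"
    using vA by (simp add: w_def)
  moreover have "v \<bullet> (X *\<^sub>v v) = local_inner A X (outer w w)"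
    using local_inner_outer[OF A X(1) w] Gw by simp
  ultimately show ?thesis
    using local_inner_Cauchy_Schwarz[OF A X outer_carrier[OF w w] transpose_outer] by simp
qed

lemma Dikin_pos_def:
  assumes A: "pos_def n A" and X: "X \<in> carrier_mat n n" "X\<^sup>T = X" and lt: "local_inner A X X < 1"
  shows "pos_def n (A + X)"
  unfolding pos_def_def
proof (intro conjI ballI impI)
  have A': "A \<in> carrier_mat n n" "A\<^sup>T = A" using A by (auto simp: pos_def_def)
  show "A + X \<in> carrier_mat n n" "(A + X)\<^sup>T = A + X"
    using A' X transpose_add[OF A'(1) X(1)] by auto
  fix v :: "real vec" assume v: "v \<in> carrier_vec n" "v \<noteq> 0\<^sub>v n"
  have pos: "v \<bullet> (A *\<^sub>v v) > 0" using A v by (auto simp: pos_def_def)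
  have "sqrt (local_inner A X X) < 1" using lt by simp
  then have "sqrt (local_inner A X X) * (v \<bullet> (A *\<^sub>v v)) < v \<bullet> (A *\<^sub>v v)"
    using pos by simp
  then have "\<bar>v \<bullet> (X *\<^sub>v v)\<bar> < v \<bullet> (A *\<^sub>v v)"
    using Dikin[OF A X v(1)] by linarith
  moreover have "v \<bullet> ((A + X) *\<^sub>v v) = v \<bullet> (A *\<^sub>v v) + v \<bullet> (X *\<^sub>v v)"
    using v A' X by (simp add: add_mult_distrib_mat_vec[of _ n n] scalar_prod_add_distrib[of _ n])
  ultimately show "v \<bullet> ((A + X) *\<^sub>v v) > 0" by linarith
qed

lemma pos_def_scalar_nonneg:
  assumes "pos_def n A" "v \<in> carrier_vec n"
  shows "v \<bullet> (A *\<^sub>v v) \<ge> 0"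
  using assms by (cases "v = 0\<^sub>v n") (auto simp: pos_def_def less_imp_le)

lemma mtrace_minv_self:
  assumes "pos_def n A" shows "mtrace (minv A * A) = real n"
  using assms minv(3)[of A n] pos_def_det[OF assms] by (auto simp: pos_def_def mtrace_one)

text \<open>The matrix \<open>Y\<close> is made so that
  \<open>minv A * Y = minv B * (A - B)\<close>. This single identity turns the local inner product
  of \<open>Y\<close> and \<open>E\<close> at \<open>A\<close> into the difference of traces, and
  the local norm of \<open>Y\<close> at \<open>A\<close> into that of \<open>A - B\<close> at
  \<open>B\<close>. Cauchy-Schwarz at \<open>A\<close> is then the claim.\<close>

lemma gradient_difference:
  assumes A: "pos_def n A" and B: "pos_def n B" and E: "E \<in> carrier_mat n n" "E\<^sup>T = E"
  shows "\<bar>mtrace (minv B * E) - mtrace (minv A * E)\<bar>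
    \<le> sqrt (local_inner B (A - B) (A - B)) * sqrt (local_inner A E E)"
proof -
  have A': "A \<in> carrier_mat n n" "A\<^sup>T = A" "det A \<noteq> 0" using A pos_def_det[OF A] by (auto simp: pos_def_def)
  have B': "B \<in> carrier_mat n n" "B\<^sup>T = B" "det B \<noteq> 0" using B pos_def_det[OF B] by (auto simp: pos_def_def)
  note G = minv[OF A'(1,3)] and H = minv[OF B'(1,3)] minv_transpose[OF B'(1,3,2)]
  define Y where "Y = A * (minv B * A) - A"
  have BA: "minv B * A \<in> carrier_mat n n" using H A' by simp
  have Y: "Y \<in> carrier_mat n n" unfolding Y_def using A'(1) by (rule minus_carrier_mat)
  have "(A * (minv B * A))\<^sup>T = (minv B * A)\<^sup>T * A\<^sup>T"
    by (rule transpose_mult) (use A' BA in auto)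
  also have "(minv B * A)\<^sup>T = A * minv B"
    using transpose_mult[of "minv B" n n A n] H A' by simp
  also have "A * minv B * A\<^sup>T = A * (minv B * A)"
    using A' H by (simp add: assoc_mult_mat[of _ n n _ n _ n])
  finally have Ysym: "Y\<^sup>T = Y"
    unfolding Y_def using A' BA by (simp add: transpose_minus[of _ n n])
  have GY: "minv A * Y = minv B * (A - B)"
  proof -
    have "minv A * Y = minv A * (A * (minv B * A)) - minv A * A"
      unfolding Y_def by (rule mult_minus_distrib_mat) (use G A' BA in auto)
    also have "minv A * (A * (minv B * A)) = minv A * A * (minv B * A)"
      by (rule assoc_mult_mat[symmetric]) (use G A' BA in auto)
    also have "\<dots> = minv B * A" unfolding G(3) by (rule left_mult_one_mat[OF BA])
    also have "minv B * A - minv A * A = minv B * A - minv B * B" using G H by simp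
    also have "\<dots> = minv B * (A - B)"
      by (rule mult_minus_distrib_mat[symmetric]) (use H A' B' in auto)
    finally show ?thesis .
  qed
  have GE: "minv A * E \<in> carrier_mat n n" using G E by simp
  have "local_inner A Y E = mtrace (minv B * (A - B) * (minv A * E))"
    unfolding local_inner_def GY ..
  also have "minv B * (A - B) * (minv A * E) = minv B * ((A - B) * (minv A * E))"
    by (rule assoc_mult_mat) (use H A' B' GE in auto)
  also have "(A - B) * (minv A * E) = A * (minv A * E) - B * (minv A * E)"
    by (rule minus_mult_distrib_mat) (use A' B' GE in auto)
  also have "A * (minv A * E) = A * minv A * E"
    by (rule assoc_mult_mat[symmetric]) (use A' G E in auto)
  also have "\<dots> = E" using G E by simp
  also have "minv B * (E - B * (minv A * E)) = minv B * E - minv B * (B * (minv A * E))"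
    by (rule mult_minus_distrib_mat) (use H E B' GE in auto)
  also have "minv B * (B * (minv A * E)) = minv B * B * (minv A * E)"
    by (rule assoc_mult_mat[symmetric]) (use H B' GE in auto)
  also have "\<dots> = minv A * E" unfolding H(3) by (rule left_mult_one_mat[OF GE])
  also have "mtrace (minv B * E - minv A * E) = mtrace (minv B * E) - mtrace (minv A * E)"
    by (rule mtrace_minus) (use H E GE in auto)
  finally have 1: "local_inner A Y E = mtrace (minv B * E) - mtrace (minv A * E)" .
  have 2: "local_inner A Y Y = local_inner B (A - B) (A - B)"
    unfolding local_inner_def GY ..
  show ?thesis
    using local_inner_Cauchy_Schwarz[OF A Y Ysym E] unfolding 1 2 .
qed

section \<open>Bilinearity and symmetry of the local inner product\<close>

lemma local_inner_add_left:
  assumes A: "A \<in> carrier_mat n n" "det A \<noteq> 0"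
    and "X \<in> carrier_mat n n" "Y \<in> carrier_mat n n" "Z \<in> carrier_mat n n"
  shows "local_inner A (X + Y) Z = local_inner A X Z + local_inner A Y Z"
proof -
  note G = minv[OF A]
  have "minv A * (X + Y) * (minv A * Z) = minv A * X * (minv A * Z) + minv A * Y * (minv A * Z)"
    using G assms by (simp add: mult_add_distrib_mat[of _ n n _ n] add_mult_distrib_mat[of _ n n _ _ n])
  then show ?thesis
    unfolding local_inner_def using G assms by (simp add: mtrace_add[of _ n] mult_carrier_mat[of _ n n])
qed

lemma local_inner_smult_left:
  assumes A: "A \<in> carrier_mat n n" "det A \<noteq> 0" and "X \<in> carrier_mat n n" "Z \<in> carrier_mat n n"
  shows "local_inner A (c \<cdot>\<^sub>m X) Z = c * local_inner A X Z"
proof -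
  note G = minv[OF A]
  have "minv A * (c \<cdot>\<^sub>m X) * (minv A * Z) = c \<cdot>\<^sub>m (minv A * X * (minv A * Z))"
    using G assms by (simp add: mult_smult_distrib[of _ n n _ n] mult_smult_assoc_mat[of _ n n _ n])
  then show ?thesis
    unfolding local_inner_def using G assms by (simp add: mtrace_smult[of _ n] mult_carrier_mat[of _ n n])
qed

lemma local_inner_commute:
  assumes A: "A \<in> carrier_mat n n" "det A \<noteq> 0" and "X \<in> carrier_mat n n" "Z \<in> carrier_mat n n"
  shows "local_inner A X Z = local_inner A Z X"
  unfolding local_inner_def using minv[OF A] assms by (intro mtrace_comm[of _ n n]) auto

lemma local_inner_self:
  assumes A: "A \<in> carrier_mat n n" "det A \<noteq> 0" and X: "X \<in> carrier_mat n n"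
  shows "local_inner A X A = mtrace (minv A * X)"
  unfolding local_inner_def using minv[OF A] X by simp

text \<open>The inner product of the two rank-one terms is at most the product of their traces, so
  the squared norm is dominated by the square of the trace sum. Two terms are what is required: the
  image of a unit vector has one rank-one piece in each diagonal block.\<close>

lemma rank_two_bound:
  assumes A: "pos_def n A" and a: "a \<in> carrier_vec n" and b: "b \<in> carrier_vec n"
    and S: "S = outer a a + outer b b"
  shows "local_inner A S S \<le> (mtrace (minv A * S))\<^sup>2" "mtrace (minv A * S) \<ge> 0"
proof -
  have A': "A \<in> carrier_mat n n" "A\<^sup>T = A" "det A \<noteq> 0" using A pos_def_det[OF A] by (auto simp: pos_def_def)
  note G = minv[OF A'(1,3)]
  let ?G = "minv A"
  have nn: "w \<bullet> (?G *\<^sub>v w) \<ge> 0" if w: "w \<in> carrier_vec n" for w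
  proof -
    have Gw: "?G *\<^sub>v w \<in> carrier_vec n" using G w by auto
    have "(?G *\<^sub>v w) \<bullet> (A *\<^sub>v (?G *\<^sub>v w)) \<ge> 0"
      using Gw by (rule pos_def_scalar_nonneg[OF A])
    also have "A *\<^sub>v (?G *\<^sub>v w) = w"
      using G A' w by (simp add: assoc_mult_mat_vec[of _ n n _ n, symmetric])
    finally show ?thesis using Gw w by (simp add: comm_scalar_prod[of _ n])
  qed
  have inner: "local_inner A (outer u u) (outer w w) = (u \<bullet> (?G *\<^sub>v w))\<^sup>2"
    if "u \<in> carrier_vec n" "w \<in> carrier_vec n" for u w
  proof -
    have Gw: "?G *\<^sub>v w \<in> carrier_vec n" using G that by auto
    show ?thesis
      using local_inner_outer[OF A outer_carrier[OF that(1,1)] that(2)] Gw that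
      by (simp add: outer_mult_vec[OF Gw that(1)] power2_eq_square comm_scalar_prod[of _ n])
  qed
  have tr: "mtrace (?G * outer w w) = w \<bullet> (?G *\<^sub>v w)" if "w \<in> carrier_vec n" for w
    using G that by (subst mult_outer[of _ n n]) (auto intro!: mtrace_outer[of _ n])
  let ?\<alpha> = "a \<bullet> (?G *\<^sub>v a)" and ?\<beta> = "b \<bullet> (?G *\<^sub>v b)"
  note oa = outer_carrier[OF a a] and ob = outer_carrier[OF b b]
  have oS: "S \<in> carrier_mat n n" using oa ob by (simp add: S)
  have trS: "mtrace (?G * S) = ?\<alpha> + ?\<beta>"
    using G oa ob tr[OF a] tr[OF b]
    by (simp add: S mult_add_distrib_mat[of _ n n _ n] mtrace_add[of _ n])
  have "local_inner A (outer a a) (outer b b) \<le> ?\<alpha> * ?\<beta>"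
    using local_inner_Cauchy_Schwarz[OF A oa transpose_outer ob transpose_outer] nn[OF a] nn[OF b]
    by (simp add: inner a b)
  moreover have "local_inner A S S = ?\<alpha>\<^sup>2 + 2 * local_inner A (outer a a) (outer b b) + ?\<beta>\<^sup>2"
  proof -
    have "local_inner A S S = local_inner A (outer a a) S + local_inner A (outer b b) S"
      unfolding S using A'(1,3) oa ob by (simp add: local_inner_add_left[of _ n])
    also have "local_inner A (outer a a) S = local_inner A S (outer a a)"
      by (rule local_inner_commute[OF A'(1,3) oa oS])
    also have "\<dots> = local_inner A (outer a a) (outer a a) + local_inner A (outer b b) (outer a a)"
      unfolding S using A'(1,3) oa ob by (simp add: local_inner_add_left[of _ n])
    also have "local_inner A (outer b b) (outer a a) = local_inner A (outer a a) (outer b b)"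
      by (rule local_inner_commute[OF A'(1,3) ob oa])
    also have "local_inner A (outer b b) S = local_inner A S (outer b b)"
      by (rule local_inner_commute[OF A'(1,3) ob oS])
    also have "\<dots> = local_inner A (outer a a) (outer b b) + local_inner A (outer b b) (outer b b)"
      unfolding S using A'(1,3) oa ob by (simp add: local_inner_add_left[of _ n])
    finally show ?thesis by (simp add: inner a b)
  qed
  ultimately show "local_inner A S S \<le> (mtrace (minv A * S))\<^sup>2"
    unfolding trS by (simp add: power2_sum)
  show "mtrace (minv A * S) \<ge> 0" unfolding trS using nn a b by simp
qed

lemma scalar_prod_self_pos:
  fixes w :: "real vec"
  assumes "w \<in> carrier_vec n" "w \<noteq> 0\<^sub>v n"
  shows "w \<bullet> w > 0"
proof -
  obtain i where "i < n" "w $ i \<noteq> 0"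
    using assms by (metis carrier_vecD eq_vecI index_zero_vec(1,2))
  then have "0 < (\<Sum>i<n. w $ i * w $ i)"
    by (intro sum_pos2[of _ i]) (auto simp: not_square_less_zero zero_less_mult_iff linorder_neq_iff)
  then show ?thesis using assms(1) by (simp add: scalar_prod_def atLeast0LessThan)
qed

text \<open>If the form vanished at some \<open>v\<close> outside the kernel, moving from
  \<open>v\<close> in the direction of \<open>- (A *\<^sub>v v)\<close> would decrease it to first
  order and make it negative.\<close>

lemma pos_semidef_det_imp_pos_def:
  assumes A: "A \<in> carrier_mat n n" "A\<^sup>T = A" "det A \<noteq> 0"
    and psd: "\<And>v. v \<in> carrier_vec n \<Longrightarrow> v \<bullet> (A *\<^sub>v v) \<ge> 0"
  shows "pos_def n A"
  unfolding pos_def_def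
proof (intro conjI ballI impI A(1,2))
  fix v :: "real vec" assume v: "v \<in> carrier_vec n" "v \<noteq> 0\<^sub>v n"
  define w where "w = A *\<^sub>v v"
  have w: "w \<in> carrier_vec n" using A v by (auto simp: w_def)
  have "w \<noteq> 0\<^sub>v n"
    using det_0_iff_vec_prod_zero_field[OF A(1)] A(3) v by (auto simp: w_def)
  then have ww: "w \<bullet> w > 0"
    by (rule scalar_prod_self_pos[OF w])
  show "v \<bullet> (A *\<^sub>v v) > 0"
  proof (rule ccontr)
    assume "\<not> ?thesis"
    then have 0: "v \<bullet> (A *\<^sub>v v) = 0" using psd[OF v(1)] by simp
    define c where "c = w \<bullet> (A *\<^sub>v w)"
    have c: "c \<ge> 0" using psd[OF w] by (simp add: c_def)
    have q: "0 \<le> - 2 * s * (w \<bullet> w) + s\<^sup>2 * c" for s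
    proof -
      let ?u = "v + (-s) \<cdot>\<^sub>v w"
      have Aw: "A *\<^sub>v w \<in> carrier_vec n" using A w by auto
      have vAw: "v \<bullet> (A *\<^sub>v w) = w \<bullet> w"
        using transpose_vec_mult_scalar[of A n n w v] A v w by (simp add: w_def)
      have "A *\<^sub>v ?u = w + (-s) \<cdot>\<^sub>v (A *\<^sub>v w)"
        using A v w by (simp add: mult_add_distrib_mat_vec[of _ n n] mult_mat_vec[of _ n n] w_def)
      then have "?u \<bullet> (A *\<^sub>v ?u) = v \<bullet> w - s * (v \<bullet> (A *\<^sub>v w)) - s * (w \<bullet> w) + s\<^sup>2 * c"
        using v w Aw by (simp add: add_scalar_prod_distrib[of _ n] scalar_prod_add_distrib[of _ n]
            c_def power2_eq_square algebra_simps)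
      then show ?thesis using psd[of ?u] v w 0 vAw by (simp add: w_def)
    qed
    show False
    proof (cases "c = 0")
      case True
      then show False using q[of 1] ww by simp
    next
      case False
      \<comment> \<open>The chosen step \<open>(w \<bullet> w) / c\<close> minimises the quadratic
        polynomial in \<open>s\<close>.\<close>
      then show False using q[of "(w \<bullet> w) / c"] ww c by (simp add: power2_eq_square field_simps mult_le_0_iff)
    qed
  qed
qed

section \<open>The Hessian of the logarithmic determinant\<close>

lemma tendsto_det:
  assumes M: "\<And>s. M s \<in> carrier_mat n n" "A \<in> carrier_mat n n"
    and lim: "\<And>i j. i < n \<Longrightarrow> j < n \<Longrightarrow> ((\<lambda>s. M s $$ (i, j)) \<longlongrightarrow> A $$ (i, j)) F"
  shows "((\<lambda>s. det (M s)) \<longlongrightarrow> (det A :: real)) F"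
  unfolding det_def'[OF M(1)] det_def'[OF M(2)]
  by (intro tendsto_intros lim) (auto simp: permutes_def)

lemma tendsto_minv:
  assumes M: "\<And>s. M s \<in> carrier_mat n n" "A \<in> carrier_mat n n" and "det A \<noteq> 0"
    and lim: "\<And>i j. i < n \<Longrightarrow> j < n \<Longrightarrow> ((\<lambda>s. M s $$ (i, j)) \<longlongrightarrow> A $$ (i, j)) F"
    and ij: "i < n" "j < n"
  shows "((\<lambda>s. minv (M s) $$ (i, j)) \<longlongrightarrow> minv A $$ (i, j)) F"
proof -
  have "minv B $$ (i, j) = 1 / det B * ((-1) ^ (j + i) * det (mat_delete B j i))"
    if "B \<in> carrier_mat n n" for B
    using that ij by (auto simp: minv_def adj_mat_def cofactor_def)
  moreover have "((\<lambda>s. det (mat_delete (M s) j i)) \<longlongrightarrow> det (mat_delete A j i)) F"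
  proof (rule tendsto_det)
    show "mat_delete (M s) j i \<in> carrier_mat (n - 1) (n - 1)" for s using M mat_delete_carrier by blast
    show "mat_delete A j i \<in> carrier_mat (n - 1) (n - 1)" using M mat_delete_carrier by blast
    fix i' j' assume *: "i' < n - 1" "j' < n - 1"
    have dims: "dim_row (M s) = n" "dim_col (M s) = n" "dim_row A = n" "dim_col A = n" for s
      using M(1)[of s] M(2) by auto
    show "((\<lambda>s. mat_delete (M s) j i $$ (i', j')) \<longlongrightarrow> mat_delete A j i $$ (i', j')) F"
      using * by (auto simp: mat_delete_def dims intro!: lim)
  qed
  ultimately show ?thesis
    using M assms(3) tendsto_det[OF M lim] by (auto intro!: tendsto_intros)
qed

lemma tendsto_mtrace_minv_mult:
  assumes M: "\<And>s. M s \<in> carrier_mat n n" "A \<in> carrier_mat n n" and "det A \<noteq> 0"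
    and lim: "\<And>i j. i < n \<Longrightarrow> j < n \<Longrightarrow> ((\<lambda>s. M s $$ (i, j)) \<longlongrightarrow> A $$ (i, j)) F"
    and X: "X \<in> carrier_mat n n"
  shows "((\<lambda>s. mtrace (minv (M s) * X)) \<longlongrightarrow> mtrace (minv A * X)) F"
proof -
  have c: "minv B \<in> carrier_mat n n" if "B \<in> carrier_mat n n" for B
    using adj_mat[OF that] by (simp add: minv_def)
  show ?thesis
    unfolding mtrace_mult[OF c[OF M(1)] X] mtrace_mult[OF c[OF M(2)] X]
    by (intro tendsto_intros tendsto_minv[OF M assms(3) lim]) auto
qed

text \<open>In the Leibniz sum a permutation other than \<open>id\<close> moves at least two
  indices, so its product vanishes to second order in \<open>s\<close>. Only the identity
  contributes, and it gives the sum of the diagonal entries.\<close>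

lemma det_one_plus_derivative:
  assumes C: "C \<in> carrier_mat n n"
  shows "((\<lambda>s. det (1\<^sub>m n + s \<cdot>\<^sub>m C)) has_real_derivative mtrace C) (at 0)"
proof -
  let ?P = "{p. p permutes {0..<n}}"
  let ?e = "\<lambda>i j. 1\<^sub>m n $$ (i, j) :: real"
  have det: "det (1\<^sub>m n + s \<cdot>\<^sub>m C) =
      (\<Sum>p\<in>?P. signof p * (\<Prod>i\<in>{0..<n}. ?e i (p i) + s * C $$ (i, p i)))" for s
  proof -
    have "det (1\<^sub>m n + s \<cdot>\<^sub>m C) =
      (\<Sum>p\<in>?P. signof p * (\<Prod>i\<in>{0..<n}. (1\<^sub>m n + s \<cdot>\<^sub>m C) $$ (i, p i)))"
      by (rule det_def') (use C in auto)
    also have "\<dots> = (\<Sum>p\<in>?P. signof p * (\<Prod>i\<in>{0..<n}. ?e i (p i) + s * C $$ (i, p i)))"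
    proof (intro sum.cong prod.cong refl arg_cong2[where f = "(*)"])
      fix p i assume p: "p \<in> ?P" and i: "i \<in> {0..<n}"
      then have "i < n" "p i < n" by (auto dest: permutes_in_image)
      then show "(1\<^sub>m n + s \<cdot>\<^sub>m C) $$ (i, p i) = ?e i (p i) + s * C $$ (i, p i)"
        using C by simp
    qed
    finally show ?thesis .
  qed
  have d: "((\<lambda>s. det (1\<^sub>m n + s \<cdot>\<^sub>m C)) has_real_derivative
      (\<Sum>p\<in>?P. signof p * (\<Sum>i\<in>{0..<n}. C $$ (i, p i) *
        (\<Prod>j\<in>{0..<n} - {i}. ?e j (p j) + 0 * C $$ (j, p j))))) (at 0)"
    unfolding det
    by (intro DERIV_sum DERIV_cmult has_field_derivative_prod) (auto intro!: derivative_eq_intros)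
  have 0: "(\<Sum>i\<in>{0..<n}. C $$ (i, p i) * (\<Prod>j\<in>{0..<n} - {i}. ?e j (p j))) = 0"
    if p: "p permutes {0..<n}" "p \<noteq> id" for p
  proof (intro sum.neutral ballI)
    fix i assume i: "i \<in> {0..<n}"
    have "\<exists>j\<in>{0..<n} - {i}. p j \<noteq> j"
    proof (rule ccontr)
      assume "\<not> ?thesis"
      then have pfix: "p j = j" if "j \<noteq> i" for j
        using p that by (cases "j \<in> {0..<n}") (auto simp: permutes_def)
      have "p i = i"
      proof (rule ccontr)
        assume "p i \<noteq> i"
        then have "p (p i) = p i" by (rule pfix)
        then show False using permutes_inj[OF p(1)] \<open>p i \<noteq> i\<close> by (auto dest: injD)
      qed
      then have "p = id" using pfix by (intro ext) (metis id_apply)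
      then show False using p by simp
    qed
    then obtain j where j: "j \<in> {0..<n} - {i}" "p j \<noteq> j" ..
    then have "j < n" "p j < n" using permutes_in_image[OF p(1), of j] by auto
    then have "?e j (p j) = 0" using j by simp
    then have "(\<Prod>j\<in>{0..<n} - {i}. ?e j (p j)) = 0"
      using j(1) by (intro prod_zero) auto
    then show "C $$ (i, p i) * (\<Prod>j\<in>{0..<n} - {i}. ?e j (p j)) = 0" by simp
  qed
  have "(\<Sum>p\<in>?P. signof p * (\<Sum>i\<in>{0..<n}. C $$ (i, p i) *
        (\<Prod>j\<in>{0..<n} - {i}. ?e j (p j) + 0 * C $$ (j, p j)))) =
      (\<Sum>p\<in>{id}. signof p * (\<Sum>i\<in>{0..<n}. C $$ (i, p i) * (\<Prod>j\<in>{0..<n} - {i}. ?e j (p j))))"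
    using 0 by (intro sum.mono_neutral_cong_right) (auto simp: permutes_id finite_permutations)
  also have "\<dots> = mtrace C"
    using C by (auto simp: mtrace_def atLeast0LessThan)
  finally show ?thesis using d by simp
qed

text \<open>Jacobi's formula: factoring out \<open>A\<close> moves the derivative to the identity
  matrix.\<close>

lemma det_line_derivative:
  assumes A: "A \<in> carrier_mat n n" "det A \<noteq> 0" and B: "B \<in> carrier_mat n n"
  shows "((\<lambda>s. det (A + s \<cdot>\<^sub>m B)) has_real_derivative det A * mtrace (minv A * B)) (at 0)"
proof -
  note G = minv[OF A]
  have "det (A + s \<cdot>\<^sub>m B) = det A * det (1\<^sub>m n + s \<cdot>\<^sub>m (minv A * B))" for s
  proof -
    have "A * (1\<^sub>m n + s \<cdot>\<^sub>m (minv A * B)) = A * 1\<^sub>m n + A * (s \<cdot>\<^sub>m (minv A * B))"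
      by (rule mult_add_distrib_mat) (use A B G in auto)
    also have "A * (s \<cdot>\<^sub>m (minv A * B)) = s \<cdot>\<^sub>m (A * (minv A * B))"
      by (rule mult_smult_distrib) (use A B G in auto)
    also have "A * (minv A * B) = A * minv A * B"
      by (rule assoc_mult_mat[symmetric]) (use A B G in auto)
    finally have "A + s \<cdot>\<^sub>m B = A * (1\<^sub>m n + s \<cdot>\<^sub>m (minv A * B))"
      using A B G by simp
    then show ?thesis
      using det_mult[of A n "1\<^sub>m n + s \<cdot>\<^sub>m (minv A * B)"] A B G by simp
  qed
  moreover have "((\<lambda>s. det A * det (1\<^sub>m n + s \<cdot>\<^sub>m (minv A * B))) has_real_derivative
      det A * mtrace (minv A * B)) (at 0)"
    using B G by (intro DERIV_cmult det_one_plus_derivative) auto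
  ultimately show ?thesis by simp
qed

lemma tendsto_line:
  assumes "A \<in> carrier_mat n n" "B \<in> carrier_mat n n" "i < n" "j < n"
  shows "((\<lambda>s::real. (A + s \<cdot>\<^sub>m B) $$ (i, j)) \<longlongrightarrow> A $$ (i, j)) (nhds 0)"
proof -
  have "((\<lambda>s::real. A $$ (i, j) + s * B $$ (i, j)) \<longlongrightarrow> A $$ (i, j) + 0 * B $$ (i, j)) (nhds 0)"
    by (intro tendsto_intros filterlim_ident)
  then show ?thesis using assms by simp
qed

lemma eventually_det_line_pos:
  assumes A: "A \<in> carrier_mat n n" "det A > 0" and B: "B \<in> carrier_mat n n"
  shows "eventually (\<lambda>s::real. det (A + s \<cdot>\<^sub>m B) > 0) (nhds 0)"
proof -
  have "((\<lambda>s. det (A + s \<cdot>\<^sub>m B)) \<longlongrightarrow> det A) (nhds 0)"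
    by (rule tendsto_det) (use A B tendsto_line[OF A(1) B] in auto)
  then show ?thesis using order_tendstoD(1) A(2) by blast
qed

lemma mtrace_minv_line_derivative:
  assumes A: "A \<in> carrier_mat n n" "det A > 0" and E: "E \<in> carrier_mat n n"
    and X: "X \<in> carrier_mat n n"
  shows "((\<lambda>s. mtrace (minv (A + s \<cdot>\<^sub>m E) * X)) has_real_derivative
    - mtrace (minv A * E * (minv A * X))) (at 0)"
proof -
  have d: "det A \<noteq> 0" using A by simp
  note G = minv[OF A(1) d]
  define Y where "Y = E * (minv A * X)"
  have Y: "Y \<in> carrier_mat n n" using E G X by (simp add: Y_def)
  let ?M = "\<lambda>s. A + s \<cdot>\<^sub>m E"
  have M: "?M s \<in> carrier_mat n n" for s using A E by simp
  \<comment> \<open>the resolvent identity\<close>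
  have quot: "- mtrace (minv (?M s) * Y) = (mtrace (minv (?M s) * X) - mtrace (minv A * X)) / s"
    if s: "det (?M s) > 0" "s \<noteq> 0" for s
  proof -
    note N = minv[OF M, of s]
    have N': "minv (?M s) \<in> carrier_mat n n" "minv (?M s) * ?M s = 1\<^sub>m n" using N s by auto
    have GX: "minv A * X \<in> carrier_mat n n" using G X by simp
    have "minv A * X = minv (?M s) * ?M s * (minv A * X)"
      unfolding N'(2) by (rule left_mult_one_mat[OF GX, symmetric])
    also have "\<dots> = minv (?M s) * (?M s * (minv A * X))"
      by (rule assoc_mult_mat) (use N' M GX in auto)
    also have "?M s * (minv A * X) = A * (minv A * X) + (s \<cdot>\<^sub>m E) * (minv A * X)"
      by (rule add_mult_distrib_mat) (use A E GX in auto)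
    also have "A * (minv A * X) = A * minv A * X"
      by (rule assoc_mult_mat[symmetric]) (use A G X in auto)
    also have "\<dots> = X" using G X by simp
    also have "(s \<cdot>\<^sub>m E) * (minv A * X) = s \<cdot>\<^sub>m Y"
      unfolding Y_def by (rule mult_smult_assoc_mat) (use E GX in auto)
    also have "minv (?M s) * (X + s \<cdot>\<^sub>m Y) = minv (?M s) * X + minv (?M s) * (s \<cdot>\<^sub>m Y)"
      by (rule mult_add_distrib_mat) (use N' X Y in auto)
    also have "minv (?M s) * (s \<cdot>\<^sub>m Y) = s \<cdot>\<^sub>m (minv (?M s) * Y)"
      by (rule mult_smult_distrib) (use N' Y in auto)
    finally have "mtrace (minv A * X) = mtrace (minv (?M s) * X + s \<cdot>\<^sub>m (minv (?M s) * Y))"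
      by simp
    also have "\<dots> = mtrace (minv (?M s) * X) + s * mtrace (minv (?M s) * Y)"
      using N' X Y by (subst mtrace_add[of _ n]) (auto simp: mtrace_smult[of _ n])
    finally show ?thesis using s by (simp add: field_simps)
  qed
  \<comment> \<open>By \<open>quot\<close> the difference quotient is itself a trace involving the
    inverse at \<open>s\<close>, so continuity of the inverse already yields the derivative.\<close>
  have "((\<lambda>s. mtrace (minv (?M s) * Y)) \<longlongrightarrow> mtrace (minv A * Y)) (nhds 0)"
    by (rule tendsto_mtrace_minv_mult[OF M A(1) d _ Y]) (rule tendsto_line[OF A(1) E])
  then have "((\<lambda>s. - mtrace (minv (?M s) * Y)) \<longlongrightarrow> - mtrace (minv A * Y)) (at 0)"
    by (intro tendsto_minus) (rule tendsto_mono[of _ "nhds 0"], simp_all add: at_within_def)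
  moreover have "eventually (\<lambda>s. - mtrace (minv (?M s) * Y) =
      (mtrace (minv (?M s) * X) - mtrace (minv A * X)) / s) (at 0)"
    unfolding eventually_at_filter using eventually_det_line_pos[OF A E]
    by eventually_elim (use quot in blast)
  ultimately have "((\<lambda>s. (mtrace (minv (?M s) * X) - mtrace (minv A * X)) / s)
      \<longlongrightarrow> - mtrace (minv A * Y)) (at 0)"
    by (rule Lim_transform_eventually)
  moreover have "?M 0 = A" using A E by (intro eq_matI) auto
  moreover have "minv A * Y = minv A * E * (minv A * X)"
    unfolding Y_def using G E X by (simp add: assoc_mult_mat[of _ n n _ n _ n])
  ultimately show ?thesis unfolding DERIV_def by simp
qed

lemma hessian_log_det:
  assumes L: "\<And>x. x \<in> carrier_vec n \<Longrightarrow> L x \<in> carrier_mat n n"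
      "\<And>x y. x \<in> carrier_vec n \<Longrightarrow> y \<in> carrier_vec n \<Longrightarrow> L (x + y) = L x + L y"
      "\<And>x c. x \<in> carrier_vec n \<Longrightarrow> L (c \<cdot>\<^sub>v x) = c \<cdot>\<^sub>m L x"
    and x: "x \<in> carrier_vec n" "det (L x) > 0"
  shows "hessian n (\<lambda>x. - ln (det (L x))) x =
    mat n n (\<lambda>(i, j). local_inner (L x) (L (unit_vec n i)) (L (unit_vec n j)))"
proof -
  let ?f = "\<lambda>x. - ln (det (L x))"
  let ?D = "\<lambda>j y. deriv (\<lambda>s. ?f (y + s \<cdot>\<^sub>v unit_vec n j)) 0"
  have line: "L (y + s \<cdot>\<^sub>v unit_vec n j) = L y + s \<cdot>\<^sub>m L (unit_vec n j)"
    if "y \<in> carrier_vec n" for y j s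
    using that L by simp
  have D: "?D j y = - mtrace (minv (L y) * L (unit_vec n j))"
    if y: "y \<in> carrier_vec n" "det (L y) > 0" for y j
  proof (rule DERIV_imp_deriv)
    have *: "L y + 0 \<cdot>\<^sub>m L (unit_vec n j) = L y"
      using y L(1)[OF y(1)] L(1)[of "unit_vec n j"] by (intro eq_matI) auto
    have "((\<lambda>s. det (L y + s \<cdot>\<^sub>m L (unit_vec n j))) has_real_derivative
        det (L y) * mtrace (minv (L y) * L (unit_vec n j))) (at 0)"
      by (rule det_line_derivative[OF L(1)[OF y(1)]]) (use y L(1) in auto)
    then have "((\<lambda>s. - ln (det (L y + s \<cdot>\<^sub>m L (unit_vec n j)))) has_real_derivative
        - (1 / det (L y) * (det (L y) * mtrace (minv (L y) * L (unit_vec n j))))) (at 0)"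
      by (intro DERIV_minus DERIV_chain2[where f = ln]) (simp_all add: * y(2) DERIV_ln_divide)
    then show "((\<lambda>s. ?f (y + s \<cdot>\<^sub>v unit_vec n j)) has_real_derivative
        - mtrace (minv (L y) * L (unit_vec n j))) (at 0)"
      using y by (simp add: line)
  qed
  have "deriv (\<lambda>s. ?D j (x + s \<cdot>\<^sub>v unit_vec n i)) 0 = local_inner (L x) (L (unit_vec n i)) (L (unit_vec n j))"
    for i j
  proof (rule DERIV_imp_deriv)
    \<comment> \<open>The formula for the first partial derivative holds only where the determinant
      is positive. Near \<open>s = 0\<close> it is, and the outer derivative sees nothing
      else.\<close>
    have "eventually (\<lambda>s. ?D j (x + s \<cdot>\<^sub>v unit_vec n i) =
        - mtrace (minv (L x + s \<cdot>\<^sub>m L (unit_vec n i)) * L (unit_vec n j))) (nhds 0)"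
      using eventually_det_line_pos[OF L(1)[OF x(1)] x(2) L(1), of "unit_vec n i", OF unit_vec_carrier]
    proof eventually_elim
      case (elim s)
      then have "det (L (x + s \<cdot>\<^sub>v unit_vec n i)) > 0" using line[OF x(1)] by simp
      then show ?case using D[of "x + s \<cdot>\<^sub>v unit_vec n i" j] line[OF x(1)] x by simp
    qed
    moreover have "((\<lambda>s. - mtrace (minv (L x + s \<cdot>\<^sub>m L (unit_vec n i)) * L (unit_vec n j))) has_real_derivative
        - (- local_inner (L x) (L (unit_vec n i)) (L (unit_vec n j)))) (at 0)"
      unfolding local_inner_def
      by (intro DERIV_minus mtrace_minv_line_derivative[OF L(1)[OF x(1)] x(2)] L(1)) auto
    ultimately show "((\<lambda>s. ?D j (x + s \<cdot>\<^sub>v unit_vec n i)) has_real_derivative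
        local_inner (L x) (L (unit_vec n i)) (L (unit_vec n j))) (at 0)"
      using DERIV_cong_ev[OF refl _ refl] by (simp add: DERIV_cong_ev)
  qed
  then show ?thesis unfolding hessian_def Let_def by (intro eq_matI) auto
qed

section \<open>Euclidean topology on vectors of fixed length\<close>

text \<open>Linearity is available on the carrier only, so \<open>u\<close> is rebuilt from its
  truncations, one coordinate at a time.\<close>

lemma linear_functional_sum:
  fixes \<phi> :: "real vec \<Rightarrow> real"
  assumes add: "\<And>x y. x \<in> carrier_vec n \<Longrightarrow> y \<in> carrier_vec n \<Longrightarrow> \<phi> (x + y) = \<phi> x + \<phi> y"
    and smult: "\<And>x c. x \<in> carrier_vec n \<Longrightarrow> \<phi> (c \<cdot>\<^sub>v x) = c * \<phi> x"
    and u: "u \<in> carrier_vec n"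
  shows "\<phi> u = (\<Sum>i<n. u $ i * \<phi> (unit_vec n i))"
proof -
  have "\<phi> (vec n (\<lambda>i. if i < k then u $ i else 0)) = (\<Sum>i<k. u $ i * \<phi> (unit_vec n i))" if "k \<le> n" for k
    using that
  proof (induction k)
    case 0
    have "\<phi> (0 \<cdot>\<^sub>v 0\<^sub>v n) = 0 * \<phi> (0\<^sub>v n)" by (rule smult) simp
    moreover have "vec n (\<lambda>i. if i < 0 then u $ i else 0) = 0 \<cdot>\<^sub>v 0\<^sub>v n" by (intro eq_vecI) auto
    ultimately show ?case by simp
  next
    case (Suc k)
    have "vec n (\<lambda>i. if i < Suc k then u $ i else 0) =
        vec n (\<lambda>i. if i < k then u $ i else 0) + u $ k \<cdot>\<^sub>v unit_vec n k"
      using Suc.prems by (intro eq_vecI) (auto simp: less_Suc_eq)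
    then show ?case using Suc add smult by simp
  qed
  from this[of n] have "\<phi> (vec n (\<lambda>i. if i < n then u $ i else 0)) = (\<Sum>i<n. u $ i * \<phi> (unit_vec n i))"
    by simp
  moreover have "vec n (\<lambda>i. if i < n then u $ i else 0) = u" using u by (intro eq_vecI) auto
  ultimately show ?thesis by simp
qed

section \<open>Interiors, boxes and compactness in coordinates\<close>

lemma euclid_interior_iff:
  "x \<in> euclid_top n interior_of K \<longleftrightarrow>
    x \<in> carrier_vec n \<and> (\<exists>r>0. \<forall>y\<in>carrier_vec n. euclid_dist n x y < r \<longrightarrow> y \<in> K)"
proof -
  interpret Metric_space "carrier_vec n" "euclid_dist n" by (rule Metric_space_euclid)
  show ?thesis
  proof
    assume "x \<in> euclid_top n interior_of K"
    then obtain T where T: "openin mtopology T" "x \<in> T" "T \<subseteq> K"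
      by (auto simp: interior_of_def euclid_top_def)
    then obtain r where "r > 0" "mball x r \<subseteq> T" "x \<in> carrier_vec n"
      unfolding openin_mtopology by blast
    moreover have "y \<in> K" if "y \<in> carrier_vec n" "euclid_dist n x y < r" for y
      using that T calculation by (auto simp: mball_def)
    ultimately show "x \<in> carrier_vec n \<and> (\<exists>r>0. \<forall>y\<in>carrier_vec n. euclid_dist n x y < r \<longrightarrow> y \<in> K)"
      by blast
  next
    assume "x \<in> carrier_vec n \<and> (\<exists>r>0. \<forall>y\<in>carrier_vec n. euclid_dist n x y < r \<longrightarrow> y \<in> K)"
    then obtain r where "x \<in> carrier_vec n" "r > 0" "\<forall>y\<in>carrier_vec n. euclid_dist n x y < r \<longrightarrow> y \<in> K"
      by blast
    then have "openin mtopology (mball x r)" "x \<in> mball x r" "mball x r \<subseteq> K"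
      by auto
    then show "x \<in> euclid_top n interior_of K"
      unfolding interior_of_def euclid_top_def by blast
  qed
qed

lemma coordinate_le_euclid_dist: "i < n \<Longrightarrow> \<bar>x $ i - y $ i\<bar> \<le> euclid_dist n x y"
  unfolding euclid_dist_def using member_le_L2_set[of "{..<n}" i "\<lambda>i. \<bar>x $ i - y $ i\<bar>"]
  by (simp add: L2_set_def)

lemma euclid_interior_box:
  assumes "x \<in> euclid_top n interior_of K"
  shows "\<exists>r>0. \<forall>y\<in>carrier_vec n. (\<forall>i<n. \<bar>x $ i - y $ i\<bar> \<le> r) \<longrightarrow> y \<in> K"
proof -
  obtain r where r: "r > 0" "\<forall>y\<in>carrier_vec n. euclid_dist n x y < r \<longrightarrow> y \<in> K"
    using assms unfolding euclid_interior_iff by blast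
  show ?thesis
  \<comment> \<open>Dividing by \<open>n + 1\<close> instead of \<open>n\<close> makes the summed
    distance strictly smaller than \<open>r\<close>.\<close>
  proof (intro exI[of _ "r / (real n + 1)"] conjI ballI impI)
    fix y :: "real vec"
    assume y: "y \<in> carrier_vec n" "\<forall>i<n. \<bar>x $ i - y $ i\<bar> \<le> r / (real n + 1)"
    have "euclid_dist n x y \<le> (\<Sum>i<n. \<bar>x $ i - y $ i\<bar>)"
      unfolding euclid_dist_def by (rule L2_set_le_sum_abs)
    also have "\<dots> \<le> (\<Sum>i<n. r / (real n + 1))" by (rule sum_mono) (use y in auto)
    also have "\<dots> < r" using r(1) by (simp add: field_simps)
    finally show "y \<in> K" using r y by blast
  qed (use r in simp)
qed

text \<open>Vectors are pulled back along \<open>vec n\<close> to functions on the naturals, where a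
  product of intervals is compact by Tychonoff. Coordinates beyond \<open>n\<close> are padded with
  zeros; the absolute value of \<open>R\<close> guarantees that the intervals contain 0.\<close>

lemma vec_attains_sup:
  fixes F :: "real vec \<Rightarrow> real"
  assumes C: "C \<noteq> {}" "C \<subseteq> carrier_vec n" and bdd: "\<And>y i. y \<in> C \<Longrightarrow> i < n \<Longrightarrow> \<bar>y $ i\<bar> \<le> R"
    and closed: "closed {f. vec n f \<in> C}" and cont: "continuous_on UNIV (\<lambda>f. F (vec n f))"
  shows "\<exists>y\<in>C. \<forall>y'\<in>C. F y' \<le> F y"
proof -
  let ?B = "PiE UNIV (\<lambda>i::nat. {-\<bar>R\<bar>..\<bar>R\<bar>})"
  have "compactin (product_topology (\<lambda>i. euclidean) UNIV) ?B"
    unfolding compactin_PiE by simp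
  then have "compact ?B" by (simp add: euclidean_product_topology)
  then have K: "compact (?B \<inter> {f. vec n f \<in> C})" using closed by (rule compact_Int_closed)
  have rep: "\<exists>f\<in>?B \<inter> {f. vec n f \<in> C}. vec n f = y" if "y \<in> C" for y
  proof (rule bexI[of _ "\<lambda>i. if i < n then y $ i else 0"])
    show eq: "vec n (\<lambda>i. if i < n then y $ i else 0) = y" using that C(2) by (intro eq_vecI) auto
    show "(\<lambda>i. if i < n then y $ i else 0) \<in> ?B \<inter> {f. vec n f \<in> C}"
      using that bdd[OF that] eq by (fastforce simp: PiE_def abs_le_iff)
  qed
  then have "?B \<inter> {f. vec n f \<in> C} \<noteq> {}" using C(1) by blast
  then obtain f where f: "f \<in> ?B \<inter> {f. vec n f \<in> C}"
      "\<forall>g\<in>?B \<inter> {f. vec n f \<in> C}. F (vec n g) \<le> F (vec n f)"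
    using continuous_attains_sup[OF K _ continuous_on_subset[OF cont subset_UNIV]] by blast
  show ?thesis
  proof (rule bexI[of _ "vec n f"], intro ballI)
    fix y' assume "y' \<in> C"
    then obtain g where "g \<in> ?B \<inter> {f. vec n f \<in> C}" "vec n g = y'" using rep by blast
    then show "F y' \<le> F (vec n f)" using f(2) by blast
  qed (use f in blast)
qed

lemma continuous_on_scalar_prod_vec: "continuous_on UNIV (\<lambda>f. x \<bullet> vec n f :: real)"
proof -
  have "x \<bullet> vec n f = (\<Sum>i<n. x $ i * f i)" for f
    by (simp add: scalar_prod_def atLeast0LessThan)
  moreover have "continuous_on UNIV (\<lambda>f. \<Sum>i<n. x $ i * f i)"
    by (intro continuous_on_sum continuous_on_mult continuous_on_const continuous_on_product_coordinates)
  ultimately show ?thesis by simp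
qed

lemma closed_dual_cone_vec: "closed {f. vec n f \<in> dual_cone n S}"
proof -
  have "{f. vec n f \<in> dual_cone n S} = (\<Inter>x\<in>S. {f. 0 \<le> x \<bullet> vec n f})"
    by (auto simp: dual_cone_def)
  also have "closed \<dots>"
    by (intro closed_INT ballI closed_Collect_le continuous_on_const continuous_on_scalar_prod_vec)
  finally show ?thesis .
qed

section \<open>Gradient certificates\<close>

text \<open>What the certificate argument needs from \<open>\<Lambda>\<close>, without polynomials.
  The matrices have the same order \<open>n\<close> as the vectors. The vectors \<open>a\<close> and
  \<open>b\<close> of a unit vector come from the two diagonal blocks, and injectivity is what makes
  the Hessian invertible.\<close>

locale moment_operator =
  fixes n :: nat and S :: "real vec set" and L :: "real vec \<Rightarrow> real mat"
  assumes n_pos: "n > 0"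
    and L_carrier: "x \<in> carrier_vec n \<Longrightarrow> L x \<in> carrier_mat n n"
    and L_sym: "x \<in> carrier_vec n \<Longrightarrow> (L x)\<^sup>T = L x"
    and L_add: "x \<in> carrier_vec n \<Longrightarrow> y \<in> carrier_vec n \<Longrightarrow> L (x + y) = L x + L y"
    and L_smult: "x \<in> carrier_vec n \<Longrightarrow> L (c \<cdot>\<^sub>v x) = c \<cdot>\<^sub>m L x"
    and L_inj: "x \<in> carrier_vec n \<Longrightarrow> L x = 0\<^sub>m n n \<Longrightarrow> x = 0\<^sub>v n"
    and L_unit: "i < n \<Longrightarrow>
      \<exists>a\<in>carrier_vec n. \<exists>b\<in>carrier_vec n. L (unit_vec n i) = outer a a + outer b b"
    and L_pos: "\<exists>y\<in>carrier_vec n. pos_def n (L y)"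
    and dual_iff: "y \<in> carrier_vec n \<Longrightarrow>
      y \<in> dual_cone n S \<longleftrightarrow> (\<forall>v\<in>carrier_vec n. v \<bullet> (L y *\<^sub>v v) \<ge> 0)"
begin

lemma L_zero: "L (0\<^sub>v n) = 0\<^sub>m n n"
proof -
  have "0\<^sub>v n = 0 \<cdot>\<^sub>v (0\<^sub>v n :: real vec)" by (intro eq_vecI) auto
  then have "L (0\<^sub>v n) = 0 \<cdot>\<^sub>m L (0\<^sub>v n)" using L_smult[of "0\<^sub>v n" 0] by simp
  also have "\<dots> = 0\<^sub>m n n" using L_carrier[of "0\<^sub>v n"] by (intro eq_matI) auto
  finally show ?thesis .
qed

lemma L_minus:
  assumes "x \<in> carrier_vec n" "y \<in> carrier_vec n"
  shows "L (x - y) = L x - L y"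
proof -
  have "x - y = x + (-1) \<cdot>\<^sub>v y" using assms by (intro eq_vecI) auto
  then have "L (x - y) = L x + (-1) \<cdot>\<^sub>m L y" using assms by (simp add: L_add L_smult)
  also have "\<dots> = L x - L y" using L_carrier[OF assms(1)] L_carrier[OF assms(2)] by (intro eq_matI) auto
  finally show ?thesis .
qed

lemma pos_def_imp_dual:
  assumes "x \<in> carrier_vec n" "pos_def n (L x)" shows "x \<in> dual_cone n S"
  unfolding dual_iff[OF assms(1)] using pos_def_scalar_nonneg[OF assms(2)] by blast

text \<open>The Hessian in closed form, without derivatives; \<open>hessian_barrier\<close>
  identifies it with \<open>hessian\<close> at the points where it is used.\<close>

definition hess :: "real vec \<Rightarrow> real mat" where
  "hess x = mat n n (\<lambda>(i, j). local_inner (L x) (L (unit_vec n i)) (L (unit_vec n j)))"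

lemma hess_carrier: "hess x \<in> carrier_mat n n"
  by (simp add: hess_def)

lemma hess_form:
  assumes x: "x \<in> carrier_vec n" "pos_def n (L x)" and u: "u \<in> carrier_vec n" and v: "v \<in> carrier_vec n"
  shows "u \<bullet> (hess x *\<^sub>v v) = local_inner (L x) (L u) (L v)"
proof -
  have d: "det (L x) \<noteq> 0" using pos_def_det[OF x(2)] by simp
  note A = L_carrier[OF x(1)] d
  have comm: "local_inner (L x) (L u) (L w) = local_inner (L x) (L w) (L u)"
    if "u \<in> carrier_vec n" "w \<in> carrier_vec n" for u w
    by (rule local_inner_commute[OF A L_carrier[OF that(1)] L_carrier[OF that(2)]])
  have expand: "local_inner (L x) (L u) (L w) = (\<Sum>i<n. u $ i * local_inner (L x) (L (unit_vec n i)) (L w))"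
    if u: "u \<in> carrier_vec n" and w: "w \<in> carrier_vec n" for u w
  proof (rule linear_functional_sum[OF _ _ u])
    fix y z :: "real vec" assume yz: "y \<in> carrier_vec n" "z \<in> carrier_vec n"
    show "local_inner (L x) (L (y + z)) (L w) = local_inner (L x) (L y) (L w) + local_inner (L x) (L z) (L w)"
      using local_inner_add_left[OF A L_carrier[OF yz(1)] L_carrier[OF yz(2)] L_carrier[OF w]]
      by (simp add: L_add yz)
  next
    fix y :: "real vec" and c :: real assume y: "y \<in> carrier_vec n"
    show "local_inner (L x) (L (c \<cdot>\<^sub>v y)) (L w) = c * local_inner (L x) (L y) (L w)"
      using local_inner_smult_left[OF A L_carrier[OF y] L_carrier[OF w]] by (simp add: L_smult y)
  qed
  have "local_inner (L x) (L (unit_vec n i)) (L v) =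
      (\<Sum>j<n. v $ j * local_inner (L x) (L (unit_vec n i)) (L (unit_vec n j)))" for i
  proof -
    have "local_inner (L x) (L (unit_vec n i)) (L v) = local_inner (L x) (L v) (L (unit_vec n i))"
      by (rule comm) (use v in auto)
    also have "\<dots> = (\<Sum>j<n. v $ j * local_inner (L x) (L (unit_vec n j)) (L (unit_vec n i)))"
      by (rule expand) (use v in auto)
    also have "\<dots> = (\<Sum>j<n. v $ j * local_inner (L x) (L (unit_vec n i)) (L (unit_vec n j)))"
      by (intro sum.cong refl arg_cong2[where f = "(*)"] comm) auto
    finally show ?thesis .
  qed
  then have "local_inner (L x) (L u) (L v) =
      (\<Sum>i<n. u $ i * (\<Sum>j<n. v $ j * local_inner (L x) (L (unit_vec n i)) (L (unit_vec n j))))"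
    unfolding expand[OF u v] by simp
  also have "\<dots> = (\<Sum>i<n. \<Sum>j<n. u $ i * hess x $$ (i, j) * v $ j)"
    by (simp add: hess_def sum_distrib_left mult_ac)
  finally show ?thesis using quad_form_sum[OF hess_carrier u v] by simp
qed

text \<open>A triangle inequality for the local norm over the coordinates of \<open>u\<close>:
  Cauchy-Schwarz bounds each entry of \<open>hess x\<close> by \<open>c i * c j\<close>, after which
  the double sum is a square.\<close>

lemma local_inner_L_bound:
  assumes x: "x \<in> carrier_vec n" "pos_def n (L x)" and u: "u \<in> carrier_vec n"
    and c: "\<And>i. i < n \<Longrightarrow> local_inner (L x) (L (unit_vec n i)) (L (unit_vec n i)) \<le> (c i)\<^sup>2"
      "\<And>i. i < n \<Longrightarrow> c i \<ge> 0"
  shows "local_inner (L x) (L u) (L u) \<le> (\<Sum>i<n. \<bar>u $ i\<bar> * c i)\<^sup>2"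
proof -
  have h: "\<bar>hess x $$ (i, j)\<bar> \<le> c i * c j" if ij: "i < n" "j < n" for i j
  proof -
    have s: "sqrt (local_inner (L x) (L (unit_vec n i)) (L (unit_vec n i))) \<le> c i" if "i < n" for i
      using c[OF that] by (simp add: real_le_lsqrt)
    have "\<bar>hess x $$ (i, j)\<bar> \<le> sqrt (local_inner (L x) (L (unit_vec n i)) (L (unit_vec n i))) *
        sqrt (local_inner (L x) (L (unit_vec n j)) (L (unit_vec n j)))"
      using local_inner_Cauchy_Schwarz[OF x(2) L_carrier L_sym L_carrier L_sym, of "unit_vec n i" "unit_vec n j"] ij
      by (simp add: hess_def)
    also have "\<dots> \<le> c i * c j"
      by (intro mult_mono s ij c real_sqrt_ge_zero local_inner_nonneg[OF x(2)] L_carrier L_sym unit_vec_carrier)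
    finally show ?thesis .
  qed
  have "local_inner (L x) (L u) (L u) = (\<Sum>i<n. \<Sum>j<n. u $ i * hess x $$ (i, j) * u $ j)"
    using hess_form[OF x u u] quad_form_sum[OF hess_carrier u u] by simp
  also have "\<dots> \<le> (\<Sum>i<n. \<Sum>j<n. (\<bar>u $ i\<bar> * c i) * (\<bar>u $ j\<bar> * c j))"
  proof (intro sum_mono)
    fix i j assume ij: "i \<in> {..<n}" "j \<in> {..<n}"
    have "u $ i * hess x $$ (i, j) * u $ j \<le> \<bar>u $ i\<bar> * \<bar>hess x $$ (i, j)\<bar> * \<bar>u $ j\<bar>"
      by (metis abs_ge_self abs_mult)
    also have "\<dots> \<le> \<bar>u $ i\<bar> * (c i * c j) * \<bar>u $ j\<bar>"
      using h ij by (intro mult_right_mono mult_left_mono) auto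
    finally show "u $ i * hess x $$ (i, j) * u $ j \<le> (\<bar>u $ i\<bar> * c i) * (\<bar>u $ j\<bar> * c j)"
      by (simp add: mult_ac)
  qed
  also have "\<dots> = (\<Sum>i<n. \<bar>u $ i\<bar> * c i)\<^sup>2"
    by (simp add: power2_eq_square sum_product)
  finally show ?thesis .
qed

text \<open>A kernel vector of the Hessian has local norm zero, hence a zero image under
  \<open>L\<close>, hence is zero. Thus \<open>mat_inverse\<close> does not return
  \<open>None\<close>.\<close>

lemma hess_inverse:
  assumes x: "x \<in> carrier_vec n" "pos_def n (L x)" and \<tau>: "\<tau> \<in> carrier_vec n"
  defines "w \<equiv> the (mat_inverse (hess x)) *\<^sub>v \<tau>"
  shows "the (mat_inverse (hess x)) \<in> carrier_mat n n" "w \<in> carrier_vec n" "hess x *\<^sub>v w = \<tau>"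
proof -
  have "det (hess x) \<noteq> 0"
  proof
    assume "det (hess x) = 0"
    then obtain v where v: "v \<in> carrier_vec n" "v \<noteq> 0\<^sub>v n" "hess x *\<^sub>v v = 0\<^sub>v n"
      using det_0_iff_vec_prod_zero_field[OF hess_carrier] by blast
    then have "local_inner (L x) (L v) (L v) = 0" using hess_form[OF x v(1,1)] by simp
    then have "L v = 0\<^sub>m n n" using local_inner_eq_0[OF x(2) L_carrier L_sym] v(1) by blast
    then show False using L_inj v by blast
  qed
  then have "hess x \<in> Units (ring_mat TYPE(real) n ())"
    by (rule det_non_zero_imp_unit[OF hess_carrier])
  then obtain B where "mat_inverse (hess x) = Some B"
    using mat_inverse(1)[OF hess_carrier, where b = "()"] by (cases "mat_inverse (hess x)") auto
  then have B: "the (mat_inverse (hess x)) = B" "hess x * B = 1\<^sub>m n" "B \<in> carrier_mat n n"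
    using mat_inverse(2)[OF hess_carrier] by auto
  then show "the (mat_inverse (hess x)) \<in> carrier_mat n n" "w \<in> carrier_vec n"
    using \<tau> by (auto simp: w_def)
  have "hess x *\<^sub>v (B *\<^sub>v \<tau>) = (hess x * B) *\<^sub>v \<tau>"
    by (rule assoc_mult_mat_vec[symmetric, OF hess_carrier B(3) \<tau>])
  then show "hess x *\<^sub>v w = \<tau>" using B \<tau> by (simp add: w_def)
qed

text \<open>A small enough ball around \<open>x\<close> is mapped into the Dikin ellipsoid of
  \<open>L x\<close>, on which definiteness persists.\<close>

lemma pos_def_imp_interior:
  assumes x: "x \<in> carrier_vec n" "pos_def n (L x)"
  shows "x \<in> euclid_top n interior_of dual_cone n S"
proof -
  define c where "c i = sqrt (local_inner (L x) (L (unit_vec n i)) (L (unit_vec n i)))" for i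
  have c: "c i \<ge> 0" "local_inner (L x) (L (unit_vec n i)) (L (unit_vec n i)) = (c i)\<^sup>2" for i
    using local_inner_nonneg[OF x(2) L_carrier L_sym, of "unit_vec n i"] by (auto simp: c_def)
  define r where "r = 1 / (1 + (\<Sum>i<n. c i))"
  have s: "(\<Sum>i<n. c i) \<ge> 0" using c by (intro sum_nonneg) auto
  have r: "r > 0" "r * (\<Sum>i<n. c i) < 1" using s by (auto simp: r_def field_simps)
  have "y \<in> dual_cone n S" if y: "y \<in> carrier_vec n" "euclid_dist n x y < r" for y
  proof -
    have yx: "y - x \<in> carrier_vec n" using y x by simp
    have "(\<Sum>i<n. \<bar>(y - x) $ i\<bar> * c i) \<le> (\<Sum>i<n. r * c i)"
    proof (intro sum_mono mult_right_mono)
      fix i assume "i \<in> {..<n}"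
      then show "\<bar>(y - x) $ i\<bar> \<le> r"
        using coordinate_le_euclid_dist[of i n x y] y x by (auto simp: abs_minus_commute)
    qed (use c in auto)
    also have "\<dots> < 1" using r by (simp add: sum_distrib_left)
    finally have "(\<Sum>i<n. \<bar>(y - x) $ i\<bar> * c i) < 1" .
    moreover have "(\<Sum>i<n. \<bar>(y - x) $ i\<bar> * c i) \<ge> 0" using c by (intro sum_nonneg) auto
    ultimately have "(\<Sum>i<n. \<bar>(y - x) $ i\<bar> * c i)\<^sup>2 < 1"
      by (simp add: abs_square_less_1)
    then have "local_inner (L x) (L (y - x)) (L (y - x)) < 1"
      using local_inner_L_bound[OF x yx, of c] c by fastforce
    then have "pos_def n (L x + L (y - x))"
      using Dikin_pos_def[OF x(2) L_carrier[OF yx] L_sym[OF yx]] by blast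
    moreover have "x + (y - x) = y" using x y by (intro eq_vecI) auto
    ultimately show ?thesis using L_add[OF x(1) yx] pos_def_imp_dual[OF y(1)] by simp
  qed
  then show ?thesis unfolding euclid_interior_iff using x(1) r(1) by blast
qed

text \<open>The gradient condition on \<open>y\<close> reads \<open>-g(y) = \<tau>\<close>. Writing \<open>w\<close> for the preimage of \<open>\<tau>\<close> under
  the Hessian at \<open>x\<close>, the local norm of \<open>w - x\<close> at \<open>x\<close> is at most that of \<open>x - y\<close> at \<open>y\<close>, hence
  below one, and \<open>w\<close> lies in the Dikin ellipsoid around \<open>x\<close>.\<close>

lemma near_gradient_certificate:
  assumes y: "y \<in> carrier_vec n" "pos_def n (L y)" and \<tau>: "\<tau> \<in> carrier_vec n"
    and grad: "\<And>u. u \<in> carrier_vec n \<Longrightarrow> mtrace (minv (L y) * L u) = \<tau> \<bullet> u"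
    and x: "x \<in> carrier_vec n" and near: "(\<Sum>i<n. \<bar>x $ i - y $ i\<bar> * \<tau> $ i) < 1"
  shows "pos_def n (L x)" "the (mat_inverse (hess x)) *\<^sub>v \<tau> \<in> dual_cone n S"
proof -
  \<comment> \<open>At a unit vector the gradient condition says that the trace is
    \<open>\<tau> $ i\<close>; for a semidefinite matrix of rank at most two this trace bounds the
    local norm.\<close>
  have diag: "local_inner (L y) (L (unit_vec n i)) (L (unit_vec n i)) \<le> (\<tau> $ i)\<^sup>2" "\<tau> $ i \<ge> 0"
    if i: "i < n" for i
  proof -
    obtain a b where ab: "a \<in> carrier_vec n" "b \<in> carrier_vec n" "L (unit_vec n i) = outer a a + outer b b"
      using L_unit[OF i] by blast
    have "mtrace (minv (L y) * L (unit_vec n i)) = \<tau> $ i"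
      using grad[of "unit_vec n i"] \<tau> i by simp
    then show "local_inner (L y) (L (unit_vec n i)) (L (unit_vec n i)) \<le> (\<tau> $ i)\<^sup>2" "\<tau> $ i \<ge> 0"
      using rank_two_bound[OF y(2) ab] by auto
  qed
  have xy: "x - y \<in> carrier_vec n" using x y by simp
  have "local_inner (L y) (L (x - y)) (L (x - y)) \<le> (\<Sum>i<n. \<bar>(x - y) $ i\<bar> * \<tau> $ i)\<^sup>2"
    by (rule local_inner_L_bound[OF y xy]) (use diag in auto)
  also have "(\<Sum>i<n. \<bar>(x - y) $ i\<bar> * \<tau> $ i) = (\<Sum>i<n. \<bar>x $ i - y $ i\<bar> * \<tau> $ i)"
    using x y by (intro sum.cong) auto
  also have "\<dots>\<^sup>2 < 1"
  proof -
    have "(\<Sum>i<n. \<bar>x $ i - y $ i\<bar> * \<tau> $ i) \<ge> 0" using diag by (intro sum_nonneg) auto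
    then show ?thesis using near by (simp add: abs_square_less_1)
  qed
  finally have lt: "local_inner (L y) (L (x - y)) (L (x - y)) < 1" .
  have "pos_def n (L y + L (x - y))"
    using Dikin_pos_def[OF y(2) L_carrier[OF xy] L_sym[OF xy] lt] .
  moreover have "y + (x - y) = x" using x y by (intro eq_vecI) auto
  ultimately show px: "pos_def n (L x)" using L_add[OF y(1) xy] by simp
  define w where "w = the (mat_inverse (hess x)) *\<^sub>v \<tau>"
  have w: "w \<in> carrier_vec n" "hess x *\<^sub>v w = \<tau>" using hess_inverse[OF x px \<tau>] by (auto simp: w_def)
  define z where "z = w - x"
  have z: "z \<in> carrier_vec n" using w x by (simp add: z_def)
  have hx: "hess x *\<^sub>v z = \<tau> - hess x *\<^sub>v x"
    unfolding z_def using mult_minus_distrib_mat_vec[OF hess_carrier w(1) x] w(2) by simp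
  have "local_inner (L x) (L z) (L z) = z \<bullet> (hess x *\<^sub>v z)" using hess_form[OF x px z z] by simp
  also have "\<dots> = z \<bullet> \<tau> - z \<bullet> (hess x *\<^sub>v x)"
    unfolding hx by (rule scalar_prod_minus_distrib[OF z \<tau> mult_mat_vec_carrier[OF hess_carrier x]])
  \<comment> \<open>Logarithmic homogeneity: applied to \<open>x\<close> itself, the Hessian at
    \<open>x\<close> is the negative gradient. The squared norm of \<open>z\<close> thereby becomes
    the pairing of \<open>z\<close> with a difference of gradients.\<close>
  also have "z \<bullet> (hess x *\<^sub>v x) = mtrace (minv (L x) * L z)"
    using hess_form[OF x px z x] local_inner_self[OF L_carrier[OF x] _ L_carrier[OF z]] pos_def_det[OF px] by simp
  also have "z \<bullet> \<tau> = mtrace (minv (L y) * L z)"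
    using grad[OF z] comm_scalar_prod[OF z \<tau>] by simp
  also have "mtrace (minv (L y) * L z) - mtrace (minv (L x) * L z) \<le>
      sqrt (local_inner (L y) (L x - L y) (L x - L y)) * sqrt (local_inner (L x) (L z) (L z))"
    using gradient_difference[OF px y(2) L_carrier[OF z] L_sym[OF z]] by simp
  finally have le: "local_inner (L x) (L z) (L z) \<le>
      sqrt (local_inner (L y) (L x - L y) (L x - L y)) * sqrt (local_inner (L x) (L z) (L z))" .
  define s where "s = sqrt (local_inner (L x) (L z) (L z))"
  have s: "s \<ge> 0" "local_inner (L x) (L z) (L z) = s\<^sup>2"
    using local_inner_nonneg[OF px L_carrier[OF z] L_sym[OF z]] by (auto simp: s_def)
  \<comment> \<open>The inequality \<open>le\<close> reads \<open>s\<^sup>2 \<le> \<rho> * s\<close>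
    with \<open>\<rho> < 1\<close>; it may be divided by \<open>s\<close> since \<open>s > 1\<close>
    is being refuted.\<close>
  have s1: "s \<le> 1"
  proof (rule ccontr)
    assume "\<not> s \<le> 1"
    then have "s * s \<le> sqrt (local_inner (L y) (L x - L y) (L x - L y)) * s"
      using le s by (simp add: power2_eq_square)
    then have "s \<le> sqrt (local_inner (L y) (L x - L y) (L x - L y))"
      using \<open>\<not> s \<le> 1\<close> by simp
    also have "\<dots> < 1" using lt L_minus[OF x y(1)] by simp
    finally show False using \<open>\<not> s \<le> 1\<close> by simp
  qed
  have "w \<in> dual_cone n S"
    unfolding dual_iff[OF w(1)]
  proof
    fix v :: "real vec" assume v: "v \<in> carrier_vec n"
    have nn: "v \<bullet> (L x *\<^sub>v v) \<ge> 0" by (rule pos_def_scalar_nonneg[OF px v])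
    have "\<bar>v \<bullet> (L z *\<^sub>v v)\<bar> \<le> s * (v \<bullet> (L x *\<^sub>v v))"
      unfolding s_def by (rule Dikin[OF px L_carrier[OF z] L_sym[OF z] v])
    also have "\<dots> \<le> v \<bullet> (L x *\<^sub>v v)" using s1 nn by (simp add: mult_left_le_one_le s)
    finally have "v \<bullet> (L x *\<^sub>v v) + v \<bullet> (L z *\<^sub>v v) \<ge> 0" by linarith
    moreover have "L w = L x + L z"
    proof -
      have "x + z = w" unfolding z_def using x w by (intro eq_vecI) auto
      then show ?thesis using L_add[OF x z] by simp
    qed
    ultimately show "v \<bullet> (L w *\<^sub>v v) \<ge> 0"
      using v L_carrier[OF x] L_carrier[OF z]
      by (simp add: add_mult_distrib_mat_vec[of _ n n] scalar_prod_add_distrib[of _ n])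
  qed
  then show "the (mat_inverse (hess x)) *\<^sub>v \<tau> \<in> dual_cone n S" by (simp add: w_def)
qed

lemma continuous_on_det_L: "continuous_on UNIV (\<lambda>f. det (L (vec n f)))"
proof -
  have entry: "L (vec n f) $$ (i, j) = (\<Sum>k<n. f k * L (unit_vec n k) $$ (i, j))" if ij: "i < n" "j < n" for f i j
  proof -
    have "L (vec n f) $$ (i, j) = (\<Sum>k<n. vec n f $ k * L (unit_vec n k) $$ (i, j))"
    proof (rule linear_functional_sum)
      fix x y :: "real vec" assume xy: "x \<in> carrier_vec n" "y \<in> carrier_vec n"
      then show "L (x + y) $$ (i, j) = L x $$ (i, j) + L y $$ (i, j)"
        using ij L_carrier[OF xy(1)] L_carrier[OF xy(2)] by (simp add: L_add)
    next
      fix x :: "real vec" and c :: real assume x: "x \<in> carrier_vec n"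
      then show "L (c \<cdot>\<^sub>v x) $$ (i, j) = c * L x $$ (i, j)"
        using ij L_carrier[OF x] by (simp add: L_smult)
    qed simp
    then show ?thesis by simp
  qed
  have "((\<lambda>f. det (L (vec n f))) \<longlongrightarrow> det (L (vec n g))) (at g)" for g
  proof (rule tendsto_det)
    fix i j assume ij: "i < n" "j < n"
    have "continuous_on UNIV (\<lambda>f. \<Sum>k<n. f k * L (unit_vec n k) $$ (i, j))"
      by (intro continuous_on_sum continuous_on_mult continuous_on_const continuous_on_product_coordinates)
    then have "((\<lambda>f. \<Sum>k<n. f k * L (unit_vec n k) $$ (i, j)) \<longlongrightarrow>
        (\<Sum>k<n. g k * L (unit_vec n k) $$ (i, j))) (at g)"
      unfolding continuous_on_def by blast
    then show "((\<lambda>f. L (vec n f) $$ (i, j)) \<longlongrightarrow> L (vec n g) $$ (i, j)) (at g)"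
      by (simp add: entry ij)
  qed (use L_carrier in auto)
  then show ?thesis unfolding continuous_on_def by simp
qed

text \<open>The determinant is maximised over the compact slice \<open>\<tau> \<bullet> y = n\<close> of the dual cone; stationarity
  at the maximiser is the gradient condition up to a factor, which the slice fixes to one.\<close>

lemma gradient_certificate_exists:
  assumes \<tau>: "\<tau> \<in> carrier_vec n" and \<delta>: "\<delta> > 0"
    and low: "\<And>y i. y \<in> dual_cone n S \<Longrightarrow> i < n \<Longrightarrow> \<delta> * \<bar>y $ i\<bar> \<le> \<tau> \<bullet> y"
  shows "\<exists>y\<in>dual_cone n S. pos_def n (L y) \<and> (\<forall>u\<in>carrier_vec n. mtrace (minv (L y) * L u) = \<tau> \<bullet> u)"
proof -
  define C where "C = {y \<in> dual_cone n S. \<tau> \<bullet> y = real n}"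
  have C: "y \<in> carrier_vec n" if "y \<in> C" for y using that by (auto simp: C_def dual_cone_def)
  obtain y0 where y0: "y0 \<in> carrier_vec n" "pos_def n (L y0)" using L_pos by blast
  \<comment> \<open>With a nonzero coordinate, \<open>low\<close> makes
    \<open>\<tau> \<bullet> y0\<close> positive, so that \<open>y0\<close> can be scaled onto the
    slice.\<close>
  have "y0 \<noteq> 0\<^sub>v n"
  proof
    assume "y0 = 0\<^sub>v n"
    then have "L y0 = 0\<^sub>m n n" by (simp add: L_zero)
    then show False using pos_def_det[OF y0(2)] det_zero[OF n_pos, where 'a = real] by simp
  qed
  then obtain i where i: "i < n" "y0 $ i \<noteq> 0"
    using y0(1) eq_vecI[of y0 "0\<^sub>v n"] by auto
  have "0 < \<delta> * \<bar>y0 $ i\<bar>" using i \<delta> by simp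
  also have "\<dots> \<le> \<tau> \<bullet> y0" by (rule low[OF pos_def_imp_dual[OF y0] i(1)])
  finally have t0: "\<tau> \<bullet> y0 > 0" .
  define y1 where "y1 = (real n / (\<tau> \<bullet> y0)) \<cdot>\<^sub>v y0"
  have y1: "y1 \<in> carrier_vec n" using y0 by (simp add: y1_def)
  have Ly1: "L y1 = (real n / (\<tau> \<bullet> y0)) \<cdot>\<^sub>m L y0" using L_smult y0 by (simp add: y1_def)
  have c0: "real n / (\<tau> \<bullet> y0) > 0" using t0 n_pos by simp
  have det1: "det (L y1) > 0"
    unfolding Ly1 using pos_def_det[OF y0(2)] c0 by simp
  have "y1 \<in> dual_cone n S"
    unfolding dual_iff[OF y1]
  proof
    fix v :: "real vec" assume v: "v \<in> carrier_vec n"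
    have "v \<bullet> (L y1 *\<^sub>v v) = (real n / (\<tau> \<bullet> y0)) * (v \<bullet> (L y0 *\<^sub>v v))"
      unfolding quad_form_sum[OF L_carrier[OF y1] v v] quad_form_sum[OF L_carrier[OF y0(1)] v v]
      unfolding Ly1 sum_distrib_left using L_carrier[OF y0(1)] by (intro sum.cong) auto
    then show "v \<bullet> (L y1 *\<^sub>v v) \<ge> 0" using mult_nonneg_nonneg[OF less_imp_le[OF c0] pos_def_scalar_nonneg[OF y0(2) v]] by simp
  qed
  moreover have "\<tau> \<bullet> y1 = real n" using t0 \<tau> y0 by (simp add: y1_def)
  ultimately have y1C: "y1 \<in> C" by (simp add: C_def)
  have "\<exists>y\<in>C. \<forall>y'\<in>C. det (L y') \<le> det (L y)"
  proof (rule vec_attains_sup)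
    show "C \<noteq> {}" using y1C by blast
    show "C \<subseteq> carrier_vec n" using C by blast
    show "\<bar>y $ i\<bar> \<le> real n / \<delta>" if "y \<in> C" "i < n" for y i
      using low[of y i] that \<delta> by (auto simp: C_def field_simps)
    have "{f. vec n f \<in> C} = {f. vec n f \<in> dual_cone n S} \<inter> {f. \<tau> \<bullet> vec n f = real n}"
      by (auto simp: C_def)
    then show "closed {f. vec n f \<in> C}"
      by (auto intro!: closed_Int closed_dual_cone_vec closed_Collect_eq continuous_on_scalar_prod_vec)
    show "continuous_on UNIV (\<lambda>f. det (L (vec n f)))" by (rule continuous_on_det_L)
  qed
  then obtain y where y: "y \<in> C" "\<And>y'. y' \<in> C \<Longrightarrow> det (L y') \<le> det (L y)" by blast
  have yc: "y \<in> carrier_vec n" "y \<in> dual_cone n S" "\<tau> \<bullet> y = real n" using y C by (auto simp: C_def)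
  \<comment> \<open>The scaled point \<open>y1\<close> competes in the maximum. The positive
    determinant keeps the maximiser off the boundary of the semidefinite cone, where stationarity
    could fail.\<close>
  have dy: "det (L y) > 0" using y(2)[OF y1C] det1 by simp
  then have pd: "pos_def n (L y)"
    using yc dual_iff[OF yc(1)] by (intro pos_semidef_det_imp_pos_def L_carrier L_sym) auto
  have stat: "mtrace (minv (L y) * L u) = 0" if u: "u \<in> carrier_vec n" "\<tau> \<bullet> u = 0" for u
  proof -
    define c where "c = local_inner (L y) (L u) (L u)"
    have c: "c \<ge> 0" using local_inner_nonneg[OF pd L_carrier L_sym] u by (simp add: c_def)
    have su: "s \<cdot>\<^sub>v u \<in> carrier_vec n" for s using u by simp
    have line: "L (y + s \<cdot>\<^sub>v u) = L y + s \<cdot>\<^sub>m L u" for s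
      using L_add[OF yc(1) su] L_smult[OF u(1)] by simp
    \<comment> \<open>For these \<open>s\<close> one gets
      \<open>s\<^sup>2 * c \<le> \<bar>s\<bar> * c < 1\<close>, so the line stays in the Dikin
      ellipsoid around \<open>L y\<close>, while \<open>\<tau> \<bullet> u = 0\<close> keeps it on
      the slice.\<close>
    have inC: "y + s \<cdot>\<^sub>v u \<in> C" if s: "\<bar>s\<bar> < 1 / (1 + c)" for s
    proof -
      have "\<bar>s\<bar> * (1 + c) < 1" using s c by (simp add: field_simps)
      moreover have "1 / (1 + c) \<le> 1" using c by simp
      then have "\<bar>s\<bar> < 1" using s by linarith
      then have "s\<^sup>2 \<le> \<bar>s\<bar>"
        using mult_left_le[of "\<bar>s\<bar>" "\<bar>s\<bar>"] by (simp add: power2_eq_square)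
      then have "s\<^sup>2 * c \<le> \<bar>s\<bar> * c" using c by (rule mult_right_mono)
      ultimately have "s\<^sup>2 * c < 1" by (simp add: algebra_simps)
      moreover have "local_inner (L y) (s \<cdot>\<^sub>m L u) (s \<cdot>\<^sub>m L u) = s\<^sup>2 * c"
      proof -
        note A = L_carrier[OF yc(1)] and U = L_carrier[OF u(1)]
        have d: "det (L y) \<noteq> 0" using dy by simp
        have sU: "s \<cdot>\<^sub>m L u \<in> carrier_mat n n" using U by simp
        show ?thesis
          using local_inner_smult_left[OF A d U sU, of s] local_inner_commute[OF A d U sU]
            local_inner_smult_left[OF A d U U, of s] by (simp add: c_def power2_eq_square)
      qed
      ultimately have "pos_def n (L y + s \<cdot>\<^sub>m L u)"
        using Dikin_pos_def[OF pd, of "s \<cdot>\<^sub>m L u"] L_carrier[OF su] L_sym[OF su] L_smult[OF u(1)] by simp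
      then have "y + s \<cdot>\<^sub>v u \<in> dual_cone n S"
        using pos_def_imp_dual[of "y + s \<cdot>\<^sub>v u"] line yc su by simp
      moreover have "\<tau> \<bullet> (y + s \<cdot>\<^sub>v u) = real n"
        using \<tau> yc u su by (simp add: scalar_prod_add_distrib[of _ n])
      ultimately show ?thesis by (simp add: C_def)
    qed
    have "((\<lambda>s. det (L y + s \<cdot>\<^sub>m L u)) has_real_derivative det (L y) * mtrace (minv (L y) * L u)) (at 0)"
      by (rule det_line_derivative[OF L_carrier[OF yc(1)] _ L_carrier[OF u(1)]]) (use dy in simp)
    then have "det (L y) * mtrace (minv (L y) * L u) = 0"
    proof (rule DERIV_local_max)
      show "0 < 1 / (1 + c)" using c by simp
      have "L y + 0 \<cdot>\<^sub>m L u = L y"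
        using L_carrier[OF yc(1)] L_carrier[OF u(1)] by (intro eq_matI) auto
      then show "\<forall>s. \<bar>0 - s\<bar> < 1 / (1 + c) \<longrightarrow> det (L y + s \<cdot>\<^sub>m L u) \<le> det (L y + 0 \<cdot>\<^sub>m L u)"
        using y(2)[OF inC] line by simp
    qed
    then show ?thesis using dy by simp
  qed
  have "mtrace (minv (L y) * L u) = \<tau> \<bullet> u" if u: "u \<in> carrier_vec n" for u
  proof -
    \<comment> \<open>Subtracting \<open>s\<close> times \<open>y\<close> leaves a vector tangent to
      the slice. Along \<open>y\<close> both sides equal \<open>n\<close>: one is the trace of the
      identity, the other the level of the slice.\<close>
    define s where "s = (\<tau> \<bullet> u) / real n"
    define u' where "u' = u - s \<cdot>\<^sub>v y"
    have u': "u' \<in> carrier_vec n" using u yc by (simp add: u'_def)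
    have "\<tau> \<bullet> u' = \<tau> \<bullet> u - s * real n"
      unfolding u'_def using \<tau> u yc by (simp add: scalar_prod_minus_distrib[of _ n])
    then have "\<tau> \<bullet> u' = 0" using n_pos by (simp add: s_def)
    then have 0: "mtrace (minv (L y) * L u') = 0" by (rule stat[OF u'])
    note G = minv(1)[OF L_carrier[OF yc(1)]] and LY = L_carrier[OF yc(1)] and LU = L_carrier[OF u]
    have G: "minv (L y) \<in> carrier_mat n n" using G dy by simp
    have "L u' = L u - s \<cdot>\<^sub>m L y" unfolding u'_def using L_minus u yc L_smult by simp
    then have "minv (L y) * L u' = minv (L y) * L u - s \<cdot>\<^sub>m (minv (L y) * L y)"
      using mult_minus_distrib_mat[OF G LU, of "s \<cdot>\<^sub>m L y"] mult_smult_distrib[OF G LY, of s] LY by simp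
    then have "mtrace (minv (L y) * L u') = mtrace (minv (L y) * L u) - s * mtrace (minv (L y) * L y)"
      using G LY LU by (simp add: mtrace_minus[of _ n] mtrace_smult[of _ n])
    then show ?thesis using 0 mtrace_minv_self[OF pd] n_pos by (simp add: s_def)
  qed
  then show ?thesis using yc pd by blast
qed

end

section \<open>The moment operator of the weighted sums of squares cone\<close>

lemma module_poly: "Modules.module (smult :: real \<Rightarrow> real poly \<Rightarrow> real poly)"
  by unfold_locales (simp_all add: smult_add_right smult_add_left)

lemma ordered_basis_expand:
  assumes b: "ordered_basis k p" and g: "degree g \<le> k"
  obtains c where "g = (\<Sum>r\<le>k. smult (c r) (p r))"
proof -
  have "g \<in> Modules.module.span smult (p ` {..k})"
    using b g by (simp add: ordered_basis_def)
  then obtain u where "g = (\<Sum>v\<in>p ` {..k}. smult (u v) v)"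
    unfolding Modules.module.span_finite[OF module_poly finite_imageI[OF finite_atMost]] by blast
  also have "\<dots> = (\<Sum>r\<le>k. smult (u (p r)) (p r))"
    using b by (subst sum.reindex) (auto simp: ordered_basis_def)
  finally show ?thesis by (rule that)
qed

lemma ordered_basis_independent:
  assumes b: "ordered_basis k p" and 0: "(\<Sum>r\<le>k. smult (c r) (p r)) = 0" and r: "r \<le> k"
  shows "c r = 0"
proof -
  have inj: "inj_on p {..k}" using b by (simp add: ordered_basis_def)
  have "(\<Sum>v\<in>p ` {..k}. smult (c (the_inv_into {..k} p v)) v) = 0"
    using 0 inj by (subst sum.reindex) (auto simp: the_inv_into_f_f)
  then have "c (the_inv_into {..k} p (p r)) = 0"
    using b r unfolding ordered_basis_def
    by (intro Modules.module.independentD[OF module_poly, of "p ` {..k}" "p ` {..k}" "\<lambda>v. c (the_inv_into {..k} p v)"]) auto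
  then show ?thesis using inj r by (simp add: the_inv_into_f_f)
qed

lemma ordered_basis_degree: "ordered_basis k p \<Longrightarrow> r \<le> k \<Longrightarrow> degree (p r) \<le> k"
proof -
  assume b: "ordered_basis k p" and r: "r \<le> k"
  have "p r \<in> Modules.module.span smult (p ` {..k})"
    by (rule Modules.module.span_base[OF module_poly]) (use r in auto)
  then show ?thesis using b by (simp add: ordered_basis_def)
qed

lemma weight_nonneg:
  assumes "x \<in> {-1..1}" shows "poly (weight1 D) x \<ge> 0" "poly (weight2 D) x \<ge> 0"
proof -
  have "x * x \<le> 1" using assms abs_square_le_1[of x] by (simp add: abs_le_iff power2_eq_square)
  then show "poly (weight1 D) x \<ge> 0" "poly (weight2 D) x \<ge> 0"
    using assms by (auto simp: weight1_def weight2_def)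
qed

lemma weight_pos:
  assumes "x \<in> {-1<..<1}" shows "poly (weight1 D) x > 0" "poly (weight2 D) x > 0"
proof -
  have "x * x < 1" using assms abs_square_less_1[of x] by (simp add: abs_less_iff power2_eq_square)
  then show "poly (weight1 D) x > 0" "poly (weight2 D) x > 0"
    using assms by (auto simp: weight1_def weight2_def)
qed

text \<open>The bound \<open>D \<ge> 2\<close> excludes \<open>D = 0\<close>, where truncated
  subtraction in \<open>deg2\<close> admits \<open>1 - z^2\<close>.\<close>

lemma wsos_degree:
  assumes "p \<in> wsos_polys D" "D \<ge> 2" shows "degree p \<le> D"
proof -
  obtain \<sigma> \<tau> where p: "\<sigma> \<in> sos_polys (deg1 D)" "\<tau> \<in> sos_polys (deg2 D)" "p = weight1 D * \<sigma> + weight2 D * \<tau>"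
    using assms(1) by (auto simp: wsos_polys_def)
  have "degree (weight1 D * \<sigma>) \<le> D"
    using degree_mult_le[of "weight1 D" \<sigma>] sos_degree[OF p(1)]
    by (cases "even D") (auto simp: weight1_def deg1_def elim!: evenE oddE)
  moreover have "degree (weight2 D * \<tau>) \<le> D"
    using degree_mult_le[of "weight2 D" \<tau>] sos_degree[OF p(2)] assms(2)
    by (cases "even D") (auto simp: weight2_def deg2_def elim!: evenE oddE)
  ultimately show ?thesis unfolding p(3) by (rule degree_add_le)
qed

lemma scalar_prod_sum: "v \<in> carrier_vec n \<Longrightarrow> w \<bullet> v = (\<Sum>i<n. w $ i * v $ i)" for v w :: "real vec"
  by (auto simp: scalar_prod_def atLeast0LessThan)

locale lagrange_nodes =
  fixes D :: nat and z :: "nat \<Rightarrow> real" and q :: "nat \<Rightarrow> real poly"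
  assumes inj: "inj_on z {..D}" and nodes: "z ` {..D} \<subseteq> {-1..1}" and lagrange: "lagrange_basis D z q"
begin

declare One_nat_def [simp del]

lemma q_degree: "i \<le> D \<Longrightarrow> degree (q i) \<le> D"
  using lagrange by (simp add: lagrange_basis_def)

lemma q_node: "i \<le> D \<Longrightarrow> j \<le> D \<Longrightarrow> poly (q i) (z j) = (if i = j then 1 else 0)"
  using lagrange by (simp add: lagrange_basis_def)

lemma node_range: "i \<le> D \<Longrightarrow> z i \<in> {-1..1}"
  using nodes by auto

lemma poly_eq_of_nodes:
  assumes "degree P \<le> D" "degree R \<le> D" "\<And>i. i \<le> D \<Longrightarrow> poly P (z i) = poly R (z i)"
  shows "P = R"
proof (rule poly_eqI_degree[of "z ` {..D}"])
  have "card (z ` {..D}) = D + 1" using inj by (simp add: card_image)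
  then show "degree P < card (z ` {..D})" "degree R < card (z ` {..D})" using assms by auto
qed (use assms in auto)

text \<open>In a Lagrange basis the coefficients are the values at the nodes, so this inverts
  \<open>poly_of_vec\<close> on degree at most \<open>D\<close>.\<close>

definition node_vec :: "real poly \<Rightarrow> real vec" where
  "node_vec P = vec (D + 1) (\<lambda>i. poly P (z i))"

lemma node_vec_carrier: "node_vec P \<in> carrier_vec (D + 1)"
  by (simp add: node_vec_def)

lemma poly_of_vec_degree: "degree (poly_of_vec D q x) \<le> D"
  unfolding poly_of_vec_def
  by (rule degree_sum_le) (auto simp: q_degree)

lemma poly_of_vec_node: "j \<le> D \<Longrightarrow> poly (poly_of_vec D q x) (z j) = x $ j"
  by (simp add: poly_of_vec_def poly_sum q_node if_distrib[of "(*) _"] sum.delta cong: if_cong)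

lemma poly_of_node_vec: "degree P \<le> D \<Longrightarrow> poly_of_vec D q (node_vec P) = P"
  by (rule poly_eq_of_nodes[OF poly_of_vec_degree]) (auto simp: poly_of_vec_node node_vec_def)

lemma node_vec_poly_of_vec: "x \<in> carrier_vec (D + 1) \<Longrightarrow> node_vec (poly_of_vec D q x) = x"
  by (intro eq_vecI) (auto simp: node_vec_def poly_of_vec_node)

text \<open>A Lagrange basis is a partition of unity.\<close>

lemma coeff_vec_one: "coeff_vec D q 1 = vec (D + 1) (\<lambda>_. 1)"
  unfolding coeff_vec_def
proof (rule the_equality)
  have eq: "node_vec 1 = vec (D + 1) (\<lambda>_. 1)" by (simp add: node_vec_def)
  show "vec (D + 1) (\<lambda>_. 1) \<in> carrier_vec (D + 1) \<and> poly_of_vec D q (vec (D + 1) (\<lambda>_. 1)) = 1"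
    using poly_of_node_vec[of 1] by (simp flip: eq add: node_vec_carrier)
  show "x = vec (D + 1) (\<lambda>_. 1)" if "x \<in> carrier_vec (D + 1) \<and> poly_of_vec D q x = 1" for x
    using node_vec_poly_of_vec[of x] that eq by simp
qed

lemma one_scalar_prod: "v \<in> carrier_vec (D + 1) \<Longrightarrow> coeff_vec D q 1 \<bullet> v = (\<Sum>i<D + 1. v $ i)"
  unfolding coeff_vec_one by (subst scalar_prod_sum[of _ "D + 1"]) auto

lemma eval_vec_node: "i \<le> D \<Longrightarrow> eval_vec (D + 1) q (z i) = unit_vec (D + 1) i"
  by (intro eq_vecI) (auto simp: eval_vec_def q_node unit_vec_def)

lemma wsos_cone_carrier: "wsos_cone D q \<subseteq> carrier_vec (D + 1)"
  by (auto simp: wsos_cone_def)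

lemma node_vec_in_cone: "P \<in> wsos_polys D \<Longrightarrow> degree P \<le> D \<Longrightarrow> node_vec P \<in> wsos_cone D q"
  by (simp add: wsos_cone_def node_vec_carrier poly_of_node_vec)

text \<open>Reads \<open>y\<close> as the functional that sums node values with weights
  \<open>y $ i\<close>, so that duality can be tested on polynomials instead of coefficient
  vectors.\<close>

lemma dual_iff_nodes:
  assumes "D \<ge> 2" "y \<in> carrier_vec (D + 1)"
  shows "y \<in> dual_cone (D + 1) (wsos_cone D q) \<longleftrightarrow>
    (\<forall>P\<in>wsos_polys D. (\<Sum>i<D + 1. poly P (z i) * y $ i) \<ge> 0)"
proof -
  have sp: "node_vec P \<bullet> y = (\<Sum>i<D + 1. poly P (z i) * y $ i)" for P
    using assms(2) by (subst scalar_prod_sum[of _ "D + 1"]) (auto simp: node_vec_def)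
  show ?thesis
  proof
    assume y: "y \<in> dual_cone (D + 1) (wsos_cone D q)"
    show "\<forall>P\<in>wsos_polys D. (\<Sum>i<D + 1. poly P (z i) * y $ i) \<ge> 0"
    proof
      fix P assume P: "P \<in> wsos_polys D"
      then have "node_vec P \<in> wsos_cone D q" by (intro node_vec_in_cone wsos_degree assms(1))
      then have "node_vec P \<bullet> y \<ge> 0" using y by (simp add: dual_cone_def)
      then show "(\<Sum>i<D + 1. poly P (z i) * y $ i) \<ge> 0" unfolding sp .
    qed
  next
    assume *: "\<forall>P\<in>wsos_polys D. (\<Sum>i<D + 1. poly P (z i) * y $ i) \<ge> 0"
    have "x \<bullet> y \<ge> 0" if "x \<in> wsos_cone D q" for x
    proof -
      have x: "x \<in> carrier_vec (D + 1)" "poly_of_vec D q x \<in> wsos_polys D" using that by (auto simp: wsos_cone_def)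
      have "node_vec (poly_of_vec D q x) \<bullet> y \<ge> 0" unfolding sp using * x(2) by blast
      then show ?thesis unfolding node_vec_poly_of_vec[OF x(1)] .
    qed
    then show "y \<in> dual_cone (D + 1) (wsos_cone D q)" using assms(2) by (simp add: dual_cone_def)
  qed
qed

text \<open>A unit vector acts as evaluation at a node, and the nodes lie in the interval.\<close>

lemma unit_vec_in_dual:
  assumes "D \<ge> 2" "i \<le> D"
  shows "unit_vec (D + 1) i \<in> dual_cone (D + 1) (wsos_cone D q)"
proof -
  have "(\<Sum>j<D + 1. poly P (z j) * unit_vec (D + 1) i $ j) \<ge> 0" if "P \<in> wsos_polys D" for P
    using wsos_nonneg[OF that node_range]
    by (intro sum_nonneg) (auto simp: unit_vec_def)
  then show ?thesis using dual_iff_nodes[OF assms(1), of "unit_vec (D + 1) i"] by simp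
qed

lemma abs_q_le:
  assumes "i \<le> D" "t \<in> {-1..1}"
  shows "\<bar>poly (q i) t\<bar> \<le> basis_max_abs D q"
proof -
  have "compact ((\<lambda>t. \<bar>poly (q i) t\<bar>) ` {-1..1})"
    by (intro compact_continuous_image continuous_intros) auto
  then have "bdd_above ((\<lambda>t. \<bar>poly (q i) t\<bar>) ` {-1..1})"
    by (intro bounded_imp_bdd_above compact_imp_bounded)
  then have "\<bar>poly (q i) t\<bar> \<le> (SUP t\<in>{-1..1}. \<bar>poly (q i) t\<bar>)"
    using assms(2) by (intro cSUP_upper) auto
  also have "\<dots> \<le> basis_max_abs D q"
    unfolding basis_max_abs_def using assms(1) by (intro Max_ge) auto
  finally show ?thesis .
qed

lemma basis_max_abs_ge_1: "basis_max_abs D q \<ge> 1"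
  using abs_q_le[of 0 "z 0"] node_range[of 0] q_node[of 0 0] by simp

text \<open>Here the Markov-Lukacs theorem enters: \<open>\<mu> + q\<^sub>i\<close> and \<open>\<mu> - q\<^sub>i\<close> are nonnegative on
  \<open>[-1, 1]\<close>, hence lie in the cone.\<close>

lemma dual_coordinate_bound:
  assumes D: "D \<ge> 2" and y: "y \<in> dual_cone (D + 1) (wsos_cone D q)" and i: "i \<le> D"
  shows "\<bar>y $ i\<bar> \<le> basis_max_abs D q * (\<Sum>j<D + 1. y $ j)"
proof -
  have yc: "y \<in> carrier_vec (D + 1)" using y by (simp add: dual_cone_def)
  have "(\<Sum>j<D + 1. (basis_max_abs D q + c * (if i = j then 1 else 0)) * y $ j) \<ge> 0" if c: "\<bar>c\<bar> = 1" for c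
  proof -
    define P where "P = [:basis_max_abs D q:] + smult c (q i)"
    have "P \<in> wsos_polys D"
    proof (rule Markov_Lukacs)
      show "degree P \<le> D"
        unfolding P_def using q_degree[OF i] degree_smult_le[of c "q i"]
        by (intro degree_add_le) auto
      show "poly P t \<ge> 0" if "t \<in> {-1..1}" for t
      proof -
        have "\<bar>c * poly (q i) t\<bar> \<le> basis_max_abs D q" using abs_q_le[OF i that] c by (simp add: abs_mult)
        then show ?thesis by (simp add: P_def)
      qed
    qed (use D in simp)
    then have "(\<Sum>j<D + 1. poly P (z j) * y $ j) \<ge> 0" using y dual_iff_nodes[OF D yc] by blast
    moreover have "(\<Sum>j<D + 1. poly P (z j) * y $ j) =
        (\<Sum>j<D + 1. (basis_max_abs D q + c * (if i = j then 1 else 0)) * y $ j)"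
      by (intro sum.cong) (auto simp: P_def q_node i)
    ultimately show ?thesis by simp
  qed
  moreover have "(\<Sum>j<D + 1. (basis_max_abs D q + c * (if i = j then 1 else 0)) * y $ j) =
      basis_max_abs D q * (\<Sum>j<D + 1. y $ j) + c * y $ i" for c
  proof -
    have "(\<Sum>j<D + 1. (basis_max_abs D q + c * (if i = j then 1 else 0)) * y $ j) =
        (\<Sum>j<D + 1. basis_max_abs D q * y $ j) + (\<Sum>j<D + 1. if i = j then c * y $ j else 0)"
      unfolding sum.distrib[symmetric] by (intro sum.cong) (auto simp: algebra_simps)
    also have "(\<Sum>j<D + 1. if i = j then c * y $ j else 0) = c * y $ i"
      using i by (subst sum.delta') auto
    finally show ?thesis by (simp add: sum_distrib_left)
  qed
  ultimately have "basis_max_abs D q * (\<Sum>j<D + 1. y $ j) + c * y $ i \<ge> 0" if "\<bar>c\<bar> = 1" for c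
    using that by metis
  from this[of 1] this[of "-1"] show ?thesis by (simp add: abs_le_iff)
qed

end

locale wsos_moment = lagrange_nodes +
  fixes p1 p2 :: "nat \<Rightarrow> real poly" and L1 L2 :: "real vec \<Rightarrow> real mat"
  assumes D: "D \<ge> 2"
    and p1: "ordered_basis (deg1 D) p1" and p2: "ordered_basis (deg2 D) p2"
    and L1: "moment_map D q (weight1 D) (deg1 D) p1 L1"
    and L2: "moment_map D q (weight2 D) (deg2 D) p2 L2"
begin

declare One_nat_def [simp del]

abbreviation "U \<equiv> D + 1"
abbreviation "k1 \<equiv> deg1 D"
abbreviation "k2 \<equiv> deg2 D"

text \<open>For even \<open>D\<close> the smaller second block compensates the extra weight degree;
  \<open>D \<ge> 2\<close> keeps the subtraction in \<open>deg2\<close> from truncating. This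
  equality is what fits \<open>\<Lambda>\<close> into \<open>moment_operator\<close>.\<close>

lemma order_sum: "(k1 + 1) + (k2 + 1) = U"
proof (cases "even D")
  case True
  then show ?thesis using D by (auto simp: deg1_def deg2_def elim!: evenE)
next
  case False
  then show ?thesis by (auto simp: deg1_def deg2_def elim!: oddE)
qed

section \<open>The block operator and its linearity\<close>

definition \<Lambda> :: "real vec \<Rightarrow> real mat" where
  "\<Lambda> x = dsum_mat (L1 x) (L2 x)"

lemma L1_dims: "x \<in> carrier_vec U \<Longrightarrow> L1 x \<in> carrier_mat (k1 + 1) (k1 + 1)"
  and L2_dims: "x \<in> carrier_vec U \<Longrightarrow> L2 x \<in> carrier_mat (k2 + 1) (k2 + 1)"
  using L1 L2 unfolding moment_map_def by blast+

lemma \<Lambda>_carrier: assumes "x \<in> carrier_vec U" shows "\<Lambda> x \<in> carrier_mat U U"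
  using four_block_carrier_mat[OF L1_dims[OF assms] L2_dims[OF assms]]
  unfolding \<Lambda>_def dsum_mat_def order_sum .

lemma \<Lambda>_index:
  assumes x: "x \<in> carrier_vec U" and ij: "i < U" "j < U"
  shows "\<Lambda> x $$ (i, j) = (if i \<le> k1 \<and> j \<le> k1 then L1 x $$ (i, j)
    else if i > k1 \<and> j > k1 then L2 x $$ (i - (k1 + 1), j - (k1 + 1)) else 0)"
  using L1_dims[OF x] L2_dims[OF x] ij order_sum unfolding \<Lambda>_def dsum_mat_def
  by auto

lemma block_ij:
  assumes "i < U" "j < U"
  obtains "i \<le> k1" "j \<le> k1" "i < k1 + 1" "j < k1 + 1"
  | "i > k1" "j > k1" "i - (k1 + 1) < k2 + 1" "j - (k1 + 1) < k2 + 1"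
  | "\<not> (i \<le> k1 \<and> j \<le> k1)" "\<not> (i > k1 \<and> j > k1)"
proof -
  consider "i \<le> k1 \<and> j \<le> k1" | "i > k1 \<and> j > k1" | "\<not> (i \<le> k1 \<and> j \<le> k1) \<and> \<not> (i > k1 \<and> j > k1)"
    by blast
  then show thesis
    by cases (use assms order_sum that in auto)
qed

lemma \<Lambda>_add:
  assumes "x \<in> carrier_vec U" "y \<in> carrier_vec U" shows "\<Lambda> (x + y) = \<Lambda> x + \<Lambda> y"
proof (rule eq_matI)
  have add: "L1 (x + y) = L1 x + L1 y" "L2 (x + y) = L2 x + L2 y"
    using L1 L2 assms unfolding moment_map_def by blast+
  fix i j assume "i < dim_row (\<Lambda> x + \<Lambda> y)" "j < dim_col (\<Lambda> x + \<Lambda> y)"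
  then have ij: "i < U" "j < U" using \<Lambda>_carrier[OF assms(2)] by auto
  have xy: "x + y \<in> carrier_vec U" using assms by simp
  show "\<Lambda> (x + y) $$ (i, j) = (\<Lambda> x + \<Lambda> y) $$ (i, j)"
    using \<Lambda>_carrier[OF assms(1)] \<Lambda>_carrier[OF assms(2)] ij
      L1_dims[OF assms(1)] L1_dims[OF assms(2)] L2_dims[OF assms(1)] L2_dims[OF assms(2)]
    by (cases rule: block_ij[OF ij]) (auto simp: \<Lambda>_index[OF xy] \<Lambda>_index[OF assms(1)] \<Lambda>_index[OF assms(2)] add)
qed (use \<Lambda>_carrier[OF assms(2)] \<Lambda>_carrier[of "x + y"] assms in auto)

lemma \<Lambda>_smult:
  assumes "x \<in> carrier_vec U" shows "\<Lambda> (c \<cdot>\<^sub>v x) = c \<cdot>\<^sub>m \<Lambda> x"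
proof (rule eq_matI)
  have smult: "L1 (c \<cdot>\<^sub>v x) = c \<cdot>\<^sub>m L1 x" "L2 (c \<cdot>\<^sub>v x) = c \<cdot>\<^sub>m L2 x"
    using L1 L2 assms unfolding moment_map_def by blast+
  fix i j assume "i < dim_row (c \<cdot>\<^sub>m \<Lambda> x)" "j < dim_col (c \<cdot>\<^sub>m \<Lambda> x)"
  then have ij: "i < U" "j < U" using \<Lambda>_carrier[OF assms] by auto
  have cx: "c \<cdot>\<^sub>v x \<in> carrier_vec U" using assms by simp
  show "\<Lambda> (c \<cdot>\<^sub>v x) $$ (i, j) = (c \<cdot>\<^sub>m \<Lambda> x) $$ (i, j)"
    using \<Lambda>_carrier[OF assms] ij L1_dims[OF assms] L2_dims[OF assms]
    by (cases rule: block_ij[OF ij]) (auto simp: \<Lambda>_index[OF cx] \<Lambda>_index[OF assms] smult)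
qed (use \<Lambda>_carrier[OF assms] \<Lambda>_carrier[of "c \<cdot>\<^sub>v x"] assms in auto)

lemma \<Lambda>_sym:
  assumes "x \<in> carrier_vec U" shows "(\<Lambda> x)\<^sup>T = \<Lambda> x"
proof (rule eq_matI)
  have T: "(L1 x)\<^sup>T = L1 x" "(L2 x)\<^sup>T = L2 x"
    using L1 L2 assms unfolding moment_map_def by blast+
  have sym: "L1 x $$ (j, i) = L1 x $$ (i, j)" if "i < k1 + 1" "j < k1 + 1" for i j
    using index_transpose_mat(1)[of i "L1 x" j] L1_dims[OF assms] that T by simp
  have sym2: "L2 x $$ (j, i) = L2 x $$ (i, j)" if "i < k2 + 1" "j < k2 + 1" for i j
    using index_transpose_mat(1)[of i "L2 x" j] L2_dims[OF assms] that T by simp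
  fix i j assume "i < dim_row (\<Lambda> x)" "j < dim_col (\<Lambda> x)"
  then have ij: "i < U" "j < U" using \<Lambda>_carrier[OF assms] by auto
  show "(\<Lambda> x)\<^sup>T $$ (i, j) = \<Lambda> x $$ (i, j)"
    using \<Lambda>_carrier[OF assms] ij
    by (cases rule: block_ij[OF ij]) (auto simp: \<Lambda>_index[OF assms] sym sym2)
qed (use \<Lambda>_carrier[OF assms] in auto)

text \<open>The weights are nonnegative at the nodes, so their square roots can be distributed over
  both factors of a rank-one block; the zeros pad the vector to the full order.\<close>

definition vec1 :: "nat \<Rightarrow> real vec" where
  "vec1 i = vec U (\<lambda>r. if r \<le> k1 then sqrt (poly (weight1 D) (z i)) * poly (p1 r) (z i) else 0)"

definition vec2 :: "nat \<Rightarrow> real vec" where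
  "vec2 i = vec U (\<lambda>r. if r > k1 then sqrt (poly (weight2 D) (z i)) * poly (p2 (r - (k1 + 1))) (z i) else 0)"

lemma vec12_carrier: "vec1 i \<in> carrier_vec U" "vec2 i \<in> carrier_vec U"
  by (simp_all add: vec1_def vec2_def)

lemma \<Lambda>_unit:
  assumes i: "i \<le> D"
  shows "\<Lambda> (unit_vec U i) = outer (vec1 i) (vec1 i) + outer (vec2 i) (vec2 i)"
proof (rule eq_matI)
  have L: "L1 (unit_vec U i) = mat (k1 + 1) (k1 + 1) (\<lambda>(a, b). poly (weight1 D) (z i) * poly (p1 a) (z i) * poly (p1 b) (z i))"
    "L2 (unit_vec U i) = mat (k2 + 1) (k2 + 1) (\<lambda>(a, b). poly (weight2 D) (z i) * poly (p2 a) (z i) * poly (p2 b) (z i))"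
    using L1 L2 unfolding moment_map_def eval_vec_node[OF i, symmetric] by blast+
  have w: "sqrt (poly (weight1 D) (z i)) * sqrt (poly (weight1 D) (z i)) = poly (weight1 D) (z i)"
    "sqrt (poly (weight2 D) (z i)) * sqrt (poly (weight2 D) (z i)) = poly (weight2 D) (z i)"
    using weight_nonneg[OF node_range[OF i], of D] by simp_all
  have w': "poly (weight1 D) (z i) * a * b = sqrt (poly (weight1 D) (z i)) * a * (sqrt (poly (weight1 D) (z i)) * b)"
    "poly (weight2 D) (z i) * a * b = sqrt (poly (weight2 D) (z i)) * a * (sqrt (poly (weight2 D) (z i)) * b)" for a b
    by (subst (1) w[symmetric], simp add: mult_ac)+
  fix r s assume "r < dim_row (outer (vec1 i) (vec1 i) + outer (vec2 i) (vec2 i))"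
    "s < dim_col (outer (vec1 i) (vec1 i) + outer (vec2 i) (vec2 i))"
  then have rs: "r < U" "s < U" by (auto simp: outer_def vec2_def)
  then have outer: "(outer (vec1 i) (vec1 i) + outer (vec2 i) (vec2 i)) $$ (r, s) =
      vec1 i $ r * vec1 i $ s + vec2 i $ r * vec2 i $ s"
    using vec12_carrier[of i] by (simp add: outer_def)
  show "\<Lambda> (unit_vec U i) $$ (r, s) = (outer (vec1 i) (vec1 i) + outer (vec2 i) (vec2 i)) $$ (r, s)"
    unfolding outer \<Lambda>_index[OF unit_vec_carrier rs] L
    by (cases rule: block_ij[OF rs]) (use rs in \<open>auto simp: vec1_def vec2_def w'\<close>)
qed (use \<Lambda>_carrier[OF unit_vec_carrier, of i] in \<open>auto simp: outer_def vec2_def\<close>)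

section \<open>Quadratic forms of the operator as elements of the cone\<close>

definition part1 :: "real vec \<Rightarrow> real poly" where
  "part1 v = (\<Sum>r\<le>k1. smult (v $ r) (p1 r))"

definition part2 :: "real vec \<Rightarrow> real poly" where
  "part2 v = (\<Sum>r\<le>k2. smult (v $ (r + (k1 + 1))) (p2 r))"

definition square_poly :: "real vec \<Rightarrow> real poly" where
  "square_poly v = weight1 D * (part1 v)\<^sup>2 + weight2 D * (part2 v)\<^sup>2"

lemma part_degree: "degree (part1 v) \<le> k1" "degree (part2 v) \<le> k2"
  unfolding part1_def part2_def
  by (rule degree_sum_le; auto intro: order_trans[OF degree_smult_le] ordered_basis_degree[OF p1] ordered_basis_degree[OF p2])+

lemma square_poly_wsos: "square_poly v \<in> wsos_polys D"
  unfolding square_poly_def wsos_polys_def using part_degree sos_square by blast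

lemma vec1_scalar_prod:
  assumes "v \<in> carrier_vec U"
  shows "vec1 i \<bullet> v = sqrt (poly (weight1 D) (z i)) * poly (part1 v) (z i)"
proof -
  have "vec1 i \<bullet> v = (\<Sum>r<U. vec1 i $ r * v $ r)" by (rule scalar_prod_sum[OF assms])
  also have "\<dots> = (\<Sum>r\<le>k1. vec1 i $ r * v $ r)"
    by (rule sum.mono_neutral_right) (use order_sum in \<open>auto simp: vec1_def\<close>)
  also have "\<dots> = (\<Sum>r\<le>k1. sqrt (poly (weight1 D) (z i)) * (v $ r * poly (p1 r) (z i)))"
    by (rule sum.cong) (use order_sum in \<open>auto simp: vec1_def\<close>)
  finally show ?thesis by (simp add: part1_def poly_sum sum_distrib_left)
qed

lemma vec2_scalar_prod:
  assumes "v \<in> carrier_vec U"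
  shows "vec2 i \<bullet> v = sqrt (poly (weight2 D) (z i)) * poly (part2 v) (z i)"
proof -
  have "vec2 i \<bullet> v = (\<Sum>r<U. vec2 i $ r * v $ r)" by (rule scalar_prod_sum[OF assms])
  also have "\<dots> = (\<Sum>r\<in>(\<lambda>r. r + (k1 + 1)) ` {..k2}. vec2 i $ r * v $ r)"
  proof (rule sum.mono_neutral_right)
    show "\<forall>r\<in>{..<U} - (\<lambda>r. r + (k1 + 1)) ` {..k2}. vec2 i $ r * v $ r = 0"
    proof
      fix r assume r: "r \<in> {..<U} - (\<lambda>r. r + (k1 + 1)) ` {..k2}"
      have "r \<le> k1"
      proof (rule ccontr)
        assume "\<not> r \<le> k1"
        then have "r = (r - (k1 + 1)) + (k1 + 1)" "r - (k1 + 1) \<le> k2" using r order_sum by auto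
        then show False using r by blast
      qed
      then show "vec2 i $ r * v $ r = 0" using r by (simp add: vec2_def)
    qed
  qed (use order_sum in auto)
  also have "\<dots> = (\<Sum>r\<le>k2. vec2 i $ (r + (k1 + 1)) * v $ (r + (k1 + 1)))"
    by (subst sum.reindex) (auto simp: inj_on_def)
  also have "\<dots> = (\<Sum>r\<le>k2. sqrt (poly (weight2 D) (z i)) * (v $ (r + (k1 + 1)) * poly (p2 r) (z i)))"
    by (rule sum.cong) (use order_sum in \<open>auto simp: vec2_def\<close>)
  finally show ?thesis by (simp add: part2_def poly_sum sum_distrib_left)
qed

text \<open>Both sides are linear in \<open>y\<close>, so unit vectors suffice. There the operator
  is a sum of two outer products, whose values at \<open>v\<close> are the two weighted squares at
  the node.\<close>

lemma \<Lambda>_quadratic_form: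
  assumes y: "y \<in> carrier_vec U" and v: "v \<in> carrier_vec U"
  shows "v \<bullet> (\<Lambda> y *\<^sub>v v) = (\<Sum>i<U. poly (square_poly v) (z i) * y $ i)"
proof -
  have "v \<bullet> (\<Lambda> y *\<^sub>v v) = (\<Sum>i<U. y $ i * (v \<bullet> (\<Lambda> (unit_vec U i) *\<^sub>v v)))"
  proof (rule linear_functional_sum[OF _ _ y])
    fix x x' :: "real vec" assume x: "x \<in> carrier_vec U" "x' \<in> carrier_vec U"
    show "v \<bullet> (\<Lambda> (x + x') *\<^sub>v v) = v \<bullet> (\<Lambda> x *\<^sub>v v) + v \<bullet> (\<Lambda> x' *\<^sub>v v)"
      unfolding \<Lambda>_add[OF x] add_mult_distrib_mat_vec[OF \<Lambda>_carrier[OF x(1)] \<Lambda>_carrier[OF x(2)] v]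
      by (rule scalar_prod_add_distrib[OF v mult_mat_vec_carrier[OF \<Lambda>_carrier[OF x(1)] v]
            mult_mat_vec_carrier[OF \<Lambda>_carrier[OF x(2)] v]])
  next
    fix x :: "real vec" and c :: real assume x: "x \<in> carrier_vec U"
    have cx: "c \<cdot>\<^sub>v x \<in> carrier_vec U" using x by simp
    show "v \<bullet> (\<Lambda> (c \<cdot>\<^sub>v x) *\<^sub>v v) = c * (v \<bullet> (\<Lambda> x *\<^sub>v v))"
      unfolding quad_form_sum[OF \<Lambda>_carrier[OF cx] v v] quad_form_sum[OF \<Lambda>_carrier[OF x] v v]
      unfolding \<Lambda>_smult[OF x] sum_distrib_left
      by (intro sum.cong refl) (use \<Lambda>_carrier[OF x] in auto)
  qed
  also have "v \<bullet> (\<Lambda> (unit_vec U i) *\<^sub>v v) = poly (square_poly v) (z i)" if i: "i < U" for i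
  proof -
    have i': "i \<le> D" using i by simp
    have sq: "v \<bullet> (outer a a *\<^sub>v v) = (a \<bullet> v)\<^sup>2" if "a \<in> carrier_vec U" for a
      using that v comm_scalar_prod[OF v that] by (simp add: outer_mult_vec[of _ U] power2_eq_square)
    note a = vec12_carrier(1)[of i] and b = vec12_carrier(2)[of i]
    have "v \<bullet> (\<Lambda> (unit_vec U i) *\<^sub>v v) = v \<bullet> (outer (vec1 i) (vec1 i) *\<^sub>v v) + v \<bullet> (outer (vec2 i) (vec2 i) *\<^sub>v v)"
      unfolding \<Lambda>_unit[OF i'] add_mult_distrib_mat_vec[OF outer_carrier[OF a a] outer_carrier[OF b b] v]
      by (rule scalar_prod_add_distrib[OF v mult_mat_vec_carrier[OF outer_carrier[OF a a] v]
            mult_mat_vec_carrier[OF outer_carrier[OF b b] v]])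
    also have "\<dots> = poly (square_poly v) (z i)"
      unfolding sq[OF a] sq[OF b] vec1_scalar_prod[OF v] vec2_scalar_prod[OF v] power_mult_distrib
      using weight_nonneg[OF node_range[OF i'], of D] by (simp add: square_poly_def)
    finally show ?thesis .
  qed
  then have "(\<Sum>i<U. y $ i * (v \<bullet> (\<Lambda> (unit_vec U i) *\<^sub>v v))) = (\<Sum>i<U. poly (square_poly v) (z i) * y $ i)"
    by (intro sum.cong refl) (simp add: mult.commute)
  finally show ?thesis .
qed

lemma square_poly_exists:
  assumes g: "degree g \<le> k1" and h: "degree h \<le> k2"
  obtains v where "v \<in> carrier_vec U" "square_poly v = weight1 D * g\<^sup>2 + weight2 D * h\<^sup>2"
proof -
  obtain c where c: "g = (\<Sum>r\<le>k1. smult (c r) (p1 r))" using ordered_basis_expand[OF p1 g] .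
  obtain e where e: "h = (\<Sum>r\<le>k2. smult (e r) (p2 r))" using ordered_basis_expand[OF p2 h] .
  define v where "v = vec U (\<lambda>r. if r \<le> k1 then c r else e (r - (k1 + 1)))"
  have "part1 v = g" unfolding part1_def c by (rule sum.cong) (use order_sum in \<open>auto simp: v_def\<close>)
  moreover have "part2 v = h" unfolding part2_def e by (rule sum.cong) (use order_sum in \<open>auto simp: v_def\<close>)
  ultimately show ?thesis using that[of v] by (simp add: square_poly_def v_def)
qed

text \<open>Each \<open>square_poly v\<close> belongs to the cone, which is one direction.
  Conversely a single weighted square is a \<open>square_poly\<close> with the other part zero, and
  such squares generate the cone additively.\<close>

lemma dual_iff_\<Lambda>:
  assumes y: "y \<in> carrier_vec U"
  shows "y \<in> dual_cone U (wsos_cone D q) \<longleftrightarrow> (\<forall>v\<in>carrier_vec U. v \<bullet> (\<Lambda> y *\<^sub>v v) \<ge> 0)"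
proof
  assume "y \<in> dual_cone U (wsos_cone D q)"
  then show "\<forall>v\<in>carrier_vec U. v \<bullet> (\<Lambda> y *\<^sub>v v) \<ge> 0"
    using dual_iff_nodes[OF D y] square_poly_wsos \<Lambda>_quadratic_form[OF y] by simp
next
  assume psd: "\<forall>v\<in>carrier_vec U. v \<bullet> (\<Lambda> y *\<^sub>v v) \<ge> 0"
  define \<phi> where "\<phi> P = (\<Sum>i<U. poly P (z i) * y $ i)" for P
  have \<phi>_add: "\<phi> (P + R) = \<phi> P + \<phi> R" for P R
    unfolding \<phi>_def by (simp add: sum.distrib distrib_right)
  have sq: "\<phi> (weight1 D * g\<^sup>2 + weight2 D * h\<^sup>2) \<ge> 0" if deg: "degree g \<le> k1" "degree h \<le> k2" for g h
  proof -
    obtain v where v: "v \<in> carrier_vec U" "square_poly v = weight1 D * g\<^sup>2 + weight2 D * h\<^sup>2"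
      using square_poly_exists[OF deg] .
    have "v \<bullet> (\<Lambda> y *\<^sub>v v) \<ge> 0" using psd v(1) by blast
    then show ?thesis unfolding \<Lambda>_quadratic_form[OF y v(1)] \<phi>_def v(2)[symmetric] .
  qed
  have 0: "\<phi> 0 = 0" by (simp add: \<phi>_def)
  have 1: "\<phi> (weight1 D * \<sigma>) \<ge> 0" if "\<sigma> \<in> sos_polys k1" for \<sigma>
    using that
  proof (induction rule: sos_induct)
    case (add_square a g)
    then show ?case using sq[of g 0] by (simp add: distrib_left \<phi>_add)
  qed (simp add: 0)
  have 2: "\<phi> (weight2 D * \<sigma>) \<ge> 0" if "\<sigma> \<in> sos_polys k2" for \<sigma>
    using that
  proof (induction rule: sos_induct)
    case (add_square a g)
    then show ?case using sq[of 0 g] by (simp add: distrib_left \<phi>_add)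
  qed (simp add: 0)
  have "\<forall>P\<in>wsos_polys D. \<phi> P \<ge> 0"
    using 1 2 by (auto simp: wsos_polys_def \<phi>_add)
  then show "y \<in> dual_cone U (wsos_cone D q)" unfolding dual_iff_nodes[OF D y] \<phi>_def .
qed

text \<open>A zero image puts both \<open>x\<close> and its negative into the dual cone. The
  coordinate bound for the two signs forces every coordinate to vanish, so here too Markov-Lukacs is
  at work.\<close>

lemma \<Lambda>_inj:
  assumes x: "x \<in> carrier_vec U" and 0: "\<Lambda> x = 0\<^sub>m U U" shows "x = 0\<^sub>v U"
proof (rule eq_vecI)
  have dual: "c \<cdot>\<^sub>v x \<in> dual_cone U (wsos_cone D q)" for c
  proof -
    have "c \<cdot>\<^sub>v x \<in> carrier_vec U" using x by simp
    moreover have "\<Lambda> (c \<cdot>\<^sub>v x) = 0\<^sub>m U U" using \<Lambda>_smult[OF x, of c] 0 by simp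
    moreover have "v \<bullet> (0\<^sub>m U U *\<^sub>v v) = 0" if "v \<in> carrier_vec U" for v :: "real vec"
      using that by (subst quad_form_sum[of _ U]) auto
    ultimately show ?thesis using dual_iff_\<Lambda> by simp
  qed
  fix i assume "i < dim_vec (0\<^sub>v U)"
  then have i: "i < U" "i \<le> D" by auto
  have "\<bar>(c \<cdot>\<^sub>v x) $ i\<bar> \<le> basis_max_abs D q * (\<Sum>j<U. (c \<cdot>\<^sub>v x) $ j)" for c
    by (rule dual_coordinate_bound[OF D dual i(2)])
  moreover have "(\<Sum>j<U. (c \<cdot>\<^sub>v x) $ j) = c * (\<Sum>j<U. x $ j)" for c
    unfolding sum_distrib_left by (rule sum.cong) (use x in auto)
  ultimately have "\<bar>c * x $ i\<bar> \<le> basis_max_abs D q * (c * (\<Sum>j<U. x $ j))" for c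
    using x i by simp
  from this[of 1] this[of "-1"] show "x $ i = 0\<^sub>v U $ i" using i by simp
qed (use x in simp)

text \<open>The vector of ones is the sum of all node evaluations. If its form vanishes at
  \<open>v\<close>, then \<open>square_poly v\<close> has \<open>D + 1\<close> zeros and is the zero
  polynomial; both parts then vanish, and independence of the two bases gives
  \<open>v = 0\<close>.\<close>

lemma \<Lambda>_pos: "pos_def U (\<Lambda> (vec U (\<lambda>_. 1)))"
  unfolding pos_def_def
proof (intro conjI ballI impI)
  have y: "vec U (\<lambda>_. 1) \<in> carrier_vec U" by simp
  show "\<Lambda> (vec U (\<lambda>_. 1)) \<in> carrier_mat U U" "(\<Lambda> (vec U (\<lambda>_. 1)))\<^sup>T = \<Lambda> (vec U (\<lambda>_. 1))"
    using \<Lambda>_carrier[OF y] \<Lambda>_sym[OF y] by auto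
  fix v :: "real vec" assume v: "v \<in> carrier_vec U" "v \<noteq> 0\<^sub>v U"
  have form: "v \<bullet> (\<Lambda> (vec U (\<lambda>_. 1)) *\<^sub>v v) = (\<Sum>i<U. poly (square_poly v) (z i))"
    unfolding \<Lambda>_quadratic_form[OF y v(1)] by (rule sum.cong) auto
  have nn: "poly (square_poly v) (z i) \<ge> 0" if "i < U" for i
    using wsos_nonneg[OF square_poly_wsos node_range] that by simp
  show "v \<bullet> (\<Lambda> (vec U (\<lambda>_. 1)) *\<^sub>v v) > 0"
  proof (rule ccontr)
    assume "\<not> ?thesis"
    then have "(\<Sum>i<U. poly (square_poly v) (z i)) = 0"
      unfolding form using nn by (intro antisym sum_nonneg) auto
    then have "\<forall>i\<in>{..<U}. poly (square_poly v) (z i) = 0"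
      using nn by (subst (asm) sum_nonneg_eq_0_iff) auto
    then have "square_poly v = 0"
      by (intro poly_eq_of_nodes wsos_degree[OF square_poly_wsos D]) auto
    \<comment> \<open>The weights can vanish at the endpoints, so the two squares are separated on
      the open interval, which is still infinite.\<close>
    then have zero: "poly (part1 v) x = 0 \<and> poly (part2 v) x = 0" if x: "x \<in> {-1<..<1}" for x
    proof -
      have "poly (square_poly v) x = 0" using \<open>square_poly v = 0\<close> by simp
      then have "poly (weight1 D) x * (poly (part1 v) x)\<^sup>2 + poly (weight2 D) x * (poly (part2 v) x)\<^sup>2 = 0"
        by (simp add: square_poly_def)
      moreover have "poly (weight1 D) x * (poly (part1 v) x)\<^sup>2 \<ge> 0" "poly (weight2 D) x * (poly (part2 v) x)\<^sup>2 \<ge> 0"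
        using weight_pos[OF x, of D] by simp_all
      ultimately have "poly (weight1 D) x * (poly (part1 v) x)\<^sup>2 = 0" "poly (weight2 D) x * (poly (part2 v) x)\<^sup>2 = 0"
        by linarith+
      then show ?thesis using weight_pos[OF x, of D] by simp
    qed
    have null: "P = 0" if "\<And>x. x \<in> {-1<..<1} \<Longrightarrow> poly P x = 0" for P :: "real poly"
    proof (rule ccontr)
      assume "P \<noteq> 0"
      then have "finite {x. poly P x = 0}" by (rule poly_roots_finite)
      then have "finite {-1<..<1::real}" using that by (rule_tac finite_subset) auto
      then show False by (simp add: infinite_Ioo)
    qed
    have "part1 v = 0" "part2 v = 0" using null zero by blast+
    then have c: "v $ r = 0" if "r \<le> k1" for r
      using ordered_basis_independent[OF p1, of "\<lambda>r. v $ r" r] that by (simp add: part1_def)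
    have e: "v $ (r + (k1 + 1)) = 0" if "r \<le> k2" for r
      using ordered_basis_independent[OF p2, of "\<lambda>r. v $ (r + (k1 + 1))" r] that \<open>part2 v = 0\<close>
      by (simp add: part2_def)
    have "v $ r = 0" if "r < U" for r
    proof (cases "r \<le> k1")
      case False
      then have "r - (k1 + 1) \<le> k2" "r - (k1 + 1) + (k1 + 1) = r" using that order_sum by auto
      then show ?thesis using e[of "r - (k1 + 1)"] by simp
    qed (rule c)
    then have "v = 0\<^sub>v U" using v(1) by (intro eq_vecI) auto
    then show False using v by simp
  qed
qed

sublocale moment_operator U "wsos_cone D q" \<Lambda>
proof
  show "\<exists>a\<in>carrier_vec U. \<exists>b\<in>carrier_vec U. \<Lambda> (unit_vec U i) = outer a a + outer b b" if "i < U" for i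
    using \<Lambda>_unit[of i] that vec12_carrier[of i] by fastforce
  show "\<exists>y\<in>carrier_vec U. pos_def U (\<Lambda> y)" using \<Lambda>_pos by (intro bexI[of _ "vec U (\<lambda>_. 1)"]) auto
qed (use \<Lambda>_carrier \<Lambda>_sym \<Lambda>_add \<Lambda>_smult \<Lambda>_inj dual_iff_\<Lambda> in auto)

lemma hessian_barrier:
  assumes "x \<in> carrier_vec U" "pos_def U (\<Lambda> x)"
  shows "hessian U (barrier L1 L2) x = hess x"
proof -
  have "barrier L1 L2 = (\<lambda>x. - ln (det (\<Lambda> x)))" by (intro ext) (simp add: barrier_def \<Lambda>_def)
  then show ?thesis
    using hessian_log_det[of U \<Lambda> x] \<Lambda>_carrier \<Lambda>_add \<Lambda>_smult assms pos_def_det[OF assms(2)]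
    by (simp add: hess_def)
qed

end

section \<open>The three bounds\<close>

lemma norm_inf_le_iff:
  assumes "v \<in> carrier_vec n" "n > 0"
  shows "norm_inf v \<le> B \<longleftrightarrow> (\<forall>i<n. \<bar>v $ i\<bar> \<le> B)"
proof -
  have "(\<lambda>i. \<bar>v $ i\<bar>) ` {..<n} \<noteq> {}" using assms(2) by blast
  then show ?thesis using assms(1) by (auto simp: norm_inf_def)
qed

lemma coordinate_le_norm_inf: "v \<in> carrier_vec n \<Longrightarrow> i < n \<Longrightarrow> \<bar>v $ i\<bar> \<le> norm_inf v"
  by (auto simp: norm_inf_def)

lemma norm_inf_attained:
  assumes "v \<in> carrier_vec n" "n > 0"
  obtains i where "i < n" "norm_inf v = \<bar>v $ i\<bar>"
proof -
  have "(\<lambda>i. \<bar>v $ i\<bar>) ` {..<n} \<noteq> {}" using assms(2) by blast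
  then have "Max ((\<lambda>i. \<bar>v $ i\<bar>) ` {..<n}) \<in> (\<lambda>i. \<bar>v $ i\<bar>) ` {..<n}" by (intro Max_in) auto
  then have "norm_inf v \<in> (\<lambda>i. \<bar>v $ i\<bar>) ` {..<n}"
    using assms(1) by (simp add: norm_inf_def)
  then show ?thesis using that by auto
qed

lemma norm_inf_eq_1_iff:
  assumes "v \<in> carrier_vec n" "n > 0"
  shows "norm_inf v = 1 \<longleftrightarrow> (\<forall>i<n. \<bar>v $ i\<bar> \<le> 1) \<and> (\<exists>i<n. \<bar>v $ i\<bar> = 1)"
proof
  assume 1: "norm_inf v = 1"
  then show "(\<forall>i<n. \<bar>v $ i\<bar> \<le> 1) \<and> (\<exists>i<n. \<bar>v $ i\<bar> = 1)"
    using norm_inf_attained[OF assms] coordinate_le_norm_inf[OF assms(1)] by metis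
next
  assume *: "(\<forall>i<n. \<bar>v $ i\<bar> \<le> 1) \<and> (\<exists>i<n. \<bar>v $ i\<bar> = 1)"
  then have "norm_inf v \<le> 1" using norm_inf_le_iff[OF assms] by blast
  moreover have "norm_inf v \<ge> 1" using * coordinate_le_norm_inf[OF assms(1)] by metis
  ultimately show "norm_inf v = 1" by simp
qed

lemma closed_norm_inf_1_vec:
  assumes "n > 0" shows "closed {f. norm_inf (vec n f) = 1}"
proof -
  have c: "continuous_on UNIV (\<lambda>f. \<bar>f i\<bar> :: real)" for i :: nat
    by (intro continuous_on_rabs continuous_on_product_coordinates)
  have "{f. norm_inf (vec n f) = 1} = (\<Inter>i\<in>{..<n}. {f. \<bar>f i\<bar> \<le> 1}) \<inter> (\<Union>i\<in>{..<n}. {f. \<bar>f i\<bar> = 1})"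
    using assms by (auto simp: norm_inf_eq_1_iff[of _ n])
  also have "closed \<dots>"
    by (intro closed_Int closed_INT closed_UN ballI closed_Collect_le closed_Collect_eq c
        continuous_on_const finite_lessThan)
  finally show ?thesis .
qed

lemma norm2_unit_vec: "i < n \<Longrightarrow> norm2 (unit_vec n i) = 1"
  by (simp add: norm2_def L2_set_def unit_vec_def if_distrib[of "\<lambda>x. x\<^sup>2"] cong: if_cong)

lemma cond_num_one:
  assumes "n > 0" shows "cond_num (1\<^sub>m n) = 1"
proof -
  have op: "op_norm2 (1\<^sub>m n) = 1"
  proof -
    have "(\<lambda>v. norm2 (1\<^sub>m n *\<^sub>v v)) ` {v \<in> carrier_vec n. norm2 v = 1} = {1}"
      using norm2_unit_vec[OF assms] unit_vec_carrier[of n 0] by force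
    then show ?thesis by (simp add: op_norm2_def)
  qed
  have "1\<^sub>m n \<in> Units (ring_mat TYPE(real) n ())"
    by (rule det_non_zero_imp_unit[of _ n]) auto
  \<comment> \<open>Invertibility rules out \<open>None\<close>, on which \<open>the\<close> is
    unspecified.\<close>
  then obtain B :: "real mat" where B: "mat_inverse (1\<^sub>m n) = Some B"
    using mat_inverse(1)[OF one_carrier_mat, where b = "()"] by (cases "mat_inverse (1\<^sub>m n :: real mat)") auto
  then have "1\<^sub>m n * B = 1\<^sub>m n" "B \<in> carrier_mat n n"
    using mat_inverse(2)[OF one_carrier_mat] by auto
  then have "B = 1\<^sub>m n" by simp
  then show ?thesis using op B by (simp add: cond_num_def)
qed

context lagrange_nodes
begin

text \<open>Pairing with \<open>y\<close> is continuous, so nonnegativity extends from the cone to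
  its closure. This is how the frontier hypothesis on \<open>t - \<epsilon> 1\<close>
  enters.\<close>

lemma closure_scalar_prod_nonneg:
  assumes s: "s \<in> euclid_top (D + 1) closure_of wsos_cone D q"
    and y: "y \<in> dual_cone (D + 1) (wsos_cone D q)"
  shows "s \<in> carrier_vec (D + 1)" "s \<bullet> y \<ge> 0"
proof -
  interpret Metric_space "carrier_vec (D + 1)" "euclid_dist (D + 1)" by (rule Metric_space_euclid)
  have near: "\<exists>x\<in>wsos_cone D q. euclid_dist (D + 1) s x < r" if "r > 0" for r
    using s that unfolding euclid_top_def metric_closure_of by auto
  show sc: "s \<in> carrier_vec (D + 1)" using s unfolding euclid_top_def metric_closure_of by auto
  have yc: "y \<in> carrier_vec (D + 1)" using y by (simp add: dual_cone_def)
  show "s \<bullet> y \<ge> 0"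
  proof (rule ccontr)
    assume neg: "\<not> s \<bullet> y \<ge> 0"
    define M where "M = (\<Sum>i<D + 1. \<bar>y $ i\<bar>)"
    have M: "M \<ge> 0" by (simp add: M_def sum_nonneg)
    define r where "r = - (s \<bullet> y) / (M + 1)"
    have r: "r > 0" "r * M < - (s \<bullet> y)" using neg M by (auto simp: r_def field_simps)
    obtain x where x: "x \<in> wsos_cone D q" "euclid_dist (D + 1) s x < r" using near[OF r(1)] by blast
    have "x \<bullet> y - s \<bullet> y = (\<Sum>i<D + 1. (x $ i - s $ i) * y $ i)"
      unfolding scalar_prod_sum[OF yc] by (simp add: left_diff_distrib sum_subtractf)
    also have "\<dots> \<le> (\<Sum>i<D + 1. r * \<bar>y $ i\<bar>)"
    proof (rule sum_mono)
      fix i assume "i \<in> {..<D + 1}"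
      then have "\<bar>x $ i - s $ i\<bar> \<le> r"
        using coordinate_le_euclid_dist[of i "D + 1" s x] x(2) by (simp add: abs_minus_commute)
      then have "\<bar>x $ i - s $ i\<bar> * \<bar>y $ i\<bar> \<le> r * \<bar>y $ i\<bar>" by (rule mult_right_mono) simp
      then show "(x $ i - s $ i) * y $ i \<le> r * \<bar>y $ i\<bar>" by (metis abs_ge_self abs_mult order_trans)
    qed
    also have "\<dots> = r * M" by (simp add: M_def sum_distrib_left)
    finally have "x \<bullet> y < 0" using r by simp
    then show False using y x(1) by (auto simp: dual_cone_def not_less[symmetric])
  qed
qed

text \<open>Moving \<open>t\<close> by \<open>r\<close> along one axis, against the sign of
  \<open>y $ i\<close>, stays in the cone, and pairing the result with \<open>y\<close> gives the
  bound. It is what makes the slices of the dual cone bounded.\<close>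

lemma interior_lower_bound:
  assumes t: "t \<in> euclid_top (D + 1) interior_of wsos_cone D q"
  shows "\<exists>r>0. \<forall>y\<in>dual_cone (D + 1) (wsos_cone D q). \<forall>i<D + 1. r * \<bar>y $ i\<bar> \<le> t \<bullet> y"
proof -
  have tc: "t \<in> carrier_vec (D + 1)" using t unfolding euclid_interior_iff by blast
  obtain r where r: "r > 0"
      "\<forall>x\<in>carrier_vec (D + 1). (\<forall>i<D + 1. \<bar>t $ i - x $ i\<bar> \<le> r) \<longrightarrow> x \<in> wsos_cone D q"
    using euclid_interior_box[OF t] by blast
  have "r * \<bar>y $ i\<bar> \<le> t \<bullet> y" if y: "y \<in> dual_cone (D + 1) (wsos_cone D q)" and i: "i < D + 1" for y i
  proof -
    have yc: "y \<in> carrier_vec (D + 1)" using y by (simp add: dual_cone_def)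
    define x where "x = t - (r * sgn (y $ i)) \<cdot>\<^sub>v unit_vec (D + 1) i"
    have "x \<in> wsos_cone D q"
    proof (rule r(2)[rule_format])
      show "x \<in> carrier_vec (D + 1)" using tc by (simp add: x_def)
      show "\<bar>t $ j - x $ j\<bar> \<le> r" if "j < D + 1" for j
        using that tc r(1) by (auto simp: x_def unit_vec_def abs_mult sgn_real_def)
    qed
    then have "x \<bullet> y \<ge> 0" using y by (simp add: dual_cone_def)
    moreover have "x \<bullet> y = t \<bullet> y - (r * sgn (y $ i)) * y $ i"
      unfolding x_def using tc yc i by (simp add: minus_scalar_prod_distrib[of _ "D + 1"])
    ultimately show ?thesis by (simp add: sgn_real_def abs_if split: if_splits)
  qed
  then show ?thesis using r(1) by blast
qed

lemma dual_minimum: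
  assumes D: "D \<ge> 2"
  shows "\<exists>k. (\<exists>v\<in>dual_cone (D + 1) (wsos_cone D q). norm_inf v = 1 \<and> coeff_vec D q 1 \<bullet> v = k) \<and>
    (\<forall>v\<in>dual_cone (D + 1) (wsos_cone D q). norm_inf v = 1 \<longrightarrow> k \<le> coeff_vec D q 1 \<bullet> v) \<and>
    k \<ge> 1 / basis_max_abs D q"
proof -
  define C where "C = {v \<in> dual_cone (D + 1) (wsos_cone D q). norm_inf v = 1}"
  have "\<exists>v\<in>C. \<forall>v'\<in>C. - (coeff_vec D q 1 \<bullet> v') \<le> - (coeff_vec D q 1 \<bullet> v)"
  proof (rule vec_attains_sup)
    have "norm_inf (unit_vec (D + 1) 0) = 1"
      by (subst norm_inf_eq_1_iff[of _ "D + 1"]) (auto simp: unit_vec_def intro!: exI[of _ 0])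
    then have "unit_vec (D + 1) 0 \<in> C" using unit_vec_in_dual[OF D, of 0] by (simp add: C_def)
    then show "C \<noteq> {}" by blast
    show "C \<subseteq> carrier_vec (D + 1)" by (auto simp: C_def dual_cone_def)
    show "\<bar>v $ i\<bar> \<le> 1" if "v \<in> C" "i < D + 1" for v i
      using that coordinate_le_norm_inf[of v "D + 1" i] by (auto simp: C_def dual_cone_def)
    have "{f. vec (D + 1) f \<in> C} = {f. vec (D + 1) f \<in> dual_cone (D + 1) (wsos_cone D q)} \<inter>
        {f. norm_inf (vec (D + 1) f) = 1}" by (auto simp: C_def)
    moreover have "closed \<dots>" by (intro closed_Int closed_dual_cone_vec closed_norm_inf_1_vec) simp
    ultimately show "closed {f. vec (D + 1) f \<in> C}" by simp
    show "continuous_on UNIV (\<lambda>f. - (coeff_vec D q 1 \<bullet> vec (D + 1) f))"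
      by (intro continuous_on_minus continuous_on_scalar_prod_vec)
  qed
  then obtain v where v: "v \<in> C" "\<And>v'. v' \<in> C \<Longrightarrow> coeff_vec D q 1 \<bullet> v \<le> coeff_vec D q 1 \<bullet> v'" by auto
  have vd: "v \<in> dual_cone (D + 1) (wsos_cone D q)" "norm_inf v = 1" "v \<in> carrier_vec (D + 1)"
    using v(1) by (auto simp: C_def dual_cone_def)
  obtain i where i: "i < D + 1" "\<bar>v $ i\<bar> = 1" using norm_inf_eq_1_iff[OF vd(3)] vd(2) by auto
  have "1 \<le> basis_max_abs D q * (coeff_vec D q 1 \<bullet> v)"
    using dual_coordinate_bound[OF D vd(1), of i] i by (simp add: one_scalar_prod[OF vd(3)])
  then have "1 / basis_max_abs D q \<le> coeff_vec D q 1 \<bullet> v"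
    using basis_max_abs_ge_1 by (simp add: field_simps)
  then show ?thesis using v(2) vd by (intro exI[of _ "coeff_vec D q 1 \<bullet> v"]) (auto simp: C_def)
qed

text \<open>At a node \<open>eval_vec\<close> is a unit vector, and the rank-one matrices of all
  unit vectors add up to the identity.\<close>

lemma identity_quadrature:
  "\<exists>(s :: nat) (x :: nat \<Rightarrow> real) (\<alpha> :: nat \<Rightarrow> real) M.
     x ` {..<s} \<subseteq> {-1..1} \<and> inj_on x {..<s} \<and>
     unisolvent (x ` {..<s}) (polys_le D) \<and> (\<forall>i<s. \<alpha> i > 0) \<and>
     M = mat (D + 1) (D + 1) (\<lambda>(j, k). \<Sum>i<s. \<alpha> i * (eval_vec (D + 1) q (x i) $ j * eval_vec (D + 1) q (x i) $ k)) \<and>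
     M = 1\<^sub>m (D + 1) \<and> cond_num M = 1"
proof (intro exI conjI)
  have eq: "{..<D + 1} = {..D}" by auto
  show "z ` {..<D + 1} \<subseteq> {-1..1}" "inj_on z {..<D + 1}" using inj nodes unfolding eq by auto
  show "unisolvent (z ` {..<D + 1}) (polys_le D)"
    unfolding unisolvent_def eq by (auto intro: poly_eq_of_nodes)
  show "\<forall>i<D + 1. (\<lambda>_. 1 :: real) i > 0" by simp
  show "1\<^sub>m (D + 1) = mat (D + 1) (D + 1) (\<lambda>(j, k). \<Sum>i<D + 1. (\<lambda>_. 1) i *
      (eval_vec (D + 1) q (z i) $ j * eval_vec (D + 1) q (z i) $ k))"
  proof (rule eq_matI)
    fix j k assume "j < dim_row (mat (D + 1) (D + 1) (\<lambda>(j, k). \<Sum>i<D + 1. (\<lambda>_. 1 :: real) i *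
      (eval_vec (D + 1) q (z i) $ j * eval_vec (D + 1) q (z i) $ k)))"
      "k < dim_col (mat (D + 1) (D + 1) (\<lambda>(j, k). \<Sum>i<D + 1. (\<lambda>_. 1 :: real) i *
      (eval_vec (D + 1) q (z i) $ j * eval_vec (D + 1) q (z i) $ k)))"
    then have jk: "j < D + 1" "k < D + 1" by auto
    have "(\<Sum>i<D + 1. eval_vec (D + 1) q (z i) $ j * eval_vec (D + 1) q (z i) $ k) =
        (\<Sum>i<D + 1. if i = j then (if j = k then 1 else 0) else 0)"
      by (rule sum.cong) (use jk in \<open>auto simp: eval_vec_node unit_vec_def\<close>)
    then show "1\<^sub>m (D + 1) $$ (j, k) = mat (D + 1) (D + 1) (\<lambda>(j, k). \<Sum>i<D + 1. (\<lambda>_. 1) i *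
      (eval_vec (D + 1) q (z i) $ j * eval_vec (D + 1) q (z i) $ k)) $$ (j, k)"
      using jk by simp
  qed auto
  show "cond_num (1\<^sub>m (D + 1)) = 1" by (rule cond_num_one) simp
qed simp

end

text \<open>The norm and \<open>\<epsilon>\<close> enter only through the ratio
  \<open>X \<ge> 1\<close>, so every logarithm involved is nonnegative. For \<open>d \<ge> 1\<close>
  the root is at most \<open>2 d\<close> and \<open>2 d + 2\<close> at most \<open>4 d\<close>,
  which gives the factor \<open>3/2 * 2 * 4 = 12\<close>; the summand \<open>1/2\<close> is absorbed
  by raising it to 13.\<close>

lemma log_bound:
  fixes d :: nat
  assumes d: "d \<ge> 1" and \<mu>: "\<mu> \<ge> 1" and \<epsilon>: "\<epsilon> > 0" and nt: "\<epsilon> \<le> nt"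
    and B: "0 \<le> B" "B \<le> 1 / 2 + 3 / 2 * sqrt (2 * real d + 2) * nt * ((2 * real d + 2) * \<mu> / \<epsilon>)"
  shows "ln B \<le> 13 * (1 + ln (real d) + ln nt + ln \<mu> + ln (1 / \<epsilon>))"
proof -
  define X where "X = nt / \<epsilon>"
  have X: "X \<ge> 1" "ln X = ln nt + ln (1 / \<epsilon>)"
    using \<epsilon> nt by (auto simp: X_def ln_div)
  have pos: "ln (real d) \<ge> 0" "ln X \<ge> 0" "ln \<mu> \<ge> 0" using d X(1) \<mu> by simp_all
  show ?thesis
  proof (cases "B = 0")
    \<comment> \<open>Here \<open>ln 0 = 0\<close>, and the right-hand side is positive.\<close>
    case True
    have "0 \<le> 1 + ln (real d) + ln \<mu> + ln X" using pos by linarith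
    then show ?thesis using X True by simp
  next
    case False
    have s: "sqrt (2 * real d + 2) \<le> 2 * real d"
    proof (rule real_le_lsqrt)
      have "real d * 1 \<le> real d * real d" using d by (intro mult_left_mono) auto
      then have "2 * real d + 2 \<le> 4 * (real d * real d)" using d by linarith
      then show "2 * real d + 2 \<le> (2 * real d)\<^sup>2" by (simp add: power2_eq_square)
    qed (use d in auto)
    have "3 / 2 * sqrt (2 * real d + 2) * nt * ((2 * real d + 2) * \<mu> / \<epsilon>) =
        3 / 2 * (sqrt (2 * real d + 2) * (2 * real d + 2)) * (\<mu> * X)"
      by (simp add: X_def)
    also have "\<dots> \<le> 3 / 2 * ((2 * real d) * (4 * real d)) * (\<mu> * X)"
      using s d \<mu> X by (intro mult_right_mono mult_left_mono mult_mono) auto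
    finally have "B \<le> 1 / 2 + 12 * (real d * real d * (\<mu> * X))" using B by (simp add: algebra_simps)
    moreover have "1 \<le> real d * real d * (\<mu> * X)"
      using d \<mu> X by (intro mult_ge1_I) auto
    ultimately have "B \<le> 13 * (real d * real d * (\<mu> * X))" by linarith
    then have "ln B \<le> ln (13 * (real d * real d * (\<mu> * X)))"
      using False B by (subst ln_le_cancel_iff) auto
    also have "\<dots> = ln 13 + (ln (real d) + ln (real d) + (ln \<mu> + ln X))"
      using d \<mu> X(1) by (simp add: ln_mult_pos)
    also have "\<dots> \<le> 13 * (1 + ln (real d) + ln \<mu> + ln X)"
      using pos ln_le_minus_one[of "13::real"] by simp
    finally show ?thesis using X by (simp add: algebra_simps)
  qed
qed

context wsos_moment
begin

lemma integer_certificate: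
  assumes d: "d \<ge> 1" "D \<in> {2 * d, 2 * d + 1}" and \<epsilon>: "\<epsilon> > 0"
    and t: "t \<in> euclid_top U interior_of wsos_cone D q"
    and fr: "t - \<epsilon> \<cdot>\<^sub>v coeff_vec D q 1 \<in> euclid_top U frontier_of wsos_cone D q"
  shows "\<exists>y. y \<in> euclid_top U interior_of dual_cone U (wsos_cone D q) \<and> dual_certificate D q L1 L2 t y \<and>
     (\<forall>i<U. y $ i \<in> \<int>) \<and>
     norm_inf y \<le> 1 / 2 +
       of_int \<lceil>3 / 2 * sqrt (2 * real d + 2) * norm2 t\<rceil> * ((2 * real d + 2) * basis_max_abs D q / \<epsilon>) \<and>
     ln (norm_inf y) \<le>
       13 * (1 + ln (real d) + ln (norm2 t) + ln (basis_max_abs D q) + ln (1 / \<epsilon>))"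
proof -
  let ?K = "dual_cone U (wsos_cone D q)" and ?\<mu> = "basis_max_abs D q"
  have tS: "t \<in> wsos_cone D q" using interior_of_subset t by (rule subsetD)
  have tc: "t \<in> carrier_vec U" using wsos_cone_carrier tS by (rule subsetD)
  have "t - \<epsilon> \<cdot>\<^sub>v coeff_vec D q 1 \<in> euclid_top U closure_of wsos_cone D q"
    using fr by (simp add: frontier_of_def)
  note cl = closure_scalar_prod_nonneg(2)[OF this]
  have t\<epsilon>: "\<epsilon> * (\<Sum>i<U. y $ i) \<le> t \<bullet> y" if y: "y \<in> ?K" for y
  proof -
    have yc: "y \<in> carrier_vec U" using y by (simp add: dual_cone_def)
    have 1: "coeff_vec D q 1 \<in> carrier_vec U" by (simp add: coeff_vec_one)
    have "(t - \<epsilon> \<cdot>\<^sub>v coeff_vec D q 1) \<bullet> y = t \<bullet> y - \<epsilon> * (coeff_vec D q 1 \<bullet> y)"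
      using tc yc 1 by (simp add: minus_scalar_prod_distrib[of _ U])
    then show ?thesis using cl[OF y] one_scalar_prod[OF yc] by simp
  qed
  \<comment> \<open>Evaluation at a node is a dual vector with coordinate sum one, so each
    coordinate of \<open>t\<close> is at least \<open>\<epsilon>\<close>. This also yields
    \<open>\<epsilon> \<le> norm2 t\<close>.\<close>
  have ti: "t $ i \<ge> \<epsilon>" if "i < U" for i
  proof -
    have "(\<Sum>j<U. unit_vec U i $ j) = (1::real)" using that by (simp add: unit_vec_def)
    then show ?thesis using t\<epsilon>[OF unit_vec_in_dual[OF D, of i]] that tc by simp
  qed
  have dimt: "dim_vec t = U" using tc by simp
  have nt: "\<epsilon> \<le> norm2 t"
  proof -
    have "\<epsilon> \<le> t $ 0" using ti[of 0] by simp
    also have "\<dots> \<le> norm2 t"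
      unfolding norm2_def dimt by (rule member_le_L2_set) auto
    finally show ?thesis .
  qed
  \<comment> \<open>Rounding changes each coordinate by at most \<open>1/2\<close>, which costs at
    most \<open>(\<Sum>i<U. t $ i) / (2 * N)\<close> in local norm. By Cauchy-Schwarz the sum is at
    most \<open>2/3 * N\<close>, whence the error \<open>1/3\<close>.\<close>
  define N where "N = 3 / 2 * sqrt (2 * real d + 2) * norm2 t"
  have N: "N > 0" using nt \<epsilon> by (auto simp: N_def add_nonneg_pos intro!: mult_pos_pos)
  define \<tau> where "\<tau> = (1 / N) \<cdot>\<^sub>v t"
  have \<tau>c: "\<tau> \<in> carrier_vec U" using tc by (simp add: \<tau>_def)
  obtain r where r: "r > 0" "\<forall>y\<in>?K. \<forall>i<U. r * \<bar>y $ i\<bar> \<le> t \<bullet> y"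
    using interior_lower_bound[OF t] by blast
  have \<tau>y: "\<tau> \<bullet> y = (t \<bullet> y) / N" if "y \<in> carrier_vec U" for y
    using tc that by (simp add: \<tau>_def)
  have "\<exists>y\<in>?K. pos_def U (\<Lambda> y) \<and> (\<forall>u\<in>carrier_vec U. mtrace (minv (\<Lambda> y) * \<Lambda> u) = \<tau> \<bullet> u)"
  proof (rule gradient_certificate_exists[OF \<tau>c])
    show "r / N > 0" using r N by simp
    show "r / N * \<bar>y $ i\<bar> \<le> \<tau> \<bullet> y" if "y \<in> ?K" "i < U" for y i
      using r(2)[rule_format, OF that] \<tau>y[of y] that N by (simp add: dual_cone_def divide_right_mono)
  qed
  then obtain y where y: "y \<in> ?K" "pos_def U (\<Lambda> y)"
      and grad: "\<And>u. u \<in> carrier_vec U \<Longrightarrow> mtrace (minv (\<Lambda> y) * \<Lambda> u) = \<tau> \<bullet> u" by blast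
  have yc: "y \<in> carrier_vec U" using y by (simp add: dual_cone_def)
  have U: "real U \<le> 2 * real d + 2" using d by auto
  have ybound: "\<bar>y $ i\<bar> \<le> N * ((2 * real d + 2) * ?\<mu> / \<epsilon>)" if "i < U" for i
  proof -
    \<comment> \<open>The gradient condition at \<open>u = y\<close> compares with the trace of the
      identity of order \<open>U\<close>; the bound \<open>U \<le> 2 d + 2\<close> then serves both
      parities of \<open>D\<close>.\<close>
    have "(t \<bullet> y) / N = real U" using grad[OF yc] mtrace_minv_self[OF y(2)] \<tau>y[OF yc] by simp
    then have "t \<bullet> y = N * real U" using N by (simp add: field_simps)
    then have "\<epsilon> * (\<Sum>i<U. y $ i) \<le> N * (2 * real d + 2)"
      using t\<epsilon>[OF y(1)] U N mult_left_mono[of "real U" "2 * real d + 2" N] by linarith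
    then have "(\<Sum>i<U. y $ i) \<le> N * (2 * real d + 2) / \<epsilon>" using \<epsilon> by (simp add: field_simps)
    then have "?\<mu> * (\<Sum>i<U. y $ i) \<le> ?\<mu> * (N * (2 * real d + 2) / \<epsilon>)"
      using basis_max_abs_ge_1 by (intro mult_left_mono) auto
    moreover have "\<bar>y $ i\<bar> \<le> ?\<mu> * (\<Sum>i<U. y $ i)"
      using dual_coordinate_bound[OF D y(1), of i] that by simp
    ultimately show ?thesis by (simp add: mult_ac)
  qed
  define x where "x = vec U (\<lambda>i. of_int (round (y $ i)) :: real)"
  have xc: "x \<in> carrier_vec U" by (simp add: x_def)
  have xy: "\<bar>x $ i - y $ i\<bar> \<le> 1 / 2" if "i < U" for i
    using that of_int_round_abs_le[of "y $ i"] by (simp add: x_def)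
  have "(\<Sum>i<U. \<bar>x $ i - y $ i\<bar> * \<tau> $ i) \<le> (\<Sum>i<U. 1 / 2 * (t $ i / N))"
  proof (rule sum_mono)
    fix i assume i: "i \<in> {..<U}"
    then have "\<tau> $ i = t $ i / N" "t $ i / N \<ge> 0" using tc ti[of i] \<epsilon> N by (auto simp: \<tau>_def)
    moreover have "\<bar>x $ i - y $ i\<bar> \<le> 1 / 2" using xy i by simp
    ultimately show "\<bar>x $ i - y $ i\<bar> * \<tau> $ i \<le> 1 / 2 * (t $ i / N)"
      by (simp only: mult_right_mono)
  qed
  also have "\<dots> = (\<Sum>i<U. t $ i) / (2 * N)" by (simp add: sum_divide_distrib)
  also have "\<dots> \<le> (sqrt (2 * real d + 2) * norm2 t) / (2 * N)"
  proof (intro divide_right_mono)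
    have "(\<Sum>i<U. t $ i) \<le> (\<Sum>i<U. \<bar>1\<bar> * \<bar>t $ i\<bar>)" by (intro sum_mono) simp
    also have "\<dots> \<le> L2_set (\<lambda>_. 1) {..<U} * L2_set (($) t) {..<U}" by (rule L2_set_mult_ineq)
    also have "\<dots> = sqrt (real U) * norm2 t" by (simp add: L2_set_def norm2_def dimt)
    also have "\<dots> \<le> sqrt (2 * real d + 2) * norm2 t"
      using U nt \<epsilon> by (intro mult_right_mono real_sqrt_le_mono) auto
    finally show "(\<Sum>i<U. t $ i) \<le> sqrt (2 * real d + 2) * norm2 t" .
  qed (use N in simp)
  also have "\<dots> = 1 / 3"
  proof -
    have "sqrt (2 * real d + 2) * norm2 t = 2 / 3 * N" by (simp add: N_def)
    then show ?thesis using N by simp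
  qed
  finally have near: "(\<Sum>i<U. \<bar>x $ i - y $ i\<bar> * \<tau> $ i) < 1" by simp
  note cert = near_gradient_certificate[OF yc y(2) \<tau>c grad xc near]
  have int: "x \<in> euclid_top U interior_of ?K" by (rule pos_def_imp_interior[OF xc cert(1)])
  have dc: "dual_certificate D q L1 L2 t x"
  proof -
    let ?H = "the (mat_inverse (hess x))"
    \<comment> \<open>The certificate was built for \<open>\<tau>\<close>. The inverse Hessian is
      linear and the dual cone is closed under positive scaling, so the same point certifies
      \<open>t\<close>.\<close>
    have tN: "t = N \<cdot>\<^sub>v \<tau>" using N tc by (intro eq_vecI) (auto simp: \<tau>_def)
    have "?H *\<^sub>v t = N \<cdot>\<^sub>v (?H *\<^sub>v \<tau>)"
      unfolding tN using hess_inverse(1)[OF xc cert(1) \<tau>c] \<tau>c by (rule mult_mat_vec)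
    moreover have "N \<cdot>\<^sub>v (?H *\<^sub>v \<tau>) \<in> ?K"
      using cert(2) N wsos_cone_carrier unfolding dual_cone_def
      by (auto simp: scalar_prod_smult_distrib[of _ U] subsetD)
    ultimately have "the (mat_inverse (hessian U (barrier L1 L2) x)) *\<^sub>v t \<in> ?K"
      by (simp only: hessian_barrier[OF xc cert(1)])
    then show ?thesis unfolding dual_certificate_def using tS int by blast
  qed
  have ints: "\<forall>i<U. x $ i \<in> \<int>" by (simp add: x_def)
  have bound: "norm_inf x \<le> 1 / 2 + N * ((2 * real d + 2) * ?\<mu> / \<epsilon>)"
  proof -
    have "\<bar>x $ i\<bar> \<le> 1 / 2 + N * ((2 * real d + 2) * ?\<mu> / \<epsilon>)" if "i < U" for i
      using xy[OF that] ybound[OF that] by linarith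
    then show ?thesis using norm_inf_le_iff[OF xc] by simp
  qed
  have bound': "norm_inf x \<le> 1 / 2 + of_int \<lceil>N\<rceil> * ((2 * real d + 2) * ?\<mu> / \<epsilon>)"
  proof -
    \<comment> \<open>The ceiling enters only now, as a weakening of \<open>bound\<close>; the
      logarithmic estimate uses the sharper form.\<close>
    have "N * ((2 * real d + 2) * ?\<mu> / \<epsilon>) \<le> of_int \<lceil>N\<rceil> * ((2 * real d + 2) * ?\<mu> / \<epsilon>)"
      using basis_max_abs_ge_1 \<epsilon> by (intro mult_right_mono) auto
    then show ?thesis using bound by linarith
  qed
  have "norm_inf x \<ge> 0"
    using coordinate_le_norm_inf[OF xc, of 0] by simp
  then have log: "ln (norm_inf x) \<le> 13 * (1 + ln (real d) + ln (norm2 t) + ln ?\<mu> + ln (1 / \<epsilon>))"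
    using log_bound[OF d(1) basis_max_abs_ge_1 \<epsilon> nt] bound by (simp add: N_def)
  show ?thesis
    using int dc ints bound'[unfolded N_def] log by (intro exI[of _ x] conjI)
qed

end

theorem theorem3p8:
  shows "\<exists>C :: real. \<forall>(d :: nat) (D :: nat) (z :: nat \<Rightarrow> real) (q :: nat \<Rightarrow> real poly)
      (p1 :: nat \<Rightarrow> real poly) (p2 :: nat \<Rightarrow> real poly)
      (L1 :: real vec \<Rightarrow> real mat) (L2 :: real vec \<Rightarrow> real mat).
    d \<ge> 1 \<and> D \<in> {2 * d, 2 * d + 1} \<and>
    inj_on z {..D} \<and> z ` {..D} \<subseteq> {-1..1} \<and> lagrange_basis D z q \<and>
    ordered_basis (deg1 D) p1 \<and> ordered_basis (deg2 D) p2 \<and>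
    moment_map D q (weight1 D) (deg1 D) p1 L1 \<and>
    moment_map D q (weight2 D) (deg2 D) p2 L2
    \<longrightarrow>
    (let U = D + 1;
         S = wsos_cone D q;
         S' = dual_cone U S;
         one = coeff_vec D q 1;
         \<mu> = basis_max_abs D q
     in
       (\<exists>k1. (\<exists>v\<in>S'. norm_inf v = 1 \<and> one \<bullet> v = k1) \<and>
             (\<forall>v\<in>S'. norm_inf v = 1 \<longrightarrow> k1 \<le> one \<bullet> v) \<and>
             k1 \<ge> 1 / \<mu>) \<and>
       (\<exists>(s :: nat) (x :: nat \<Rightarrow> real) (\<alpha> :: nat \<Rightarrow> real) M.
             x ` {..<s} \<subseteq> {-1..1} \<and> inj_on x {..<s} \<and>
             unisolvent (x ` {..<s}) (polys_le D) \<and> (\<forall>i<s. \<alpha> i > 0) \<and>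
             M = mat U U (\<lambda>(j, k). \<Sum>i<s. \<alpha> i * (eval_vec U q (x i) $ j * eval_vec U q (x i) $ k)) \<and>
             M = 1\<^sub>m U \<and> cond_num M = 1) \<and>
       (\<forall>t \<epsilon>. t \<in> euclid_top U interior_of S \<and> \<epsilon> > 0 \<and>
             t - \<epsilon> \<cdot>\<^sub>v one \<in> euclid_top U frontier_of S
          \<longrightarrow>
          (\<exists>y. y \<in> euclid_top U interior_of S' \<and> dual_certificate D q L1 L2 t y \<and>
               (\<forall>i<U. y $ i \<in> \<int>) \<and>
               norm_inf y \<le> 1 / 2 +
                 of_int \<lceil>3 / 2 * sqrt (2 * real d + 2) * norm2 t\<rceil> * ((2 * real d + 2) * \<mu> / \<epsilon>) \<and>
               ln (norm_inf y) \<le>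
                 C * (1 + ln (real d) + ln (norm2 t) + ln \<mu> + ln (1 / \<epsilon>)))))"
proof (rule exI[of _ 13], intro allI impI, elim conjE, unfold Let_def, intro conjI)
  fix d D :: nat and z :: "nat \<Rightarrow> real" and q p1 p2 :: "nat \<Rightarrow> real poly" and L1 L2 :: "real vec \<Rightarrow> real mat"
  assume d: "1 \<le> d" "D \<in> {2 * d, 2 * d + 1}"
    and *: "inj_on z {..D}" "z ` {..D} \<subseteq> {-1..1}" "lagrange_basis D z q"
    "ordered_basis (deg1 D) p1" "ordered_basis (deg2 D) p2"
    "moment_map D q (weight1 D) (deg1 D) p1 L1" "moment_map D q (weight2 D) (deg2 D) p2 L2"
  \<comment> \<open>The condition \<open>D \<ge> 2\<close> of the locale follows from
    \<open>d \<ge> 1\<close>; the absolute constant 13 is the one of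
    \<open>log_bound\<close>.\<close>
  interpret wsos_moment D z q p1 p2 L1 L2
    by unfold_locales (use d * in auto)
  show "\<exists>k. (\<exists>v\<in>dual_cone (D + 1) (wsos_cone D q). norm_inf v = 1 \<and> coeff_vec D q 1 \<bullet> v = k) \<and>
    (\<forall>v\<in>dual_cone (D + 1) (wsos_cone D q). norm_inf v = 1 \<longrightarrow> k \<le> coeff_vec D q 1 \<bullet> v) \<and>
    k \<ge> 1 / basis_max_abs D q"
    by (rule dual_minimum[OF D])
  show "\<exists>(s :: nat) (x :: nat \<Rightarrow> real) (\<alpha> :: nat \<Rightarrow> real) M.
     x ` {..<s} \<subseteq> {-1..1} \<and> inj_on x {..<s} \<and>
     unisolvent (x ` {..<s}) (polys_le D) \<and> (\<forall>i<s. \<alpha> i > 0) \<and>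
     M = mat (D + 1) (D + 1) (\<lambda>(j, k). \<Sum>i<s. \<alpha> i * (eval_vec (D + 1) q (x i) $ j * eval_vec (D + 1) q (x i) $ k)) \<and>
     M = 1\<^sub>m (D + 1) \<and> cond_num M = 1"
    by (rule identity_quadrature)
  show "\<forall>t \<epsilon>. t \<in> euclid_top (D + 1) interior_of wsos_cone D q \<and> 0 < \<epsilon> \<and>
        t - \<epsilon> \<cdot>\<^sub>v coeff_vec D q 1 \<in> euclid_top (D + 1) frontier_of wsos_cone D q \<longrightarrow>
      (\<exists>y. y \<in> euclid_top (D + 1) interior_of dual_cone (D + 1) (wsos_cone D q) \<and> dual_certificate D q L1 L2 t y \<and>
         (\<forall>i<D + 1. y $ i \<in> \<int>) \<and>
         norm_inf y \<le> 1 / 2 +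
           of_int \<lceil>3 / 2 * sqrt (2 * real d + 2) * norm2 t\<rceil> * ((2 * real d + 2) * basis_max_abs D q / \<epsilon>) \<and>
         ln (norm_inf y) \<le>
           13 * (1 + ln (real d) + ln (norm2 t) + ln (basis_max_abs D q) + ln (1 / \<epsilon>)))"
    by (intro allI impI, elim conjE) (rule integer_certificate[OF d])
qed

end
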